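(* Let $M$ be either $B_n^+$ or $B_n^{+*}$ ($n\ge2$). For a real $p\ge0$, there exists a uniform measure of parameter $p$ on $\overline M$ if and only if $p\in[0,q_n]\cup\{1\}$, and for each such $p$ it is unique; denote it $\nu_p$. Moreover: (1) $\nu_0$ is the Dirac measure at $\mathbf e$. (2) $\nu_1$ is the Dirac measure at the element $\Delta^\infty\in\overline M$, the constant sequence $(\Delta,\Delta,\dots)$. (3) For $p\in(0,q_n)$, $\nu_p$ is supported by $M$, and it is characterized equivalently by $\nu_p(\{x\})=H_n(p)\,p^{|x|}$ for all $x\in M$, or by $\nu_p(\Uparrow x)=p^{|x|}$ for all $x\in M$. (4) For $p=q_n$, $\nu_{q_n}$ is supported by $\partial M$, and it is the unique probability measure on $\overline M$ satisfying $\nu_{q_n}(\uparrow x)=q_n^{|x|}$ for all $x\in M$.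
   Context: $M$ is either (a) the positive braid monoid $B_n^+$, generated by $\Sigma=\{\sigma_1,\dots,\sigma_{n-1}\}$ with relations $\sigma_i\sigma_j=\sigma_j\sigma_i$ for $|i-j|\ge2$, $\sigma_i\sigma_j\sigma_i=\sigma_j\sigma_i\sigma_j$ for $|i-j|=1$; or (b) the dual braid monoid $B_n^{+*}$, generated by $\Sigma=\{\sigma_{i,j}:1\le i<j\le n\}$ ($\sigma_{j,i}=\sigma_{i,j}$) with relations $\sigma_{i,j}\sigma_{j,k}=\sigma_{j,k}\sigma_{k,i}=\sigma_{k,i}\sigma_{i,j}$ for $i<j<k$ and $\sigma_{i,j}\sigma_{k,\ell}=\sigma_{k,\ell}\sigma_{i,j}$ whenever $i<j<k<\ell$ or $i<k<\ell<j$. Unit $\mathbf e$; $|x|$ word length; $x\le_l y$ iff $y=xz$. $M$ is a Garside monoid; $\Delta_X$ is the least upper bound of $X\subseteq\Sigma$ for $\le_l$, $\Delta=\Delta_\Sigma$, $\mathcal S_n$ the set of left divisors of $\Delta$. For $x\in\mathcal S_n$, $\mathsf R(x)=\{\sigma\in\Sigma:x\sigma\notin\mathcal S_n\}$, $\mathsf L(x)=\{\sigma\in\Sigma:\sigma\le_l x\}$, $x\to y$ iff $\mathsf L(y)\subseteq\mathsf R(x)$. Every $x\neq\mathbf e$ has a unique Garside normal form $(x_1,\dots,x_k)$ (non-unit simple braids, $x=x_1\cdots x_k$, $x_i\to x_{i+1}$); the normal form of $\mathbf e$ is $(\mathbf e)$. $G_n(t)=\sum_{x\in M}t^{|x|}$,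 $H_n(t)=\sum_{X\subseteq\Sigma}(-1)^{|X|}t^{|\Delta_X|}$ (so that $G_n=1/H_n$), and $q_n$ is the radius of convergence of $G_n$. $\overline M$ is the set of sequences $(\xi_k)_{k\ge1}$ in $\mathcal S_n$ with $\xi_k\to\xi_{k+1}$ for all $k$, with product topology ($\mathcal S_n$ discrete) and Borel $\sigma$-algebra; $M$ is identified with sequences eventually equal to $\mathbf e$ via $x\mapsto$ its normal form followed by infinitely many $\mathbf e$; $\partial M=\overline M\setminus M$. $\Uparrow x$ is the closure in $\overline M$ of $\{xz:z\in M\}$ and $\uparrow x=\Uparrow x\cap\partial M$. A uniform measure of parameter $p\ge0$ is a probability measure $\nu$ on $\overline M$ with $\nu(\Uparrow x)=p^{|x|}$ for all $x\in M$. *)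

theory Defs
  imports "HOL-Analysis.Analysis" "HOL-Probability.Probability"
begin

text \<open>Which monoid: the positive braid monoid (Artin) or the dual braid monoid (Dual).
  A generator is encoded as a pair (i,j) with i<j: sigma_i of B_n^+ is (i,i+1),
  sigma_{i,j} of the dual monoid is (min i j, max i j).\<close>

datatype mkind = Artin | Dual

type_synonym gen = "nat \<times> nat"
type_synonym elt = "gen list set"

definition sg :: "nat \<Rightarrow> nat \<Rightarrow> gen" where
  "sg i j = (min i j, max i j)"

definition gens :: "mkind \<Rightarrow> nat \<Rightarrow> gen set" where
  "gens k n = (case k of
      Artin \<Rightarrow> {(i, i + 1) | i. 1 \<le> i \<and> i + 1 \<le> n}
    | Dual \<Rightarrow> {(i, j) | i j. 1 \<le> i \<and> i < j \<and> j \<le> n})"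

definition rels :: "mkind \<Rightarrow> nat \<Rightarrow> (gen list \<times> gen list) set" where
  "rels k n = (case k of
      Artin \<Rightarrow>
        {([(i, i+1), (j, j+1)], [(j, j+1), (i, i+1)]) | i j.
            1 \<le> i \<and> i < n \<and> 1 \<le> j \<and> j < n \<and> (i + 2 \<le> j \<or> j + 2 \<le> i)}
        \<union> {([(i, i+1), (j, j+1), (i, i+1)], [(j, j+1), (i, i+1), (j, j+1)]) | i j.
            1 \<le> i \<and> i < n \<and> 1 \<le> j \<and> j < n \<and> (i = j + 1 \<or> j = i + 1)}
    | Dual \<Rightarrow>
        {([sg i j, sg j k], [sg j k, sg k i]) | i j k. 1 \<le> i \<and> i < j \<and> j < k \<and> k \<le> n}
        \<union> {([sg j k, sg k i], [sg k i, sg i j]) | i j k. 1 \<le> i \<and> i < j \<and> j < k \<and> k \<le> n}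
        \<union> {([sg i j, sg k l], [sg k l, sg i j]) | i j k l.
            1 \<le> i \<and> i < j \<and> j \<le> n \<and> 1 \<le> k \<and> k < l \<and> l \<le> n \<and>
            ((i < j \<and> j < k \<and> k < l) \<or> (i < k \<and> k < l \<and> l < j))})"

inductive beq :: "(gen list \<times> gen list) set \<Rightarrow> gen list \<Rightarrow> gen list \<Rightarrow> bool" for R where
  beq_refl: "beq R w w"
| beq_step: "\<lbrakk>(u, v) \<in> R \<or> (v, u) \<in> R; beq R w (a @ u @ b)\<rbrakk> \<Longrightarrow> beq R w (a @ v @ b)"

definition cls :: "mkind \<Rightarrow> nat \<Rightarrow> gen list \<Rightarrow> elt" where
  "cls k n w = {v. beq (rels k n) w v}"

definition Mon :: "mkind \<Rightarrow> nat \<Rightarrow> elt set" where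
  "Mon k n = cls k n ` lists (gens k n)"

definition unit_e :: "mkind \<Rightarrow> nat \<Rightarrow> elt" where
  "unit_e k n = cls k n []"

definition gel :: "mkind \<Rightarrow> nat \<Rightarrow> gen \<Rightarrow> elt" where
  "gel k n s = cls k n [s]"

definition mmul :: "mkind \<Rightarrow> nat \<Rightarrow> elt \<Rightarrow> elt \<Rightarrow> elt" where
  "mmul k n x y = cls k n ((SOME u. u \<in> x) @ (SOME v. v \<in> y))"

definition mprod :: "mkind \<Rightarrow> nat \<Rightarrow> elt list \<Rightarrow> elt" where
  "mprod k n xs = foldr (mmul k n) xs (unit_e k n)"

definition blen :: "elt \<Rightarrow> nat" where
  "blen x = (LEAST m. \<exists>w\<in>x. length w = m)"

definition ldiv :: "mkind \<Rightarrow> nat \<Rightarrow> elt \<Rightarrow> elt \<Rightarrow> bool" where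
  "ldiv k n x y \<longleftrightarrow> (\<exists>z \<in> Mon k n. y = mmul k n x z)"

definition DeltaX :: "mkind \<Rightarrow> nat \<Rightarrow> gen set \<Rightarrow> elt" where
  "DeltaX k n X = (THE d. d \<in> Mon k n \<and> (\<forall>s\<in>X. ldiv k n (gel k n s) d) \<and>
      (\<forall>m\<in>Mon k n. (\<forall>s\<in>X. ldiv k n (gel k n s) m) \<longrightarrow> ldiv k n d m))"

definition Delta :: "mkind \<Rightarrow> nat \<Rightarrow> elt" where
  "Delta k n = DeltaX k n (gens k n)"

definition Simples :: "mkind \<Rightarrow> nat \<Rightarrow> elt set" where
  "Simples k n = {x \<in> Mon k n. ldiv k n x (Delta k n)}"

definition Rset :: "mkind \<Rightarrow> nat \<Rightarrow> elt \<Rightarrow> gen set" where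
  "Rset k n x = {s \<in> gens k n. mmul k n x (gel k n s) \<notin> Simples k n}"

definition Lset :: "mkind \<Rightarrow> nat \<Rightarrow> elt \<Rightarrow> gen set" where
  "Lset k n x = {s \<in> gens k n. ldiv k n (gel k n s) x}"

definition arrow :: "mkind \<Rightarrow> nat \<Rightarrow> elt \<Rightarrow> elt \<Rightarrow> bool" where
  "arrow k n x y \<longleftrightarrow> Lset k n y \<subseteq> Rset k n x"

definition Mbar :: "mkind \<Rightarrow> nat \<Rightarrow> (nat \<Rightarrow> elt) set" where
  "Mbar k n = {\<xi>. (\<forall>i. \<xi> i \<in> Simples k n) \<and> (\<forall>i. arrow k n (\<xi> i) (\<xi> (Suc i)))}"

text \<open>Embedding of M into Mbar: the normal form padded with units.\<close>
definition nfs :: "mkind \<Rightarrow> nat \<Rightarrow> elt \<Rightarrow> (nat \<Rightarrow> elt)" where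
  "nfs k n x = (THE \<xi>. \<xi> \<in> Mbar k n \<and>
      (\<exists>N. (\<forall>i\<ge>N. \<xi> i = unit_e k n) \<and> mprod k n (map \<xi> [0..<N]) = x))"

definition Mimg :: "mkind \<Rightarrow> nat \<Rightarrow> (nat \<Rightarrow> elt) set" where
  "Mimg k n = nfs k n ` Mon k n"

definition bdry :: "mkind \<Rightarrow> nat \<Rightarrow> (nat \<Rightarrow> elt) set" where
  "bdry k n = Mbar k n - Mimg k n"

definition Tbar :: "mkind \<Rightarrow> nat \<Rightarrow> (nat \<Rightarrow> elt) topology" where
  "Tbar k n = subtopology (product_topology (\<lambda>_. discrete_topology (Simples k n)) UNIV) (Mbar k n)"

definition borel_of_top :: "'a topology \<Rightarrow> 'a measure" where
  "borel_of_top T = sigma (topspace T) {U. openin T U}"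

definition Bbar :: "mkind \<Rightarrow> nat \<Rightarrow> (nat \<Rightarrow> elt) measure" where
  "Bbar k n = borel_of_top (Tbar k n)"

definition Up :: "mkind \<Rightarrow> nat \<Rightarrow> elt \<Rightarrow> (nat \<Rightarrow> elt) set" where
  "Up k n x = Tbar k n closure_of {nfs k n (mmul k n x z) | z. z \<in> Mon k n}"

definition up :: "mkind \<Rightarrow> nat \<Rightarrow> elt \<Rightarrow> (nat \<Rightarrow> elt) set" where
  "up k n x = Up k n x \<inter> bdry k n"

definition prob_on :: "mkind \<Rightarrow> nat \<Rightarrow> (nat \<Rightarrow> elt) measure \<Rightarrow> bool" where
  "prob_on k n \<nu> \<longleftrightarrow> prob_space \<nu> \<and> sets \<nu> = sets (Bbar k n)"

definition uniform :: "mkind \<Rightarrow> nat \<Rightarrow> real \<Rightarrow> (nat \<Rightarrow> elt) measure \<Rightarrow> bool" where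
  "uniform k n p \<nu> \<longleftrightarrow> prob_on k n \<nu> \<and> (\<forall>x\<in>Mon k n. measure \<nu> (Up k n x) = p ^ blen x)"

definition qn :: "mkind \<Rightarrow> nat \<Rightarrow> real" where
  "qn k n = real_of_ereal (conv_radius (\<lambda>m. real (card {x \<in> Mon k n. blen x = m})))"

definition Hn :: "mkind \<Rightarrow> nat \<Rightarrow> real \<Rightarrow> real" where
  "Hn k n t = (\<Sum>X\<in>Pow (gens k n). (-1) ^ card X * t ^ blen (DeltaX k n X))"

end

theory Submission
  imports Defs
begin

text \<open>
  Both monoids are treated through a finite automaton describing their simple elements: permutations
  with bubble sort moves for \<open>B\<^sub>n\<^sup>+\<close>, noncrossing partitions cut along chords for the dual monoid. Joins of
  two atoms exist in this model, hence so do all joins of simple elements, and an induction on word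
  length then transfers joins and left cancellation to the presented monoid.

  Inclusion-exclusion shows that a uniform measure of parameter \<open>p\<close> gives the cylinder of a normal
  sequence \<open>(x\<^sub>1, \<dots>, x\<^sub>k)\<close> with product \<open>x\<close> the mass \<open>p\<^bsup>|x|\<^esup> g\<^sub>p(x\<^sub>k)\<close> for an explicit polynomial \<open>g\<^sub>p\<close> in \<open>p\<close>;
  this gives uniqueness, and \<open>g\<^sub>p(e) = H\<^sub>n(p)\<close>. For \<open>p < q\<^sub>n\<close> the measure with masses \<open>H\<^sub>n(p) p\<^bsup>|x|\<^esup>\<close> on \<open>M\<close> is
  uniform because \<open>G\<^sub>n H\<^sub>n = 1\<close>. At \<open>p = q\<^sub>n\<close> the polynomials \<open>g\<^sub>p\<close> are still nonnegative by continuity, and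
  they define a Markov chain on simple elements whose law is uniform. Submultiplicativity of the
  number of elements of given length makes \<open>G\<^sub>n\<close> diverge for \<open>p \<ge> q\<^sub>n\<close>, which forces \<open>H\<^sub>n(p) = 0\<close>.
  Finally, for \<open>q\<^sub>n < p < 1\<close> the graph of simple elements is connected enough to make \<open>g\<^sub>p\<close> positive off
  \<open>e\<close>, so that the sum of \<open>p\<^bsup>|x|\<^esup>\<close> over the \<open>x\<close> with \<open>k\<close> factors is bounded in \<open>k\<close>; comparing it with the
  same sum at \<open>q\<^sub>n\<close>, which is at least \<open>1\<close>, shows that it grows like \<open>(p / q\<^sub>n)\<^sup>k\<close>, a contradiction.
\<close>

section \<open>Words and their classes\<close>

text \<open>The monoids are given as classes of words, so neither left cancellation nor joins are
  available at the start, and each is needed to prove the other: both are carried together, bounded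
  by word length. In the dual monoid two crossing atoms head no common relation, so joins must be
  found in a lattice of simple elements and cannot be read off the relations. Right cancellation is
  never established in general; conjugation by \<open>Delta\<close> is shown bijective by counting
  elements of one length.

  On the measure side the obstacle is that \<open>Up\<close> is a closure. A product of
  \<open>j\<close> simple elements divides some partial product of a normal sequence only if it
  divides the \<open>j\<close>-th one, so \<open>Up\<close> is a finite union of cylinders;
  conversely a cylinder is \<open>Up\<close> minus finitely many smaller \<open>Up\<close>, since a
  normal product of \<open>r + 1\<close> nontrivial factors divides no normal product of
  \<open>r\<close> factors.

  The unit is the exceptional state: its weight \<open>H_n(p)\<close> vanishes for a uniform measure
  with \<open>p \<ge> q_n\<close>. The other weights are positive for \<open>p < 1\<close> because a
  vanishing weight would spread along arrows to a simple element of weight \<open>1\<close> or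
  \<open>1 - p\<close>.\<close>

lemma beq_trans: "beq R v w \<Longrightarrow> beq R u v \<Longrightarrow> beq R u w"
  by (induction rule: beq.induct) (auto intro: beq.beq_step)

lemma beq_sym: "beq R u v \<Longrightarrow> beq R v u"
proof (induction rule: beq.induct)
  case (beq_step u v w a b)
  have "beq R (a @ v @ b) (a @ u @ b)"
    using beq_step.hyps(1) by (intro beq.beq_step[where u=v and v=u]) (auto intro: beq.beq_refl)
  then show ?case using beq_step.IH beq_trans by blast
qed (rule beq.beq_refl)

lemma beq_context: "beq R u v \<Longrightarrow> beq R (a @ u @ b) (a @ v @ b)"
proof (induction rule: beq.induct)
  case (beq_step u v w a' b')
  then show ?case
    using beq.beq_step[of u v R "a @ w @ b" "a @ a'" "b' @ b"] by simp
qed (rule beq.beq_refl)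

lemma beq_append:
  assumes "beq R u u'" "beq R v v'"
  shows "beq R (u @ v) (u' @ v')"
proof -
  have "beq R (u @ v) (u' @ v)" "beq R (u' @ v) (u' @ v')"
    using beq_context[OF assms(1), of "[]" v] beq_context[OF assms(2), of u' "[]"] by simp_all
  then show ?thesis using beq_trans by blast
qed

text \<open>Homogeneity makes \<open>blen\<close> a genuine length; the bound \<open>2\<close> keeps
  distinct atoms from being identified.\<close>

lemma rels_homogeneous:
  assumes "(u, v) \<in> rels k n"
  shows "length u = length v" "u \<in> lists (gens k n)" "v \<in> lists (gens k n)" "u \<noteq> []" "v \<noteq> []" "2 \<le> length u"
proof -
  have "length u = length v \<and> u \<in> lists (gens k n) \<and> v \<in> lists (gens k n) \<and> 2 \<le> length u"
  proof (cases k)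
    case Artin
    show ?thesis using assms unfolding Artin rels_def gens_def mkind.case by (elim UnE) auto
  next
    case Dual
    show ?thesis using assms unfolding Dual rels_def gens_def mkind.case
      by (elim UnE) (auto simp: sg_def min_def max_def)
  qed
  then show "length u = length v" "u \<in> lists (gens k n)" "v \<in> lists (gens k n)" "u \<noteq> []" "v \<noteq> []" "2 \<le> length u"
    by auto
qed

lemma beq_length: "beq (rels k n) u v \<Longrightarrow> length u = length v"
  by (induction rule: beq.induct) (auto dest: rels_homogeneous(1))

lemma beq_lists: "beq (rels k n) u v \<Longrightarrow> u \<in> lists (gens k n) \<longleftrightarrow> v \<in> lists (gens k n)"
  by (induction rule: beq.induct) (auto dest: rels_homogeneous(2,3))

lemma finite_gens [simp]: "finite (gens k n)"
proof -
  have "gens k n \<subseteq> {..n} \<times> {..n}" by (cases k) (auto simp: gens_def)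
  then show ?thesis by (rule finite_subset) simp
qed

section \<open>Product, length and left divisibility\<close>

locale braid =
  fixes k :: mkind and n :: nat
begin

abbreviation "M \<equiv> Mon k n"
abbreviation "\<Sigma> \<equiv> gens k n"
abbreviation "E \<equiv> unit_e k n"
abbreviation "g \<equiv> gel k n"
abbreviation mult (infixl \<open>\<odot>\<close> 70) where "x \<odot> y \<equiv> mmul k n x y"
abbreviation dvs (infix \<open>\<preceq>\<close> 50) where "x \<preceq> y \<equiv> ldiv k n x y"
abbreviation "W \<equiv> cls k n"
abbreviation weq (infix \<open>\<doteq>\<close> 50) where "u \<doteq> v \<equiv> beq (rels k n) u v"

lemma W_eq_iff: "W u = W v \<longleftrightarrow> u \<doteq> v"
proof
  assume "W u = W v"
  then have "v \<in> W u" by (simp add: cls_def beq.beq_refl)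
  then show "u \<doteq> v" by (simp add: cls_def)
next
  assume uv: "u \<doteq> v"
  have "u \<doteq> w \<longleftrightarrow> v \<doteq> w" for w
    using beq_trans[OF _ uv] beq_trans[OF _ beq_sym[OF uv]] by blast
  then show "W u = W v" by (simp add: cls_def)
qed

lemma some_in_W: "u \<doteq> (SOME v. v \<in> W u)"
  by (rule someI2[of _ u]) (auto simp: cls_def beq.beq_refl)

lemma W_append: "W u \<odot> W v = W (u @ v)"
  unfolding mmul_def W_eq_iff by (intro beq_append beq_sym[OF some_in_W])

lemma blen_W [simp]: "blen (W w) = length w"
proof -
  have "(\<exists>v\<in>W w. length v = m) \<longleftrightarrow> m = length w" for m
    by (auto simp: cls_def dest: beq_length intro: exI[of _ w] beq.beq_refl)
  then show ?thesis unfolding blen_def by (auto intro: Least_equality)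
qed

lemma in_M_cases: assumes "x \<in> M" obtains w where "w \<in> lists \<Sigma>" "x = W w"
  using assms unfolding Mon_def by blast

lemma W_in_M [simp]: "W w \<in> M \<longleftrightarrow> w \<in> lists \<Sigma>"
proof
  assume "W w \<in> M"
  then obtain v where "v \<in> lists \<Sigma>" "W w = W v" unfolding Mon_def by auto
  then show "w \<in> lists \<Sigma>" using beq_lists by (simp only: W_eq_iff)
qed (simp add: Mon_def)

lemma E_in_M [simp]: "E \<in> M" and g_in_M [simp]: "s \<in> \<Sigma> \<Longrightarrow> g s \<in> M"
  by (auto simp: unit_e_def gel_def)

lemma mult_in_M [simp]: "x \<in> M \<Longrightarrow> y \<in> M \<Longrightarrow> x \<odot> y \<in> M"
  by (elim in_M_cases) (simp add: W_append)

lemma mult_assoc: "x \<in> M \<Longrightarrow> y \<in> M \<Longrightarrow> z \<in> M \<Longrightarrow> x \<odot> y \<odot> z = x \<odot> (y \<odot> z)"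
  by (elim in_M_cases) (simp add: W_append)

lemma E_left [simp]: "x \<in> M \<Longrightarrow> E \<odot> x = x" and E_right [simp]: "x \<in> M \<Longrightarrow> x \<odot> E = x"
  by (auto elim!: in_M_cases simp: unit_e_def W_append)

lemma W_Cons: "W (s # w) = g s \<odot> W w"
  by (simp add: gel_def W_append)

lemma blen_mult [simp]: "x \<in> M \<Longrightarrow> y \<in> M \<Longrightarrow> blen (x \<odot> y) = blen x + blen y"
  by (elim in_M_cases) (simp add: W_append)

lemma blen_E [simp]: "blen E = 0" and blen_g [simp]: "blen (g s) = 1"
  by (auto simp: unit_e_def gel_def)

lemma blen_0_iff [simp]: "x \<in> M \<Longrightarrow> blen x = 0 \<longleftrightarrow> x = E"
  by (elim in_M_cases) (auto simp: unit_e_def W_eq_iff dest: beq_length intro: beq.beq_refl)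

lemma M_decomp:
  assumes "x \<in> M" "x \<noteq> E"
  obtains s y where "s \<in> \<Sigma>" "y \<in> M" "x = g s \<odot> y"
proof -
  obtain w where w: "w \<in> lists \<Sigma>" "x = W w" using assms(1) by (rule in_M_cases)
  then obtain s v where "w = s # v" using assms(2) by (cases w) (auto simp: unit_e_def)
  then show ?thesis using w that[of s "W v"] by (simp add: W_Cons)
qed

lemma M_induct [consumes 1, case_names E gen]:
  assumes "x \<in> M" "Q E" "\<And>s y. s \<in> \<Sigma> \<Longrightarrow> y \<in> M \<Longrightarrow> Q y \<Longrightarrow> Q (g s \<odot> y)"
  shows "Q x"
proof -
  obtain w where w: "w \<in> lists \<Sigma>" "x = W w" using assms(1) by (rule in_M_cases)
  have "Q (W w)" using w(1)
    by (induction w) (use assms(2,3) in \<open>auto simp: W_Cons, auto simp: unit_e_def\<close>)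
  then show ?thesis using w by simp
qed

lemma finite_M_blen: "finite {x \<in> M. blen x = m}"
proof -
  have "{x \<in> M. blen x = m} \<subseteq> W ` {w. set w \<subseteq> \<Sigma> \<and> length w = m}"
  proof
    fix x assume x: "x \<in> {x \<in> M. blen x = m}"
    then obtain w where "w \<in> lists \<Sigma>" "x = W w" by (auto elim: in_M_cases)
    then show "x \<in> W ` {w. set w \<subseteq> \<Sigma> \<and> length w = m}" using x by (auto simp: lists_eq_set)
  qed
  then show ?thesis by (rule finite_subset) (simp add: finite_lists_length_eq)
qed

lemma countable_M: "countable M"
  unfolding Mon_def by (intro countable_image) (simp add: countable_lists countable_finite)

lemma dvsI [intro]: "z \<in> M \<Longrightarrow> x \<preceq> x \<odot> z"
  unfolding ldiv_def by blast

lemma dvsE: assumes "x \<preceq> y" obtains z where "z \<in> M" "y = x \<odot> z"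
  using assms unfolding ldiv_def by blast

lemma dvs_refl [simp]: "x \<in> M \<Longrightarrow> x \<preceq> x"
  using dvsI[of E x] by simp

lemma E_dvs [simp]: "x \<in> M \<Longrightarrow> E \<preceq> x"
  using dvsI[of x E] by simp

lemma dvs_trans: "x \<in> M \<Longrightarrow> x \<preceq> y \<Longrightarrow> y \<preceq> z \<Longrightarrow> x \<preceq> z"
  by (elim dvsE) (auto simp: mult_assoc)

lemma dvs_blen: "x \<in> M \<Longrightarrow> x \<preceq> y \<Longrightarrow> blen x \<le> blen y"
  by (elim dvsE) auto

lemma dvs_eq: "x \<in> M \<Longrightarrow> x \<preceq> y \<Longrightarrow> blen y \<le> blen x \<Longrightarrow> x = y"
  by (elim dvsE) auto

lemma dvs_antisym: "x \<in> M \<Longrightarrow> y \<in> M \<Longrightarrow> x \<preceq> y \<Longrightarrow> y \<preceq> x \<Longrightarrow> x = y"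
  using dvs_blen dvs_eq by blast

lemma dvs_mult_left: "a \<in> M \<Longrightarrow> x \<in> M \<Longrightarrow> x \<preceq> y \<Longrightarrow> a \<odot> x \<preceq> a \<odot> y"
  by (elim dvsE) (auto simp flip: mult_assoc)

lemma dvs_mult: "x \<in> M \<Longrightarrow> x \<preceq> y \<Longrightarrow> z \<in> M \<Longrightarrow> x \<preceq> y \<odot> z"
  by (elim dvsE) (auto simp: mult_assoc)

text \<open>No relation can be applied to a word of length one, as both sides have length at least
  two.\<close>

lemma g_inj: "g s = g t \<longleftrightarrow> s = t"
proof -
  have "u \<doteq> v \<Longrightarrow> length u = 1 \<Longrightarrow> u = v" for u v
  proof (induction rule: beq.induct)
    case (beq_step u v w a b)
    then have "2 \<le> length u" using rels_homogeneous(1,6) by metis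
    moreover have "length (a @ u @ b) = 1" using beq_step by simp
    ultimately show ?case by simp
  qed simp
  from this[of "[s]" "[t]"] show ?thesis unfolding gel_def W_eq_iff by (auto intro: beq.beq_refl)
qed

end

section \<open>Lattices of simple elements\<close>

text \<open>Everything is assumed relative to \<open>P\<close>: cancellation only for products in
  \<open>P\<close>, minimality of joins only against elements of \<open>P\<close>. By
  \<open>rel_join\<close> the common value of a relation is the join of its two first letters;
  \<open>atom_join\<close> also covers pairs of atoms that head no relation.\<close>

locale simple_family = braid +
  fixes P :: "elt set" and \<delta> :: elt
  assumes P_sub: "P \<subseteq> M"
    and P_factors: "\<And>a b. a \<in> M \<Longrightarrow> b \<in> M \<Longrightarrow> a \<odot> b \<in> P \<Longrightarrow> a \<in> P \<and> b \<in> P"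
    and P_cancel: "\<And>a b b'. a \<in> M \<Longrightarrow> b \<in> M \<Longrightarrow> b' \<in> M \<Longrightarrow> a \<odot> b \<in> P \<Longrightarrow> a \<odot> b = a \<odot> b' \<Longrightarrow> b = b'"
    and \<delta>_P: "\<delta> \<in> P" and P_dvs_\<delta>: "\<And>x. x \<in> P \<Longrightarrow> x \<preceq> \<delta>"
    and g_dvs_\<delta>: "\<And>s. s \<in> \<Sigma> \<Longrightarrow> g s \<preceq> \<delta>"
    and \<delta>_unique: "\<And>x. x \<in> P \<Longrightarrow> (\<And>s. s \<in> \<Sigma> \<Longrightarrow> g s \<preceq> x) \<Longrightarrow> x = \<delta>"
    and atom_join: "\<And>s t. s \<in> \<Sigma> \<Longrightarrow> t \<in> \<Sigma> \<Longrightarrow>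
      \<exists>j\<in>P. g s \<preceq> j \<and> g t \<preceq> j \<and> (\<forall>x\<in>P. g s \<preceq> x \<longrightarrow> g t \<preceq> x \<longrightarrow> j \<preceq> x)"
    and rel_join: "\<And>s t u v x. (s # u, t # v) \<in> rels k n \<Longrightarrow>
      W (s # u) \<in> P \<and> (x \<in> P \<longrightarrow> g s \<preceq> x \<longrightarrow> g t \<preceq> x \<longrightarrow> W (s # u) \<preceq> x)"
begin

lemma P_M [simp]: "x \<in> P \<Longrightarrow> x \<in> M" using P_sub by blast

lemma \<delta>_M [simp]: "\<delta> \<in> M" using \<delta>_P by simp

lemma P_iff: "x \<in> P \<longleftrightarrow> x \<in> M \<and> x \<preceq> \<delta>"
proof
  assume "x \<in> M \<and> x \<preceq> \<delta>"
  then obtain z where "x \<in> M" "z \<in> M" "\<delta> = x \<odot> z" by (auto elim: dvsE)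
  then show "x \<in> P" using P_factors \<delta>_P by metis
qed (simp add: P_dvs_\<delta>)

lemma P_dvs: "x \<in> M \<Longrightarrow> x \<preceq> y \<Longrightarrow> y \<in> P \<Longrightarrow> x \<in> P"
  using P_iff dvs_trans by blast

lemma g_P [simp]: "s \<in> \<Sigma> \<Longrightarrow> g s \<in> P" using P_iff g_dvs_\<delta> by simp

lemma E_P [simp]: "E \<in> P" using P_iff by simp

lemma P_dvs_cancel:
  assumes "a \<in> M" "x \<in> M" "y \<in> M" "a \<odot> y \<in> P" "a \<odot> x \<preceq> a \<odot> y"
  shows "x \<preceq> y"
proof -
  obtain z where z: "z \<in> M" "a \<odot> y = a \<odot> x \<odot> z" using assms(5) by (rule dvsE)
  then have "a \<odot> y = a \<odot> (x \<odot> z)" using assms by (simp add: mult_assoc)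
  then have "y = x \<odot> z" using P_cancel assms z by (metis mult_in_M)
  then show ?thesis using z by auto
qed

section \<open>Joins inside the set of simple elements\<close>

definition lub :: "elt \<Rightarrow> elt \<Rightarrow> elt \<Rightarrow> bool" where
  "lub x y j \<longleftrightarrow> j \<in> P \<and> x \<preceq> j \<and> y \<preceq> j \<and> (\<forall>z\<in>P. x \<preceq> z \<longrightarrow> y \<preceq> z \<longrightarrow> j \<preceq> z)"

lemma lub_unique: "lub x y i \<Longrightarrow> lub x y j \<Longrightarrow> i = j"
  unfolding lub_def by (meson P_M dvs_antisym)

text \<open>Dividing an upper bound in \<open>P\<close> by \<open>a\<close> gives an upper bound of
  \<open>x\<close> and \<open>y\<close> in \<open>P\<close>. The bound \<open>z\<close> is what
  keeps \<open>a \<odot> j\<close> inside \<open>P\<close>.\<close>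

lemma lub_translate:
  assumes a: "a \<in> M" and xy: "x \<in> M" "y \<in> M" "j \<in> M"
    and j: "lub x y j" and ub: "z \<in> P" "a \<odot> x \<preceq> z" "a \<odot> y \<preceq> z"
  shows "lub (a \<odot> x) (a \<odot> y) (a \<odot> j)"
proof -
  have main: "a \<odot> j \<preceq> w" if w: "w \<in> P" "a \<odot> x \<preceq> w" "a \<odot> y \<preceq> w" for w
  proof -
    obtain w' where w': "w' \<in> M" "w = a \<odot> x \<odot> w'" using w(2) by (rule dvsE)
    define v where "v = x \<odot> w'"
    have v: "v \<in> M" "w = a \<odot> v" using w' a xy unfolding v_def by (auto simp: mult_assoc)
    have "v \<in> P" using P_factors[OF a v(1)] w(1) v(2) by auto
    moreover have "x \<preceq> v" "y \<preceq> v" using P_dvs_cancel[OF a _ v(1)] w v xy by auto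
    ultimately have "j \<preceq> v" using j unfolding lub_def by blast
    then show ?thesis using v a xy by (auto intro: dvs_mult_left)
  qed
  have "a \<odot> j \<in> P" using P_dvs[OF _ main[OF ub]] ub a xy by simp
  then show ?thesis
    using main j a xy unfolding lub_def by (auto intro: dvs_mult_left)
qed

lemma atom_lub: "s \<in> \<Sigma> \<Longrightarrow> t \<in> \<Sigma> \<Longrightarrow> \<exists>j. lub (g s) (g t) j"
  using atom_join unfolding lub_def by blast

text \<open>Joins of atoms give all joins, by induction on the distance from a common divisor
  \<open>z\<close> up to \<open>\<delta>\<close>.\<close>

lemma P_lub_above:
  assumes "z \<in> P" "u \<in> P" "v \<in> P" "z \<preceq> u" "z \<preceq> v"
  shows "\<exists>j. lub u v j"
  using assms
proof (induction "blen \<delta> - blen z" arbitrary: z u v rule: less_induct)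
  case less
  show ?case
  proof (cases "z = u \<or> z = v")
    case True
    then show ?thesis
      using less.prems unfolding lub_def by (metis P_M dvs_refl)
  next
    case False
    obtain u' where u': "u' \<in> M" "u = z \<odot> u'" using less.prems(4) by (rule dvsE)
    obtain v' where v': "v' \<in> M" "v = z \<odot> v'" using less.prems(5) by (rule dvsE)
    obtain s u2 where s: "s \<in> \<Sigma>" "u2 \<in> M" "u' = g s \<odot> u2"
      using M_decomp[OF u'(1)] u' False less.prems(1) by (metis E_right P_M)
    obtain t v2 where t: "t \<in> \<Sigma>" "v2 \<in> M" "v' = g t \<odot> v2"
      using M_decomp[OF v'(1)] v' False less.prems(1) by (metis E_right P_M)
    have zM: "z \<in> M" using less.prems by simp
    have su: "z \<odot> g s \<preceq> u" using u' s zM by (auto simp flip: mult_assoc)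
    have tv: "z \<odot> g t \<preceq> v" using v' t zM by (auto simp flip: mult_assoc)
    obtain j0 where j0: "lub (g s) (g t) j0" using atom_lub s t by blast
    have j0M: "j0 \<in> M" using j0 unfolding lub_def by simp
    define j where "j = z \<odot> j0"
    have zsM: "z \<odot> g s \<in> M" "z \<odot> g t \<in> M" using zM s t by auto
    have ubd: "z \<odot> g s \<preceq> \<delta>" "z \<odot> g t \<preceq> \<delta>"
      using su tv dvs_trans zsM P_dvs_\<delta> less.prems by blast+
    have j: "lub (z \<odot> g s) (z \<odot> g t) j"
      unfolding j_def using lub_translate[OF zM _ _ j0M j0 \<delta>_P ubd] s t by simp
    have zsP: "z \<odot> g s \<in> P" "z \<odot> g t \<in> P" using ubd zsM P_iff by auto
    have lt: "blen \<delta> - blen (z \<odot> g s) < blen \<delta> - blen z" "blen \<delta> - blen (z \<odot> g t) < blen \<delta> - blen z"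
      using dvs_blen[OF zsM(1) ubd(1)] dvs_blen[OF zsM(2) ubd(2)] zM s t by auto
    have jP: "j \<in> P" using j unfolding lub_def by blast
    \<comment> \<open>The pair \<open>u\<close>, \<open>j\<close> has the longer common divisor
      \<open>z \<odot> g s\<close>; afterwards \<open>a\<close>, \<open>v\<close> have
      \<open>z \<odot> g t\<close>. These are the two appeals to the induction hypothesis.\<close>
    obtain a where a: "lub u j a"
      using less.hyps[OF lt(1) zsP(1) less.prems(2) jP su] j unfolding lub_def by blast
    have aP: "a \<in> P" "j \<preceq> a" "u \<preceq> a" using a unfolding lub_def by auto
    have "z \<odot> g t \<preceq> a" using j aP dvs_trans zsM unfolding lub_def by blast
    then obtain b where b: "lub a v b"
      using less.hyps[OF lt(2) zsP(2) aP(1) less.prems(3)] tv by blast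
    have "lub u v b"
    proof -
      have "u \<preceq> b" using b aP dvs_trans less.prems(2) unfolding lub_def by (meson P_M)
      moreover have "b \<preceq> w" if w: "w \<in> P" "u \<preceq> w" "v \<preceq> w" for w
      proof -
        have "z \<odot> g s \<preceq> w" "z \<odot> g t \<preceq> w" using su tv w dvs_trans zsM by blast+
        then have "j \<preceq> w" using j w unfolding lub_def by blast
        then have "a \<preceq> w" using a w unfolding lub_def by blast
        then show ?thesis using b w unfolding lub_def by blast
      qed
      ultimately show ?thesis using b unfolding lub_def by blast
    qed
    then show ?thesis by blast
  qed
qed

lemma P_lub: "u \<in> P \<Longrightarrow> v \<in> P \<Longrightarrow> \<exists>j. lub u v j"
  using P_lub_above[of E u v] by simp

section \<open>Transfer of cancellation and joins to the whole monoid\<close>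

definition cancel_upto :: "nat \<Rightarrow> bool" where
  "cancel_upto N \<longleftrightarrow> (\<forall>s a b. s \<in> \<Sigma> \<longrightarrow> a \<in> M \<longrightarrow> b \<in> M \<longrightarrow> g s \<odot> a = g s \<odot> b \<longrightarrow> blen a < N \<longrightarrow> a = b)"

text \<open>The index bounds the length of the whole element \<open>m\<close>; in
  \<open>cancel_upto\<close> it likewise bounds that of \<open>g s \<odot> a\<close>, hence the
  strict inequality for \<open>a\<close> there.\<close>

definition lub_upto :: "nat \<Rightarrow> bool" where
  "lub_upto N \<longleftrightarrow> (\<forall>s t m j. s \<in> \<Sigma> \<longrightarrow> t \<in> \<Sigma> \<longrightarrow> m \<in> M \<longrightarrow> blen m \<le> N \<longrightarrow>
     g s \<preceq> m \<longrightarrow> g t \<preceq> m \<longrightarrow> lub (g s) (g t) j \<longrightarrow> j \<preceq> m)"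

lemma cancel_upto_mult:
  assumes "cancel_upto N" "x \<in> M" "a \<in> M" "b \<in> M" "x \<odot> a = x \<odot> b" "blen (x \<odot> a) \<le> N"
  shows "a = b"
  using assms(2-)
proof (induction x rule: M_induct)
  case (gen s y)
  then have "g s \<odot> (y \<odot> a) = g s \<odot> (y \<odot> b)" by (simp add: mult_assoc)
  moreover have "blen (g s \<odot> y \<odot> a) = Suc (blen (y \<odot> a))" using gen(1,2,4) by simp
  then have "blen (y \<odot> a) < N" using gen.prems(4) by simp
  ultimately have "y \<odot> a = y \<odot> b" using assms(1) gen unfolding cancel_upto_def by (meson mult_in_M)
  then show ?case using gen by auto
qed simp

text \<open>A first atom shared by \<open>x\<close> and \<open>y\<close> is cancelled, and the
  induction hypothesis is applied to the shorter \<open>m\<close>. In general the join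
  \<open>j0\<close> of the first atoms divides \<open>m\<close> by \<open>lub_upto\<close>, and it
  shares a first atom with each of \<open>x\<close> and \<open>y\<close>.\<close>

lemma lub_upto_P:
  assumes N: "cancel_upto N" "lub_upto N"
  shows "x \<in> P \<Longrightarrow> y \<in> P \<Longrightarrow> lub x y j \<Longrightarrow> m \<in> M \<Longrightarrow> blen m \<le> N \<Longrightarrow> x \<preceq> m \<Longrightarrow> y \<preceq> m \<Longrightarrow> j \<preceq> m"
proof (induction "blen m" arbitrary: x y j m rule: less_induct)
  case less
  have step: "i \<preceq> m" if h: "s \<in> \<Sigma>" "x \<in> P" "y \<in> P" "lub x y i" "x \<preceq> m" "y \<preceq> m" "g s \<preceq> x" "g s \<preceq> y" for s x y i
  proof -
    obtain x' where x': "x' \<in> M" "x = g s \<odot> x'" using h(7) by (rule dvsE)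
    obtain y' where y': "y' \<in> M" "y = g s \<odot> y'" using h(8) by (rule dvsE)
    have "g s \<preceq> m" using h dvs_trans g_in_M by blast
    then obtain m' where m': "m' \<in> M" "m = g s \<odot> m'" by (rule dvsE)
    have P': "x' \<in> P" "y' \<in> P" using P_factors x' y' h by (metis g_in_M)+
    obtain i' where i': "lub x' y' i'" using P_lub[OF P'] by blast
    have c: "z' \<preceq> m'" if z': "z' \<in> M" "g s \<odot> z' \<preceq> m" for z'
    proof -
      obtain w where w: "w \<in> M" "m = g s \<odot> z' \<odot> w" using z'(2) by (rule dvsE)
      have "m' = z' \<odot> w"
        using cancel_upto_mult[OF N(1), of "g s" m' "z' \<odot> w"] w m' z' h(1) less.prems(5) by (auto simp: mult_assoc)
      then show ?thesis using w by auto
    qed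
    have "i' \<preceq> m'"
      by (rule less.hyps[OF _ P' i' m'(1)]) (use m' h(1) less.prems(5) c x' y' h in auto)
    moreover have i'M: "i' \<in> M" using i' unfolding lub_def by simp
    ultimately have "g s \<odot> i' \<preceq> m" using m' h(1) by (auto intro: dvs_mult_left)
    moreover have "lub x y (g s \<odot> i')"
      using lub_translate[OF _ x'(1) y'(1) i'M i', of "g s" i] x' y' h unfolding lub_def by auto
    ultimately show ?thesis using lub_unique h(4) by blast
  qed
  show ?case
  proof (cases "x = E \<or> y = E")
    case True
    have "lub x y (if x = E then y else x)"
      using True less.prems(1,2) unfolding lub_def by (auto split: if_splits)
    then have "j = (if x = E then y else x)" using lub_unique less.prems(3) by blast
    then show ?thesis using less.prems(6,7) by (simp split: if_splits)
  next
    case False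
    obtain s x' where s: "s \<in> \<Sigma>" "x' \<in> M" "x = g s \<odot> x'" using False less.prems(1) M_decomp P_M by metis
    obtain t y' where t: "t \<in> \<Sigma>" "y' \<in> M" "y = g t \<odot> y'" using False less.prems(2) M_decomp P_M by metis
    have sx: "g s \<preceq> x" "g t \<preceq> y" using s t by auto
    have sm: "g s \<preceq> m" "g t \<preceq> m" using sx s t less.prems dvs_trans g_in_M by blast+
    obtain j0 where j0: "lub (g s) (g t) j0" using atom_lub s t by blast
    then have j0m: "j0 \<preceq> m" using N(2) s t sm less.prems unfolding lub_upto_def by blast
    have j0P: "j0 \<in> P" "g s \<preceq> j0" "g t \<preceq> j0" using j0 unfolding lub_def by auto
    obtain a where a: "lub x j0 a" using P_lub less.prems j0P by blast
    have am: "a \<preceq> m" using step[OF s(1) less.prems(1) j0P(1) a less.prems(6) j0m sx(1) j0P(2)] .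
    have aP: "a \<in> P" "j0 \<preceq> a" "x \<preceq> a" using a unfolding lub_def by auto
    have ta: "g t \<preceq> a" using j0P aP dvs_trans t by (meson g_in_M)
    obtain b where b: "lub a y b" using P_lub less.prems aP by blast
    have bm: "b \<preceq> m" using step[OF t(1) aP(1) less.prems(2) b am less.prems(7) ta sx(2)] .
    have jP: "j \<in> P" "x \<preceq> j" "y \<preceq> j" using less.prems(3) unfolding lub_def by auto
    have bP: "b \<in> P" "a \<preceq> b" "y \<preceq> b" using b unfolding lub_def by auto
    have "x \<preceq> b" using aP bP dvs_trans less.prems(1) by (meson P_M)
    then have "j \<preceq> b" using less.prems(3) bP unfolding lub_def by blast
    then show ?thesis using bm dvs_trans jP by (meson P_M)
  qed
qed

lemma rel_lub:
  assumes "(s # u, t # v) \<in> rels k n \<or> (t # v, s # u) \<in> rels k n"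
  shows "lub (g s) (g t) (W (s # u))" "W (s # u) = W (t # v)"
    "s \<in> \<Sigma>" "t \<in> \<Sigma>" "u \<in> lists \<Sigma>" "v \<in> lists \<Sigma>"
proof -
  show eq: "W (s # u) = W (t # v)"
    using assms beq.beq_step[of "s # u" "t # v" "rels k n" "s # u" "[]" "[]"] beq.beq_refl
    unfolding W_eq_iff by auto
  show *: "s \<in> \<Sigma>" "t \<in> \<Sigma>" "u \<in> lists \<Sigma>" "v \<in> lists \<Sigma>"
    using assms by (auto dest: rels_homogeneous(2,3))
  have "g s \<preceq> W (s # u)" "g t \<preceq> W (s # u)"
    using dvsI[of "W u" "g s"] dvsI[of "W v" "g t"] * eq by (simp_all add: W_Cons)
  then show "lub (g s) (g t) (W (s # u))"
    using assms rel_join[of s u t v] rel_join[of t v s u] eq unfolding lub_def by auto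
qed

text \<open>The step where a defining relation is applied at the head of the
  word is a cube condition, which holds because any three simple elements have a join in \<open>P\<close>.\<close>

lemma word_chain:
  assumes N: "cancel_upto N" "lub_upto N"
    and "w \<doteq> w'" "w = s # x" "w \<in> lists \<Sigma>" "length w = Suc N"
  shows "\<exists>t y a b z j. w' = t # y \<and> t \<in> \<Sigma> \<and> y \<in> lists \<Sigma> \<and> a \<in> M \<and> b \<in> M \<and> z \<in> M \<and>
    lub (g s) (g t) j \<and> j = g s \<odot> a \<and> j = g t \<odot> b \<and> W x = a \<odot> z \<and> W y = b \<odot> z"
  using assms(3-)
proof (induction rule: beq.induct)
  case (beq_refl w)
  then have "lub (g s) (g s) (g s)" unfolding lub_def by auto
  then show ?case using beq_refl
    by (intro exI[of _ s] exI[of _ x] exI[of _ E] exI[of _ "W x"] exI[of _ "g s"]) auto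
next
  case (beq_step u v w a1 b1)
  then obtain r y a b z1 j1 where IH: "a1 @ u @ b1 = r # y" "r \<in> \<Sigma>" "y \<in> lists \<Sigma>"
      "a \<in> M" "b \<in> M" "z1 \<in> M" "lub (g s) (g r) j1" "j1 = g s \<odot> a" "j1 = g r \<odot> b"
      "W x = a \<odot> z1" "W y = b \<odot> z1" by blast
  have sS: "s \<in> \<Sigma>" "x \<in> lists \<Sigma>" using beq_step.prems by auto
  show ?case
  proof (cases a1)
    \<comment> \<open>The relation acts behind the first letter, so the class of the tail is
      unchanged.\<close>
    case (Cons r' a2)
    then have "y = a2 @ u @ b1" "r' = r" using IH by auto
    moreover have "a2 @ u @ b1 \<doteq> a2 @ v @ b1"
      using beq.beq_step[OF beq_step.hyps(1) beq.beq_refl] .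
    ultimately have yv: "y \<doteq> a2 @ v @ b1" by simp
    have "W y = W (a2 @ v @ b1)" using yv by (simp only: W_eq_iff)
    moreover have "a2 @ v @ b1 \<in> lists \<Sigma>" using beq_lists[OF yv] IH(3) by (simp only:)
    moreover have "a1 @ v @ b1 = r # (a2 @ v @ b1)" using Cons \<open>r' = r\<close> by simp
    ultimately show ?thesis using IH
      by (intro exI[of _ r] exI[of _ "a2 @ v @ b1"] exI[of _ a] exI[of _ b] exI[of _ z1] exI[of _ j1]) simp
  next
    case Nil
    have ne: "u \<noteq> []" "v \<noteq> []" using rels_homogeneous(4,5) beq_step.hyps(1) by blast+
    obtain u1 where u1: "u = r # u1" "y = u1 @ b1" using IH(1) Nil ne by (cases u) auto
    obtain t v1 where v1: "v = t # v1" using ne by (cases v) auto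
    note rel = rel_lub[of r u1 t v1] 
    have R: "(r # u1, t # v1) \<in> rels k n \<or> (t # v1, r # u1) \<in> rels k n"
      using beq_step.hyps(1) u1 v1 by auto
    note rl = rel[OF R]
    define c d z2 where "c = W u1" "d = W v1" "z2 = W b1"
    have M: "c \<in> M" "d \<in> M" "z2 \<in> M" using rl IH(3) u1 unfolding c_d_z2_def by auto
    have j2: "lub (g r) (g t) (g r \<odot> c)" "g r \<odot> c = g t \<odot> d"
      using rl unfolding c_d_z2_def W_Cons by auto
    have j1P: "g r \<odot> b \<in> P" "g r \<odot> c \<in> P" using IH(7,9) j2 unfolding lub_def by auto
    then have bcP: "b \<in> P" "c \<in> P" using P_factors M IH by (meson g_in_M)+
    \<comment> \<open>\<open>g r \<odot> b\<close> is the join of \<open>s\<close> and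
      \<open>r\<close>, and \<open>g r \<odot> c\<close> that of \<open>r\<close> and
      \<open>t\<close>, so \<open>J\<close> is the join of all three atoms; cancelling
      \<open>r\<close> leaves the join \<open>e\<close> of \<open>b\<close> and
      \<open>c\<close>.\<close>
    obtain J where J: "lub (g r \<odot> b) (g r \<odot> c) J" using P_lub j1P by blast
    obtain e where e: "lub b c e" using P_lub bcP by blast
    have eM: "e \<in> M" using e unfolding lub_def by simp
    have JP: "J \<in> P" "g r \<odot> b \<preceq> J" "g r \<odot> c \<preceq> J" using J unfolding lub_def by auto
    have Je: "J = g r \<odot> e"
      using lub_unique[OF J lub_translate[OF _ IH(5) M(1) eM e JP]] IH(2) by simp
    have Wy: "W y = b \<odot> z1" "W y = c \<odot> z2" using IH u1 unfolding c_d_z2_def by (auto simp: W_append)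
    have "length (a1 @ u @ b1) = Suc N" using beq_length[OF beq_step.hyps(2)] beq_step.prems by simp
    then have "length y = N" using IH(1) by simp
    then have lenN: "blen (W y) \<le> N" by simp
    have WyM: "W y \<in> M" using IH(3) by simp
    have "b \<preceq> W y" unfolding Wy(1) using IH(6) by (rule dvsI)
    moreover have "c \<preceq> W y" unfolding Wy(2) using M(3) by (rule dvsI)
    ultimately have "e \<preceq> W y" using lub_upto_P[OF N bcP e WyM lenN] by blast
    then obtain z' where z': "z' \<in> M" "W y = e \<odot> z'" by (rule dvsE)
    obtain a' where a': "a' \<in> M" "e = b \<odot> a'" using e unfolding lub_def by (auto elim: dvsE)
    obtain b' where b': "b' \<in> M" "e = c \<odot> b'" using e unfolding lub_def by (auto elim: dvsE)
    have "b \<odot> z1 = b \<odot> (a' \<odot> z')" using z' a' Wy IH by (simp add: mult_assoc)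
    then have z1: "z1 = a' \<odot> z'" using cancel_upto_mult[OF N(1) IH(5)] IH(6) a' z' lenN Wy by (metis mult_in_M)
    have "c \<odot> z2 = c \<odot> (b' \<odot> z')" using z' b' Wy M by (simp add: mult_assoc)
    then have z2: "z2 = b' \<odot> z'" using cancel_upto_mult[OF N(1) M(1)] M(3) b' z' lenN Wy by (metis mult_in_M)
    have J1: "J = g s \<odot> (a \<odot> a')"
    proof -
      have "J = g r \<odot> b \<odot> a'" using Je a' IH(2,5) by (simp add: mult_assoc)
      also have "\<dots> = g s \<odot> a \<odot> a'" using IH(8,9) by simp
      finally show ?thesis using a' IH sS by (simp add: mult_assoc)
    qed
    have J2: "J = g t \<odot> (d \<odot> b')"
    proof -
      have "J = g r \<odot> c \<odot> b'" using Je b' IH(2) M by (simp add: mult_assoc)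
      also have "\<dots> = g t \<odot> d \<odot> b'" using j2 by simp
      finally show ?thesis using b' M rl by (simp add: mult_assoc)
    qed
    \<comment> \<open>The join of \<open>s\<close> and \<open>t\<close> divides \<open>J\<close>;
      the remaining factor \<open>f\<close> moves into the common tail, which becomes
      \<open>f \<odot> z'\<close>.\<close>
    obtain j3 where j3: "lub (g s) (g t) j3" using atom_lub sS rl by blast
    have "g s \<preceq> J" unfolding J1 using IH(4) a' by (intro dvsI) simp
    moreover have "g t \<preceq> J" unfolding J2 using M b' by (intro dvsI) simp
    ultimately have "j3 \<preceq> J" using j3 JP unfolding lub_def by blast
    then obtain f where f: "f \<in> M" "J = j3 \<odot> f" by (rule dvsE)
    obtain a3 where a3: "a3 \<in> M" "j3 = g s \<odot> a3" using j3 unfolding lub_def by (auto elim: dvsE)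
    obtain b3 where b3: "b3 \<in> M" "j3 = g t \<odot> b3" using j3 unfolding lub_def by (auto elim: dvsE)
    have "g s \<odot> (a \<odot> a') = g s \<odot> (a3 \<odot> f)" using J1 f a3 sS by (simp add: mult_assoc)
    then have c1: "a \<odot> a' = a3 \<odot> f"
      using P_cancel[of "g s" "a \<odot> a'" "a3 \<odot> f"] J1 JP(1) sS IH a' a3 f by simp
    have "g t \<odot> (d \<odot> b') = g t \<odot> (b3 \<odot> f)" using J2 f b3 rl by (simp add: mult_assoc)
    then have c2: "d \<odot> b' = b3 \<odot> f"
      using P_cancel[of "g t" "d \<odot> b'" "b3 \<odot> f"] J2 JP(1) rl M b' b3 f by simp
    have "W x = a \<odot> a' \<odot> z'" using IH z1 a' z' by (simp add: mult_assoc)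
    also have "\<dots> = a3 \<odot> (f \<odot> z')" using c1 a3 f z' by (simp add: mult_assoc)
    finally have x: "W x = a3 \<odot> (f \<odot> z')" .
    have "W (v1 @ b1) = d \<odot> z2" unfolding c_d_z2_def by (simp add: W_append)
    also have "\<dots> = d \<odot> b' \<odot> z'" using z2 b' z' M by (simp add: mult_assoc)
    also have "\<dots> = b3 \<odot> (f \<odot> z')" using c2 b3 f z' by (simp add: mult_assoc)
    finally have y: "W (v1 @ b1) = b3 \<odot> (f \<odot> z')" .
    have "b1 \<in> lists \<Sigma>" using IH(3) u1 by simp
    then show ?thesis
      using x y a3 b3 f z' j3 rl Nil v1
      by (intro exI[of _ t] exI[of _ "v1 @ b1"] exI[of _ a3] exI[of _ b3] exI[of _ "f \<odot> z'"] exI[of _ j3]) simp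
  qed
qed

text \<open>Equivalent words with first letters \<open>s\<close> and \<open>t\<close> factor through
  the join of \<open>s\<close> and \<open>t\<close>. For \<open>s = t\<close> this is cancellation,
  in general it is minimality of the join; \<open>word_chain\<close> gives both at length
  \<open>N + 1\<close> from the bounds at \<open>N\<close>.\<close>

lemma cancel_lub_upto: "cancel_upto N \<and> lub_upto N"
proof (induction N)
  case 0
  have "lub_upto 0" unfolding lub_upto_def using dvs_blen g_in_M blen_g by fastforce
  then show ?case unfolding cancel_upto_def by simp
next
  case (Suc N)
  have C: "cancel_upto (Suc N)"
    unfolding cancel_upto_def
  proof (intro allI impI)
    fix s a b assume h: "s \<in> \<Sigma>" "a \<in> M" "b \<in> M" "g s \<odot> a = g s \<odot> b" "blen a < Suc N"
    show "a = b"
    proof (cases "blen a = N")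
      case False
      then show ?thesis using Suc h unfolding cancel_upto_def by (metis less_antisym)
    next
      case True
      obtain u where u: "u \<in> lists \<Sigma>" "a = W u" using h(2) by (rule in_M_cases)
      obtain v where v: "v \<in> lists \<Sigma>" "b = W v" using h(3) by (rule in_M_cases)
      have "s # u \<doteq> s # v" using h(4) u v by (simp flip: W_Cons add: W_eq_iff)
      then obtain a' b' z j where *: "a' \<in> M" "b' \<in> M" "z \<in> M"
          "lub (g s) (g s) j" "j = g s \<odot> a'" "j = g s \<odot> b'" "W u = a' \<odot> z" "W v = b' \<odot> z"
        using word_chain[of N "s # u" "s # v" s u] Suc h u True by auto
      have "lub (g s) (g s) (g s)" using h unfolding lub_def by auto
      then have "j = g s" using lub_unique * by blast
      then have "blen a' = 0" "blen b' = 0" using *(1,2,5,6) h(1) by (metis blen_mult g_in_M add_cancel_left_right)+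
      then show ?thesis using * u v by simp
    qed
  qed
  have L: "lub_upto (Suc N)"
    unfolding lub_upto_def
  proof (intro allI impI)
    fix s t m j assume h: "s \<in> \<Sigma>" "t \<in> \<Sigma>" "m \<in> M" "blen m \<le> Suc N" "g s \<preceq> m" "g t \<preceq> m" "lub (g s) (g t) j"
    show "j \<preceq> m"
    proof (cases "blen m = Suc N")
      case False
      then show ?thesis using Suc h unfolding lub_upto_def by (metis le_SucE)
    next
      case True
      obtain a where a: "a \<in> M" "m = g s \<odot> a" using h(5) by (rule dvsE)
      obtain b where b: "b \<in> M" "m = g t \<odot> b" using h(6) by (rule dvsE)
      obtain u where u: "u \<in> lists \<Sigma>" "a = W u" using a(1) by (rule in_M_cases)
      obtain v where v: "v \<in> lists \<Sigma>" "b = W v" using b(1) by (rule in_M_cases)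
      have "W (s # u) = W (t # v)" using a b u v by (simp add: W_Cons)
      then have "s # u \<doteq> t # v" unfolding W_eq_iff .
      then obtain a' b' z j' where *: "a' \<in> M" "b' \<in> M" "z \<in> M"
          "lub (g s) (g t) j'" "j' = g s \<odot> a'" "j' = g t \<odot> b'" "W u = a' \<odot> z" "W v = b' \<odot> z"
        using word_chain[of N "s # u" "t # v" s u] Suc h a u True by auto
      have "j' = j" using lub_unique * h by blast
      moreover have "m = g s \<odot> a' \<odot> z" using a(2) u(2) *(1,3,7) h(1) by (simp add: mult_assoc)
      ultimately have "m = j \<odot> z" using *(5) by simp
      then show ?thesis using * by auto
    qed
  qed
  show ?case using C L by blast
qed

lemma left_cancel: "x \<in> M \<Longrightarrow> a \<in> M \<Longrightarrow> b \<in> M \<Longrightarrow> x \<odot> a = x \<odot> b \<Longrightarrow> a = b"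
  using cancel_lub_upto cancel_upto_mult by blast

lemma lub_M: "x \<in> P \<Longrightarrow> y \<in> P \<Longrightarrow> lub x y j \<Longrightarrow> m \<in> M \<Longrightarrow> x \<preceq> m \<Longrightarrow> y \<preceq> m \<Longrightarrow> j \<preceq> m"
  using cancel_lub_upto lub_upto_P by blast

text \<open>The join is built in \<open>P\<close> one generator at a time, and \<open>lub_M\<close>
  allows testing it against all of \<open>M\<close>, as \<open>DeltaX\<close> demands.\<close>

lemma DeltaX_spec:
  assumes "X \<subseteq> \<Sigma>"
  shows "DeltaX k n X \<in> P \<and> (\<forall>m\<in>M. DeltaX k n X \<preceq> m \<longleftrightarrow> (\<forall>s\<in>X. g s \<preceq> m))"
proof -
  have "finite X" using assms finite_subset finite_gens by blast
  then have ex: "\<exists>d\<in>P. \<forall>m\<in>M. d \<preceq> m \<longleftrightarrow> (\<forall>s\<in>X. g s \<preceq> m)" using assms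
  proof (induction X)
    case empty
    then show ?case by (intro bexI[of _ E]) auto
  next
    case (insert s X)
    then obtain d where d: "d \<in> P" "\<And>m. m \<in> M \<Longrightarrow> d \<preceq> m \<longleftrightarrow> (\<forall>s\<in>X. g s \<preceq> m)" by auto
    obtain j where j: "lub (g s) d j" using P_lub[of "g s" d] insert.prems d(1) by auto
    have jP: "j \<in> P" "g s \<preceq> j" "d \<preceq> j" using j unfolding lub_def by auto
    have "j \<preceq> m \<longleftrightarrow> (\<forall>s\<in>insert s X. g s \<preceq> m)" if m: "m \<in> M" for m
    proof -
      have "j \<preceq> m \<longleftrightarrow> g s \<preceq> m \<and> d \<preceq> m"
        using lub_M[OF _ d(1) j m] jP dvs_trans[of "g s" j m] dvs_trans[of d j m] insert.prems d(1) by auto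
      then show ?thesis using d(2)[OF m] by auto
    qed
    then show ?case using jP by blast
  qed
  then obtain d where d: "d \<in> P" "\<forall>m\<in>M. d \<preceq> m \<longleftrightarrow> (\<forall>s\<in>X. g s \<preceq> m)" by blast
  have "DeltaX k n X = d"
    unfolding DeltaX_def
  proof (rule the_equality)
    show "d \<in> M \<and> (\<forall>s\<in>X. g s \<preceq> d) \<and> (\<forall>m\<in>M. (\<forall>s\<in>X. g s \<preceq> m) \<longrightarrow> d \<preceq> m)"
      using d dvs_refl P_M by blast
  next
    fix d' assume "d' \<in> M \<and> (\<forall>s\<in>X. g s \<preceq> d') \<and> (\<forall>m\<in>M. (\<forall>s\<in>X. g s \<preceq> m) \<longrightarrow> d' \<preceq> m)"
    then show "d' = d" using d dvs_antisym P_M dvs_refl by metis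
  qed
  then show ?thesis using d by simp
qed

lemma Delta_eq: "Delta k n = \<delta>"
proof -
  have *: "Delta k n \<in> P" "\<forall>m\<in>M. Delta k n \<preceq> m \<longleftrightarrow> (\<forall>s\<in>\<Sigma>. g s \<preceq> m)"
    using DeltaX_spec[of \<Sigma>] unfolding Delta_def by auto
  show ?thesis by (rule \<delta>_unique[OF *(1)]) (use * dvs_refl P_M in blast)
qed

lemma Simples_eq: "Simples k n = P"
  unfolding Simples_def Delta_eq using P_iff by auto

end

section \<open>Automata of simple elements\<close>

fun run :: "('w \<Rightarrow> gen set) \<Rightarrow> (gen \<Rightarrow> 'w \<Rightarrow> 'w) \<Rightarrow> gen list \<Rightarrow> 'w \<Rightarrow> 'w option" where
  "run D q [] x = Some x"
| "run D q (s # w) x = (if s \<in> D x then run D q w (q s x) else None)"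

lemma run_append: "run D q (u @ v) x = Option.bind (run D q u x) (run D q v)"
  by (induction u arbitrary: x) auto

text \<open>A deterministic automaton modelling the simple elements: a state \<open>x\<close> is a simple element, \<open>D x\<close> is
  the set of its left-dividing atoms and \<open>q s x\<close> the quotient of \<open>x\<close> by such an atom \<open>s\<close>. The state
  \<open>c\<close> stands for \<open>\<Delta>\<close>, and \<open>K x\<close> for the quotient of \<open>\<Delta>\<close> by \<open>x\<close>.\<close>

locale germ0 = braid k n for k n +
  fixes S :: "'w set" and D :: "'w \<Rightarrow> gen set" and q :: "gen \<Rightarrow> 'w \<Rightarrow> 'w" and e c :: 'w
    and rk :: "'w \<Rightarrow> nat" and K :: "'w \<Rightarrow> 'w"
  assumes e_S: "e \<in> S" and c_S: "c \<in> S"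
    and D_sub: "\<And>x. x \<in> S \<Longrightarrow> D x \<subseteq> \<Sigma>"
    and q_S: "\<And>s x. x \<in> S \<Longrightarrow> s \<in> D x \<Longrightarrow> q s x \<in> S"
    and rk_less: "\<And>s x. x \<in> S \<Longrightarrow> s \<in> D x \<Longrightarrow> rk (q s x) < rk x"
    and D_empty: "\<And>x. x \<in> S \<Longrightarrow> D x = {} \<longleftrightarrow> x = e"
    and D_c: "D c = \<Sigma>" and D_full: "\<And>x. x \<in> S \<Longrightarrow> D x = \<Sigma> \<Longrightarrow> x = c"
    and prefix: "\<And>s x. x \<in> S \<Longrightarrow> s \<in> \<Sigma> \<Longrightarrow> D x \<subseteq> D (q s c) \<Longrightarrow> \<exists>y\<in>S. s \<in> D y \<and> q s y = x"
    and rel_run: "\<And>u v x. (u, v) \<in> rels k n \<Longrightarrow> x \<in> S \<Longrightarrow> run D q u x = run D q v x"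
    and rel_ex: "\<And>s t u v x. (s # u, t # v) \<in> rels k n \<Longrightarrow> x \<in> S \<Longrightarrow> s \<in> D x \<Longrightarrow> t \<in> D x \<Longrightarrow>
      run D q (s # u) x \<noteq> None"
    and conn: "\<And>s t x. x \<in> S \<Longrightarrow> s \<in> D x \<Longrightarrow> t \<in> D x \<Longrightarrow> (s, t) \<in> {(a, b). a \<in> D x \<and> b \<in> D x \<and>
      (\<exists>u v. (a # u, b # v) \<in> rels k n \<or> (b # v, a # u) \<in> rels k n)}\<^sup>*"
    and K_run: "\<And>w x. x \<in> S \<Longrightarrow> run D q w x = Some e \<Longrightarrow> run D q w c = Some (K x)"
    and K_inj: "\<And>s t. s \<in> \<Sigma> \<Longrightarrow> t \<in> \<Sigma> \<Longrightarrow> D (K (q s c)) \<inter> D (K (q t c)) \<noteq> {} \<Longrightarrow> s = t"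
begin

abbreviation "rd \<equiv> run D q"

lemma run_S: "x \<in> S \<Longrightarrow> rd w x = Some y \<Longrightarrow> y \<in> S"
proof (induction w arbitrary: x)
  case (Cons s w)
  then show ?case using q_S[of x s] by (simp split: if_splits)
qed simp

lemma run_lists: "x \<in> S \<Longrightarrow> rd w x = Some y \<Longrightarrow> w \<in> lists \<Sigma>"
proof (induction w arbitrary: x)
  case (Cons s w)
  then show ?case using q_S[of x s] D_sub[of x] by (auto split: if_splits)
qed simp

lemma run_beq: "u \<doteq> v \<Longrightarrow> x \<in> S \<Longrightarrow> rd u x = rd v x"
proof (induction rule: beq.induct)
  case (beq_step u v w a b)
  have "rd u y = rd v y" if "y \<in> S" for y
    using beq_step.hyps(1) rel_run[of u v y] rel_run[of v u y] that by auto
  then have "rd (a @ u @ b) x = rd (a @ v @ b) x"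
    using run_S[OF beq_step.prems, of a] unfolding run_append by (cases "rd a x") auto
  then show ?case using beq_step by simp
qed simp

section \<open>Reduced words of a state\<close>

lemma reduced_ex: "x \<in> S \<Longrightarrow> \<exists>w. rd w x = Some e"
proof (induction "rk x" arbitrary: x rule: less_induct)
  case less
  show ?case
  proof (cases "x = e")
    case False
    then obtain s where s: "s \<in> D x" using D_empty less.prems by blast
    then obtain w where "rd w (q s x) = Some e" using less rk_less q_S by blast
    then have "rd (s # w) x = Some e" using s by simp
    then show ?thesis by blast
  qed (auto intro: exI[of _ "[]"])
qed

text \<open>The analogue of Matsumoto's theorem. The first letters of two reduced words are joined
  by the chain from \<open>conn\<close>; each link is a relation that runs on \<open>x\<close> and
  extends to reduced words, and the induction hypothesis on quotients connects consecutive
  links.\<close>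

lemma reduced_unique: "x \<in> S \<Longrightarrow> rd u x = Some e \<Longrightarrow> rd v x = Some e \<Longrightarrow> u \<doteq> v"
proof (induction "rk x" arbitrary: x u v rule: less_induct)
  case less
  show ?case
  proof (cases "x = e")
    case True
    then have "D x = {}" using D_empty less.prems by blast
    then have "u = []" "v = []" using less.prems by (cases u; cases v; auto)+
    then show ?thesis by (simp add: beq.beq_refl)
  next
    case False
    then obtain s u' where u: "u = s # u'" "s \<in> D x" "rd u' (q s x) = Some e"
      using less.prems by (cases u) (auto split: if_splits)
    obtain t v' where v: "v = t # v'" "t \<in> D x" "rd v' (q t x) = Some e"
      using False less.prems by (cases v) (auto split: if_splits)
    have "rd w (q t x) = Some e \<longrightarrow> s # u' \<doteq> t # w" for w
      using conn[OF less.prems(1) u(2) v(2)]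
    proof (induction arbitrary: w rule: rtrancl_induct)
      case base
      show ?case
        using less.hyps[OF rk_less[OF less.prems(1) u(2)] q_S[OF less.prems(1) u(2)] u(3)]
          beq_context[of "rels k n" u' w "[s]" "[]"] by auto
    next
      case (step a b)
      obtain ua ub where R: "(a # ua, b # ub) \<in> rels k n \<or> (b # ub, a # ua) \<in> rels k n"
        and ab: "a \<in> D x" "b \<in> D x" using step.hyps by auto
      have eq: "rd (a # ua) x = rd (b # ub) x" using R rel_run less.prems(1) by metis
      have "rd (a # ua) x \<noteq> None" using R rel_ex less.prems(1) ab eq by metis
      then obtain y where y: "rd (a # ua) x = Some y" by auto
      then obtain z where z: "rd z y = Some e" using reduced_ex run_S less.prems(1) by blast
      have a: "rd (ua @ z) (q a x) = Some e" using y z ab by (simp add: run_append)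
      have b: "rd (ub @ z) (q b x) = Some e" using eq y z ab by (simp add: run_append)
      have 1: "s # u' \<doteq> a # ua @ z" using step.IH a by simp
      have 2: "a # ua @ z \<doteq> b # ub @ z"
        using beq.beq_step[OF R beq.beq_refl, of "[]" z] by simp
      have 3: "b # ub @ z \<doteq> b # w" if "rd w (q b x) = Some e"
        using less.hyps[OF rk_less[OF less.prems(1) ab(2)] q_S[OF less.prems(1) ab(2)] b that]
          beq_context[of "rels k n" "ub @ z" w "[b]" "[]"] by auto
      show ?case using 1 2 3 beq_trans by blast
    qed
    then show ?thesis using u v by simp
  qed
qed

definition rr :: "'w \<Rightarrow> elt" where "rr x = W (SOME w. rd w x = Some e)"

definition le :: "'w \<Rightarrow> 'w \<Rightarrow> bool" where "le x y \<longleftrightarrow> (\<exists>w. rd w x = Some e \<and> rd w y \<noteq> None)"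

lemma rr_eq: "x \<in> S \<Longrightarrow> rd w x = Some e \<Longrightarrow> rr x = W w"
  unfolding rr_def W_eq_iff using reduced_unique someI[of "\<lambda>w. rd w x = Some e" w] by blast

lemma rr_red: assumes "x \<in> S" obtains w where "rd w x = Some e" "rr x = W w" "w \<in> lists \<Sigma>"
  using assms reduced_ex rr_eq run_lists by metis

lemma rr_run: "x \<in> S \<Longrightarrow> rr x = W w \<Longrightarrow> rd w x = Some e"
  by (metis rr_red W_eq_iff run_beq)

lemma rr_M: "x \<in> S \<Longrightarrow> rr x \<in> M"
  by (metis rr_red W_in_M)

lemma g_dvs_rr: assumes "x \<in> S" shows "g s \<preceq> rr x \<longleftrightarrow> s \<in> D x"
proof
  assume "g s \<preceq> rr x"
  then obtain z where z: "z \<in> M" "rr x = g s \<odot> z" by (rule dvsE)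
  obtain w where w: "z = W w" using z(1) by (rule in_M_cases)
  have "rd (s # w) x = Some e" using rr_run[OF assms, of "s # w"] z w by (simp add: W_Cons)
  then show "s \<in> D x" by (auto split: if_splits)
next
  assume s: "s \<in> D x"
  obtain w where w: "rd w (q s x) = Some e" "w \<in> lists \<Sigma>" using rr_red[OF q_S[OF assms s]] by blast
  then have "rr x = W (s # w)" using rr_eq[OF assms, of "s # w"] s by simp
  then show "g s \<preceq> rr x" using w(2) by (auto simp: W_Cons)
qed

text \<open>A word running on \<open>x\<close> extends to a reduced word of \<open>x\<close>, which
  is equivalent to the witness of \<open>le x y\<close> and therefore runs on \<open>y\<close> as
  well.\<close>

lemma le_run:
  assumes "x \<in> S" "y \<in> S" "le x y" "rd w x \<noteq> None"
  shows "rd w y \<noteq> None"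
proof -
  obtain v where v: "rd v x = Some e" "rd v y \<noteq> None" using assms(3) unfolding le_def by blast
  obtain z where z: "rd w x = Some z" using assms(4) by blast
  obtain u where u: "rd u z = Some e" using reduced_ex run_S assms z by blast
  have "rd (w @ u) x = Some e" using z u by (simp add: run_append)
  then have "w @ u \<doteq> v" using reduced_unique v assms by blast
  then have "rd (w @ u) y \<noteq> None" using run_beq assms(2) v by metis
  then show ?thesis by (cases "rd w y") (auto simp: run_append)
qed

lemma le_c: "x \<in> S \<Longrightarrow> le x c"
  unfolding le_def using K_run reduced_ex by blast

lemma le_dvs: assumes "x \<in> S" "y \<in> S" "le x y" shows "rr x \<preceq> rr y"
proof -
  obtain w z where w: "rd w x = Some e" "rd w y = Some z" using assms(3) unfolding le_def by blast
  have zS: "z \<in> S" using run_S w assms by blast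
  obtain u where u: "rd u z = Some e" "u \<in> lists \<Sigma>" using rr_red[OF zS] by blast
  have "rd (w @ u) y = Some e" using w u by (simp add: run_append)
  then have "rr y = rr x \<odot> W u" using rr_eq assms w by (simp add: W_append)
  then show ?thesis using u by auto
qed

text \<open>In the step \<open>u\<close> runs on \<open>q s c\<close>, hence on \<open>c\<close>, so
  it spells a state \<open>x\<close> by induction. The atoms of \<open>x\<close> also run on
  \<open>q s c\<close>, which is the condition under which \<open>prefix\<close> puts
  \<open>s\<close> in front.\<close>

lemma prefix_state: "rd u c \<noteq> None \<Longrightarrow> \<exists>x\<in>S. rd u x = Some e"
proof (induction u)
  case Nil
  then show ?case using e_S by auto
next
  case (Cons s u)
  then have s: "s \<in> D c" "rd u (q s c) \<noteq> None" by (auto split: if_splits)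
  have qS: "q s c \<in> S" using q_S c_S s by blast
  have "rd u c \<noteq> None" using le_run[OF qS c_S le_c[OF qS] s(2)] .
  then obtain x where x: "x \<in> S" "rd u x = Some e" using Cons by blast
  have "D x \<subseteq> D (q s c)"
  proof
    fix t assume t: "t \<in> D x"
    obtain v where "rd v (q t x) = Some e" using reduced_ex q_S x t by blast
    then have "rd (t # v) x = Some e" using t by simp
    then have "u \<doteq> t # v" using reduced_unique x by blast
    then have "rd (t # v) (q s c) \<noteq> None" using run_beq qS s(2) by metis
    then show "t \<in> D (q s c)" by (auto split: if_splits)
  qed
  then obtain y where "y \<in> S" "s \<in> D y" "q s y = x" using prefix[OF x(1)] s D_c by blast
  then show ?case using x by auto
qed

text \<open>The word \<open>s # u\<close> runs on every state that contains \<open>s\<close> and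
  \<open>t\<close>, in particular on \<open>c\<close>; so it spells a state, and this state lies
  below all the others.\<close>

lemma rel_state:
  assumes R: "(s # u, t # v) \<in> rels k n \<or> (t # v, s # u) \<in> rels k n"
  shows "\<exists>j\<in>S. rd (s # u) j = Some e \<and> s \<in> D j \<and> t \<in> D j \<and>
    (\<forall>x\<in>S. s \<in> D x \<longrightarrow> t \<in> D x \<longrightarrow> le j x)"
proof -
  have eq: "rd (s # u) x = rd (t # v) x" if "x \<in> S" for x using R rel_run that by metis
  have ex: "rd (s # u) x \<noteq> None" if "x \<in> S" "s \<in> D x" "t \<in> D x" for x
    using R rel_ex that eq by metis
  have st: "s \<in> \<Sigma>" "t \<in> \<Sigma>" using R by (auto dest: rels_homogeneous(2,3))
  then obtain j where j: "j \<in> S" "rd (s # u) j = Some e" using prefix_state ex c_S D_c by metis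
  then have "rd (t # v) j = Some e" using eq by simp
  then have "s \<in> D j" "t \<in> D j" using j by (auto split: if_splits)
  then show ?thesis using j ex unfolding le_def by blast
qed

end

locale germ = germ0 +
  assumes join: "\<And>s t. s \<in> \<Sigma> \<Longrightarrow> t \<in> \<Sigma> \<Longrightarrow>
      \<exists>j\<in>S. s \<in> D j \<and> t \<in> D j \<and> (\<forall>x\<in>S. s \<in> D x \<longrightarrow> t \<in> D x \<longrightarrow> le j x)"

sublocale germ \<subseteq> simple_family k n "rr ` S" "rr c"
proof
  show "rr ` S \<subseteq> M" using rr_M by blast
next
  fix a b assume ab: "a \<in> M" "b \<in> M" "a \<odot> b \<in> rr ` S"
  obtain u where u: "u \<in> lists \<Sigma>" "a = W u" using ab(1) by (rule in_M_cases)
  obtain v where v: "v \<in> lists \<Sigma>" "b = W v" using ab(2) by (rule in_M_cases)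
  obtain x where x: "x \<in> S" "rr x = W (u @ v)" using ab(3) u v by (auto simp: W_append)
  then have run: "rd (u @ v) x = Some e" using rr_run by blast
  then obtain y where y: "rd u x = Some y" "rd v y = Some e" by (cases "rd u x") (auto simp: run_append)
  have yS: "y \<in> S" using run_S x y by blast
  have "b \<in> rr ` S" using rr_eq[OF yS y(2)] v yS by auto
  moreover have "rd u c \<noteq> None" using le_run[OF x(1) c_S le_c[OF x(1)]] y by simp
  then obtain z where "z \<in> S" "rd u z = Some e" using prefix_state by blast
  then have "a \<in> rr ` S" using rr_eq u by auto
  ultimately show "a \<in> rr ` S \<and> b \<in> rr ` S" by blast
next
  fix a b b' assume h: "a \<in> M" "b \<in> M" "b' \<in> M" "a \<odot> b \<in> rr ` S" "a \<odot> b = a \<odot> b'"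
  obtain u where u: "u \<in> lists \<Sigma>" "a = W u" using h(1) by (rule in_M_cases)
  obtain v where v: "v \<in> lists \<Sigma>" "b = W v" using h(2) by (rule in_M_cases)
  obtain v' where v': "v' \<in> lists \<Sigma>" "b' = W v'" using h(3) by (rule in_M_cases)
  obtain x where x: "x \<in> S" "rr x = W (u @ v)" using h(4) u v by (auto simp: W_append)
  then have x': "rr x = W (u @ v')" using h(5) u v v' by (simp add: W_append)
  have "rd (u @ v) x = Some e" "rd (u @ v') x = Some e" using rr_run x x' by blast+
  then obtain y where "rd u x = Some y" "rd v y = Some e" "rd v' y = Some e"
    by (cases "rd u x") (auto simp: run_append)
  then have "v \<doteq> v'" using reduced_unique run_S x by blast
  then show "b = b'" using v v' W_eq_iff by blast
next
  show "rr c \<in> rr ` S" using c_S by blast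
next
  fix x assume "x \<in> rr ` S"
  then show "x \<preceq> rr c" using le_dvs c_S le_c by auto
next
  fix s assume "s \<in> \<Sigma>"
  then show "g s \<preceq> rr c" using g_dvs_rr c_S D_c by simp
next
  fix x assume "x \<in> rr ` S" and h: "\<And>s. s \<in> \<Sigma> \<Longrightarrow> g s \<preceq> x"
  then obtain y where y: "y \<in> S" "x = rr y" by blast
  then have "D y = \<Sigma>" using h g_dvs_rr D_sub by blast
  then show "x = rr c" using D_full y by simp
next
  fix s t assume st: "s \<in> \<Sigma>" "t \<in> \<Sigma>"
  obtain j where j: "j \<in> S" "s \<in> D j" "t \<in> D j" "\<forall>x\<in>S. s \<in> D x \<longrightarrow> t \<in> D x \<longrightarrow> le j x"
    using join[OF st] by blast
  show "\<exists>j\<in>rr ` S. g s \<preceq> j \<and> g t \<preceq> j \<and> (\<forall>x\<in>rr ` S. g s \<preceq> x \<longrightarrow> g t \<preceq> x \<longrightarrow> j \<preceq> x)"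
    using j g_dvs_rr le_dvs by (intro bexI[of _ "rr j"]) auto
next
  fix s t u v x assume R: "(s # u, t # v) \<in> rels k n"
  obtain j where j: "j \<in> S" "rd (s # u) j = Some e" "\<forall>x\<in>S. s \<in> D x \<longrightarrow> t \<in> D x \<longrightarrow> le j x"
    using rel_state R by metis
  have "W (s # u) = rr j" using rr_eq[OF j(1,2)] by (rule sym)
  then show "W (s # u) \<in> rr ` S \<and> (x \<in> rr ` S \<longrightarrow> g s \<preceq> x \<longrightarrow> g t \<preceq> x \<longrightarrow> W (s # u) \<preceq> x)"
    using j(1,3) g_dvs_rr[of _ s] g_dvs_rr[of _ t] le_dvs[of j] by auto
qed

section \<open>Complements and arrows in terms of states\<close>

context germ
begin

lemma rr_complement: "x \<in> S \<Longrightarrow> K x \<in> S \<and> rr c = rr x \<odot> rr (K x)"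
proof -
  assume x: "x \<in> S"
  obtain w where w: "rd w x = Some e" "rr x = W w" using x by (rule rr_red)
  have K: "rd w c = Some (K x)" using K_run[OF x w(1)] .
  then have KS: "K x \<in> S" using run_S c_S by blast
  obtain v where v: "rd v (K x) = Some e" "rr (K x) = W v" using KS by (rule rr_red)
  have "rd (w @ v) c = Some e" using K v by (simp add: run_append)
  then have "rr c = W (w @ v)" using rr_eq c_S by blast
  then show ?thesis using KS v w by (simp add: W_append)
qed

lemma Lset_rr: "x \<in> S \<Longrightarrow> Lset k n (rr x) = D x"
  unfolding Lset_def using g_dvs_rr D_sub by blast

lemma Rset_rr:
  assumes x: "x \<in> S" shows "Rset k n (rr x) = \<Sigma> - D (K x)"
proof -
  have K: "K x \<in> S" "rr c = rr x \<odot> rr (K x)" using rr_complement[OF x] by auto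
  have "rr x \<odot> g s \<in> rr ` S \<longleftrightarrow> s \<in> D (K x)" if s: "s \<in> \<Sigma>" for s
  proof -
    have "rr x \<odot> g s \<in> rr ` S \<longleftrightarrow> rr x \<odot> g s \<preceq> rr c" using P_iff rr_M[OF x] s by simp
    also have "\<dots> \<longleftrightarrow> g s \<preceq> rr (K x)"
      using P_dvs_cancel[of "rr x" "g s" "rr (K x)"] dvs_mult_left[of "rr x" "g s" "rr (K x)"]
        K rr_M x s \<delta>_P by auto
    finally show ?thesis using g_dvs_rr K by simp
  qed
  then show ?thesis unfolding Rset_def Simples_eq by blast
qed

lemma arrow_rr: "x \<in> S \<Longrightarrow> y \<in> S \<Longrightarrow> arrow k n (rr x) (rr y) \<longleftrightarrow> D y \<inter> D (K x) = {}"
  unfolding arrow_def using Lset_rr Rset_rr D_sub by blast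

text \<open>As \<open>rr c\<close> is \<open>g s\<close> times the quotient
  \<open>rr (q s c)\<close>, moving \<open>g s\<close> across \<open>rr c\<close> produces
  \<open>rr (K (q s c))\<close>. Left cancellation compares these conjugates; their atoms form a
  nonempty set, so \<open>K_inj\<close> applies.\<close>

lemma \<phi>_inj:
  assumes "s \<in> \<Sigma>" "t \<in> \<Sigma>" "g s \<odot> rr c = g t \<odot> rr c"
  shows "s = t"
proof -
  have *: "q s c \<in> S \<and> g s \<odot> rr c = rr c \<odot> rr (K (q s c)) \<and> K (q s c) \<in> S" if s: "s \<in> \<Sigma>" for s
  proof -
    have qS: "q s c \<in> S" using q_S c_S D_c s by blast
    obtain w where w: "rd w (q s c) = Some e" "rr (q s c) = W w" using qS by (rule rr_red)
    have "rd (s # w) c = Some e" using w s D_c by simp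
    then have c: "rr c = g s \<odot> rr (q s c)" using rr_eq[OF c_S] w by (simp flip: W_Cons)
    have "g s \<odot> rr c = g s \<odot> rr (q s c) \<odot> rr (K (q s c))"
      using rr_complement[OF qS] rr_M qS s by (simp add: mult_assoc)
    then show ?thesis using c qS rr_complement[OF qS] by simp
  qed
  note s = *[OF assms(1)] and t = *[OF assms(2)]
  have "rr (K (q s c)) = rr (K (q t c))"
    using left_cancel[of "rr c"] s t assms(3) rr_M c_S by metis
  then have "D (K (q s c)) = D (K (q t c))" using g_dvs_rr s t by (metis subsetI subset_antisym)
  moreover have "D (K (q s c)) \<noteq> {}"
  proof
    assume "D (K (q s c)) = {}"
    then have "K (q s c) = e" using D_empty s by blast
    then have "rr (K (q s c)) = E" using rr_eq[OF e_S, of "[]"] by (simp add: unit_e_def)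
    then have "blen (g s \<odot> rr c) = blen (rr c \<odot> E)" using s by simp
    then show False using assms(1) rr_M c_S by simp
  qed
  ultimately show ?thesis using K_inj assms by auto
qed

end

section \<open>Garside normal forms\<close>

text \<open>\<open>gen_Delta_inj\<close> is the one instance of right cancellation required.
  \<open>mixing\<close> leads from each atom to a simple \<open>z\<close> which at most one atom
  extends to a simple element; this feeds the positivity of the cylinder weights.\<close>

locale garside = braid +
  assumes left_cancel: "\<And>x a b. x \<in> M \<Longrightarrow> a \<in> M \<Longrightarrow> b \<in> M \<Longrightarrow> x \<odot> a = x \<odot> b \<Longrightarrow> a = b"
    and right_factor: "\<And>a b. a \<in> M \<Longrightarrow> b \<in> M \<Longrightarrow> a \<odot> b \<in> Simples k n \<Longrightarrow> b \<in> Simples k n"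
    and simple_lub: "\<And>a b. a \<in> Simples k n \<Longrightarrow> b \<in> Simples k n \<Longrightarrow>
      \<exists>j\<in>Simples k n. a \<preceq> j \<and> b \<preceq> j \<and> (\<forall>m\<in>M. a \<preceq> m \<longrightarrow> b \<preceq> m \<longrightarrow> j \<preceq> m)"
    and DeltaX_M: "\<And>X. X \<subseteq> \<Sigma> \<Longrightarrow> DeltaX k n X \<in> M"
    and DeltaX_dvs: "\<And>X m. X \<subseteq> \<Sigma> \<Longrightarrow> m \<in> M \<Longrightarrow> DeltaX k n X \<preceq> m \<longleftrightarrow> (\<forall>s\<in>X. g s \<preceq> m)"
    and gen_Delta_inj: "\<And>s t. s \<in> \<Sigma> \<Longrightarrow> t \<in> \<Sigma> \<Longrightarrow> g s \<odot> Delta k n = g t \<odot> Delta k n \<Longrightarrow> s = t"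
    and mixing: "\<And>s. s \<in> \<Sigma> \<Longrightarrow> \<exists>z. (g s, z) \<in> {(x, y). x \<in> Simples k n \<and> y \<in> Simples k n \<and> arrow k n x y}\<^sup>* \<and>
      card (\<Sigma> - Rset k n z) \<le> 1"
begin

abbreviation "P \<equiv> Simples k n"
abbreviation "\<Delta> \<equiv> Delta k n"

lemma \<Delta>_M [simp]: "\<Delta> \<in> M" unfolding Delta_def by (simp add: DeltaX_M)

lemma \<Delta>_dvs: "m \<in> M \<Longrightarrow> \<Delta> \<preceq> m \<longleftrightarrow> (\<forall>s\<in>\<Sigma>. g s \<preceq> m)"
  unfolding Delta_def by (simp add: DeltaX_dvs)

lemma P_iff: "x \<in> P \<longleftrightarrow> x \<in> M \<and> x \<preceq> \<Delta>" unfolding Simples_def by blast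

lemma P_M [simp]: "x \<in> P \<Longrightarrow> x \<in> M" by (simp add: P_iff)

lemma P_dvs: "x \<in> M \<Longrightarrow> x \<preceq> y \<Longrightarrow> y \<in> P \<Longrightarrow> x \<in> P"
  using P_iff dvs_trans by blast

lemma \<Delta>_P [simp]: "\<Delta> \<in> P" and E_P [simp]: "E \<in> P" by (simp_all add: P_iff)

lemma g_P [simp]: "s \<in> \<Sigma> \<Longrightarrow> g s \<in> P"
  using \<Delta>_dvs[of \<Delta>] by (simp add: P_iff)

lemma finite_P [simp]: "finite P"
proof -
  have "P \<subseteq> (\<Union>m\<le>blen \<Delta>. {x \<in> M. blen x = m})"
    using dvs_blen P_iff by auto
  then show ?thesis using finite_M_blen finite_subset by blast
qed

lemma dvs_cancel:
  assumes "a \<in> M" "x \<in> M" "y \<in> M" "a \<odot> x \<preceq> a \<odot> y" shows "x \<preceq> y"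
proof -
  obtain z where z: "z \<in> M" "a \<odot> y = a \<odot> x \<odot> z" using assms(4) by (rule dvsE)
  then have "y = x \<odot> z" using left_cancel[of a y "x \<odot> z"] assms by (simp add: mult_assoc)
  then show ?thesis using z by auto
qed

lemma dvs_cancel_iff: "a \<in> M \<Longrightarrow> x \<in> M \<Longrightarrow> y \<in> M \<Longrightarrow> a \<odot> x \<preceq> a \<odot> y \<longleftrightarrow> x \<preceq> y"
  using dvs_cancel dvs_mult_left by blast

section \<open>Complements and greatest simple divisors\<close>

definition quot :: "elt \<Rightarrow> elt \<Rightarrow> elt" where "quot x y = (SOME z. z \<in> M \<and> y = x \<odot> z)"

lemma quot: "x \<preceq> y \<Longrightarrow> quot x y \<in> M \<and> y = x \<odot> quot x y"
  unfolding quot_def ldiv_def by (rule someI_ex) blast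

definition cpl :: "elt \<Rightarrow> elt" (\<open>\<partial>\<close>) where "\<partial> x = quot x \<Delta>"

lemma compl_mult: "x \<in> P \<Longrightarrow> x \<odot> \<partial> x = \<Delta>" and compl_P [simp]: "x \<in> P \<Longrightarrow> \<partial> x \<in> P"
proof -
  assume x: "x \<in> P"
  then have *: "\<partial> x \<in> M" "\<Delta> = x \<odot> \<partial> x" using quot[of x \<Delta>] P_iff[of x] unfolding cpl_def by auto
  then show "x \<odot> \<partial> x = \<Delta>" by simp
  then show "\<partial> x \<in> P" using right_factor[of x "\<partial> x"] x *(1) \<Delta>_P by simp
qed

text \<open>The join of \<open>x\<close> and \<open>z\<close> divides \<open>x \<odot> m\<close>;
  cancelling \<open>x\<close> from it leaves \<open>w\<close>.\<close>

lemma simple_compl: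
  assumes "x \<in> P" "z \<in> P" "m \<in> M" "z \<preceq> x \<odot> m"
  obtains w u where "w \<in> P" "u \<in> P" "x \<odot> w \<in> P" "w \<preceq> m" "x \<odot> w = z \<odot> u"
proof -
  obtain j where j: "j \<in> P" "x \<preceq> j" "z \<preceq> j" "\<forall>m\<in>M. x \<preceq> m \<longrightarrow> z \<preceq> m \<longrightarrow> j \<preceq> m"
    using simple_lub[OF assms(1,2)] by blast
  obtain w where w: "w \<in> M" "j = x \<odot> w" using j(2) by (rule dvsE)
  obtain u where u: "u \<in> M" "j = z \<odot> u" using j(3) by (rule dvsE)
  have "j \<preceq> x \<odot> m" using j(4) assms by auto
  then have "w \<preceq> m" using dvs_cancel[of x w m] w assms by simp
  moreover have "w \<in> P" "u \<in> P" using right_factor w u j(1) assms by (metis P_M)+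
  ultimately show ?thesis using that w u j by simp
qed

text \<open>A simple divisor of maximal length absorbs any other one, since their join is again a
  simple divisor.\<close>

lemma simple_head:
  assumes "m \<in> M"
  obtains a where "a \<in> P" "a \<preceq> m" "\<And>z. z \<in> P \<Longrightarrow> z \<preceq> m \<Longrightarrow> z \<preceq> a"
proof -
  let ?A = "{z \<in> P. z \<preceq> m}"
  have "finite ?A" "?A \<noteq> {}" using assms by (auto intro: exI[of _ E])
  then have "Max (blen ` ?A) \<in> blen ` ?A" by (intro Max_in) auto
  then obtain a where a: "a \<in> ?A" "blen a = Max (blen ` ?A)" by auto
  have "z \<preceq> a" if z: "z \<in> P" "z \<preceq> m" for z
  proof -
    obtain j where j: "j \<in> P" "a \<preceq> j" "z \<preceq> j" "j \<preceq> m"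
      using simple_lub[of a z] a z assms by blast
    then have "blen j \<le> blen a" using a(2) \<open>finite ?A\<close> by (auto intro!: Max_ge)
    then show ?thesis using dvs_eq[of a j] j a by auto
  qed
  then show ?thesis using that a by blast
qed

lemma Lset_g [simp]: "s \<in> \<Sigma> \<Longrightarrow> Lset k n (g s) = {s}"
  unfolding Lset_def using dvs_eq[of "g _" "g s"] g_inj by auto

lemma Lset_E [simp]: "Lset k n E = {}"
  unfolding Lset_def using dvs_blen[OF g_in_M, of _ E] by fastforce

lemma Rset_E [simp]: "Rset k n E = {}"
  unfolding Rset_def by auto

lemma Lset_empty: "x \<in> M \<Longrightarrow> Lset k n x = {} \<Longrightarrow> x = E"
  unfolding Lset_def by (rule ccontr, erule (1) M_decomp) auto

lemma arrow_E [simp]: "arrow k n x E" unfolding arrow_def by simp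

lemma arrow_from_E: "y \<in> P \<Longrightarrow> arrow k n E y \<Longrightarrow> y = E"
  unfolding arrow_def using Lset_empty by auto

lemma P_mult_iff: "x \<in> P \<Longrightarrow> y \<in> M \<Longrightarrow> x \<odot> y \<in> P \<longleftrightarrow> y \<preceq> \<partial> x"
  using dvs_cancel_iff[of x y "\<partial> x"] compl_mult[of x] P_iff[of "x \<odot> y"] by simp

lemma Rset_iff: "x \<in> P \<Longrightarrow> s \<in> \<Sigma> \<Longrightarrow> s \<in> Rset k n x \<longleftrightarrow> \<not> g s \<preceq> \<partial> x"
  unfolding Rset_def using P_mult_iff[of x "g s"] by simp

lemma compl_eq_\<Delta>: assumes "x \<in> P" "\<Delta> \<preceq> \<partial> x" shows "x = E"
proof -
  have "blen \<Delta> = blen x + blen (\<partial> x)" using compl_mult[OF assms(1)] blen_mult[of x "\<partial> x"] assms(1) by simp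
  moreover have "blen \<Delta> \<le> blen (\<partial> x)" using dvs_blen assms by simp
  ultimately show ?thesis using assms(1) by simp
qed

lemma Rset_empty: assumes "x \<in> P" "Rset k n x = {}" shows "x = E"
  using assms Rset_iff compl_eq_\<Delta> \<Delta>_dvs[of "\<partial> x"] by auto

lemma Rset_\<Delta>: "Rset k n \<Delta> = \<Sigma>"
proof -
  have "\<Delta> \<odot> g s \<notin> P" if "s \<in> \<Sigma>" for s
  proof
    assume "\<Delta> \<odot> g s \<in> P"
    then have "blen (\<Delta> \<odot> g s) \<le> blen \<Delta>" using P_iff dvs_blen by blast
    then show False using that by simp
  qed
  then show ?thesis unfolding Rset_def by auto
qed

subsection \<open>Conjugation by the Garside element\<close>

definition \<phi> :: "elt \<Rightarrow> elt" where "\<phi> x = (SOME y. y \<in> M \<and> x \<odot> \<Delta> = \<Delta> \<odot> y)"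

lemma simple_\<Delta>: "x \<in> P \<Longrightarrow> x \<odot> \<Delta> = \<Delta> \<odot> \<partial> (\<partial> x)"
  using compl_mult[of x] compl_mult[of "\<partial> x"] mult_assoc[of x "\<partial> x" "\<partial> (\<partial> x)"] by simp

lemma \<phi>: "x \<in> M \<Longrightarrow> \<phi> x \<in> M \<and> x \<odot> \<Delta> = \<Delta> \<odot> \<phi> x"
proof -
  assume "x \<in> M"
  then have "\<exists>y. y \<in> M \<and> x \<odot> \<Delta> = \<Delta> \<odot> y"
  proof (induction x rule: M_induct)
    case E
    then show ?case by (intro exI[of _ E]) simp
  next
    case (gen s x)
    then obtain y where y: "y \<in> M" "x \<odot> \<Delta> = \<Delta> \<odot> y" by blast
    have pM: "\<partial> (\<partial> (g s)) \<in> M" using gen by simp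
    have "g s \<odot> x \<odot> \<Delta> = g s \<odot> \<Delta> \<odot> y" using gen y by (simp add: mult_assoc)
    also have "\<dots> = \<Delta> \<odot> (\<partial> (\<partial> (g s)) \<odot> y)" using simple_\<Delta>[of "g s"] gen y pM by (simp add: mult_assoc)
    finally show ?case using y pM by (intro exI[of _ "\<partial> (\<partial> (g s)) \<odot> y"]) simp
  qed
  then show ?thesis unfolding \<phi>_def by (rule someI_ex)
qed

lemma \<phi>_M [simp]: "x \<in> M \<Longrightarrow> \<phi> x \<in> M" using \<phi> by blast

lemma \<phi>_eqI: "x \<in> M \<Longrightarrow> y \<in> M \<Longrightarrow> x \<odot> \<Delta> = \<Delta> \<odot> y \<Longrightarrow> \<phi> x = y"
  using \<phi>[of x] left_cancel[of \<Delta> "\<phi> x" y] by simp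

lemma \<phi>_P: "x \<in> P \<Longrightarrow> \<phi> x = \<partial> (\<partial> x)"
  using \<phi>_eqI simple_\<Delta> by simp

lemma \<phi>_in_P [simp]: "x \<in> P \<Longrightarrow> \<phi> x \<in> P"
  by (simp add: \<phi>_P)

lemma \<phi>_E [simp]: "\<phi> E = E" by (rule \<phi>_eqI) auto

lemma \<phi>_mult: assumes "x \<in> M" "y \<in> M" shows "\<phi> (x \<odot> y) = \<phi> x \<odot> \<phi> y"
proof (rule \<phi>_eqI)
  have "x \<odot> y \<odot> \<Delta> = x \<odot> \<Delta> \<odot> \<phi> y" using assms \<phi>[of y] by (simp add: mult_assoc)
  also have "\<dots> = \<Delta> \<odot> (\<phi> x \<odot> \<phi> y)" using assms \<phi>[of x] by (simp add: mult_assoc)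
  finally show "x \<odot> y \<odot> \<Delta> = \<Delta> \<odot> (\<phi> x \<odot> \<phi> y)" .
qed (use assms in auto)

lemma blen_\<phi>: assumes "x \<in> M" shows "blen (\<phi> x) = blen x"
proof -
  have "blen (x \<odot> \<Delta>) = blen (\<Delta> \<odot> \<phi> x)" using \<phi>[OF assms] by simp
  then show ?thesis using assms by simp
qed

lemma \<phi>_gen: "s \<in> \<Sigma> \<Longrightarrow> \<exists>t\<in>\<Sigma>. \<phi> (g s) = g t"
proof -
  assume s: "s \<in> \<Sigma>"
  have b: "blen (\<phi> (g s)) = 1" using blen_\<phi>[of "g s"] s by simp
  then have "\<phi> (g s) \<noteq> E" by auto
  then obtain t y where t: "t \<in> \<Sigma>" "y \<in> M" "\<phi> (g s) = g t \<odot> y" using M_decomp[of "\<phi> (g s)"] s by auto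
  then have "y = E" using b by simp
  then show ?thesis using t by auto
qed

lemma \<phi>_gen_surj: assumes "t \<in> \<Sigma>" shows "\<exists>s\<in>\<Sigma>. \<phi> (g s) = g t"
proof -
  have inj: "inj_on (\<lambda>s. \<phi> (g s)) \<Sigma>"
  proof (rule inj_onI)
    fix s t assume "s \<in> \<Sigma>" "t \<in> \<Sigma>" "\<phi> (g s) = \<phi> (g t)"
    then show "s = t" using \<phi>[of "g s"] \<phi>[of "g t"] gen_Delta_inj by simp
  qed
  have sub: "(\<lambda>s. \<phi> (g s)) ` \<Sigma> \<subseteq> g ` \<Sigma>"
  proof
    fix x assume "x \<in> (\<lambda>s. \<phi> (g s)) ` \<Sigma>"
    then obtain s where "s \<in> \<Sigma>" "x = \<phi> (g s)" by blast
    then show "x \<in> g ` \<Sigma>" using \<phi>_gen[of s] by auto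
  qed
  have "card (g ` \<Sigma>) \<le> card ((\<lambda>s. \<phi> (g s)) ` \<Sigma>)"
    using card_image[OF inj] card_image_le[OF finite_gens, of g k n] by simp
  then have "(\<lambda>s. \<phi> (g s)) ` \<Sigma> = g ` \<Sigma>" using card_seteq[OF _ sub] by simp
  then show ?thesis using assms by (metis (no_types, lifting) imageE image_eqI)
qed

lemma \<phi>_surj: "y \<in> M \<Longrightarrow> \<exists>x\<in>M. \<phi> x = y"
proof (induction y rule: M_induct)
  case E
  then show ?case by (intro bexI[of _ E]) auto
next
  case (gen t y)
  then obtain x s where "x \<in> M" "\<phi> x = y" "s \<in> \<Sigma>" "\<phi> (g s) = g t" using \<phi>_gen_surj by blast
  then show ?case by (intro bexI[of _ "g s \<odot> x"]) (auto simp: \<phi>_mult)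
qed

text \<open>A surjection of the finite set of elements of one length onto itself is injective; this
  replaces right cancellation by \<open>\<Delta>\<close>, assumed only for atoms.\<close>

lemma \<phi>_inj: assumes "x \<in> M" "y \<in> M" "\<phi> x = \<phi> y" shows "x = y"
proof -
  let ?A = "{z \<in> M. blen z = blen x}"
  have "?A \<subseteq> \<phi> ` ?A"
  proof
    fix z assume z: "z \<in> ?A"
    then obtain w where "w \<in> M" "\<phi> w = z" using \<phi>_surj by blast
    then show "z \<in> \<phi> ` ?A" using z blen_\<phi> by force
  qed
  then have "inj_on \<phi> ?A" using finite_surj_inj[OF finite_M_blen] by blast
  moreover have "blen y = blen x" using blen_\<phi> assms by metis
  ultimately show ?thesis using assms by (auto dest: inj_onD)
qed

lemma \<phi>_dvs: assumes "x \<in> M" "y \<in> M" shows "\<phi> x \<preceq> \<phi> y \<longleftrightarrow> x \<preceq> y"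
proof
  assume "\<phi> x \<preceq> \<phi> y"
  then obtain z where z: "z \<in> M" "\<phi> y = \<phi> x \<odot> z" by (rule dvsE)
  then obtain z' where "z' \<in> M" "\<phi> z' = z" using \<phi>_surj by blast
  then have "\<phi> y = \<phi> (x \<odot> z')" "z' \<in> M" using z assms by (auto simp: \<phi>_mult)
  then have "y = x \<odot> z'" using \<phi>_inj assms by simp
  then show "x \<preceq> y" using \<open>z' \<in> M\<close> by auto
next
  assume "x \<preceq> y"
  then obtain z where "z \<in> M" "y = x \<odot> z" by (rule dvsE)
  then show "\<phi> x \<preceq> \<phi> y" using assms by (auto simp: \<phi>_mult)
qed

lemma \<phi>_\<Delta>: "\<phi> \<Delta> = \<Delta>" by (rule \<phi>_eqI) auto

lemma \<phi>_P_iff: "x \<in> M \<Longrightarrow> \<phi> x \<in> P \<longleftrightarrow> x \<in> P"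
  using \<phi>_dvs[of x \<Delta>] P_iff \<phi>_\<Delta> by simp

lemma arrow_\<phi>: assumes "x \<in> P" "y \<in> P" "arrow k n x y" shows "arrow k n (\<phi> x) (\<phi> y)"
  unfolding arrow_def
proof
  fix t assume t: "t \<in> Lset k n (\<phi> y)"
  then obtain s where s: "s \<in> \<Sigma>" "\<phi> (g s) = g t" using \<phi>_gen_surj unfolding Lset_def by blast
  then have "g s \<preceq> y" using \<phi>_dvs[of "g s" y] t assms unfolding Lset_def by auto
  then have "x \<odot> g s \<notin> P" using assms(3) s unfolding arrow_def Lset_def Rset_def by auto
  then have "\<phi> x \<odot> g t \<notin> P" using \<phi>_P_iff[of "x \<odot> g s"] s assms by (simp add: \<phi>_mult)
  then show "t \<in> Rset k n (\<phi> x)" using t unfolding Rset_def Lset_def by auto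
qed

text \<open>An arrow from \<open>x\<close> to \<open>y\<close> says that \<open>\<partial> x\<close>
  and \<open>y\<close> have no common atom. Applying \<open>\<phi>\<close>, with
  \<open>\<phi> y = \<partial> (\<partial> y)\<close>, turns this into the arrow between
  complements.\<close>

lemma arrow_compl: assumes "x \<in> P" "y \<in> P" "arrow k n x y" shows "arrow k n (\<partial> y) (\<phi> (\<partial> x))"
  unfolding arrow_def
proof
  fix t assume t: "t \<in> Lset k n (\<phi> (\<partial> x))"
  then obtain s where s: "s \<in> \<Sigma>" "\<phi> (g s) = g t" using \<phi>_gen_surj unfolding Lset_def by blast
  have tS: "t \<in> \<Sigma>" "g t \<preceq> \<phi> (\<partial> x)" using t unfolding Lset_def by auto
  then have "g s \<preceq> \<partial> x" using \<phi>_dvs[of "g s" "\<partial> x"] s assms by auto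
  then have "\<not> g s \<preceq> y" using assms s Rset_iff[of x s] unfolding arrow_def Lset_def by auto
  then have "\<not> g t \<preceq> \<phi> y" using \<phi>_dvs[of "g s" y] s assms by auto
  then show "t \<in> Rset k n (\<partial> y)" using Rset_iff[of "\<partial> y" t] tS assms by (simp add: \<phi>_P)
qed

subsection \<open>Normal sequences\<close>

definition pr :: "(nat \<Rightarrow> elt) \<Rightarrow> nat \<Rightarrow> elt" where "pr \<xi> j = mprod k n (map \<xi> [0..<j])"

lemma pr_0 [simp]: "pr \<xi> 0 = E" by (simp add: pr_def mprod_def)

lemma pr_Cons: "pr \<xi> (Suc j) = \<xi> 0 \<odot> pr (\<lambda>i. \<xi> (Suc i)) j"
proof -
  have "map \<xi> [0..<Suc j] = \<xi> 0 # map (\<lambda>i. \<xi> (Suc i)) [0..<j]"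
    by (simp add: upt_conv_Cons map_Suc_upt[symmetric] del: upt_Suc)
  then show ?thesis by (simp add: pr_def mprod_def)
qed

lemma pr_M [simp]: "(\<And>i. \<xi> i \<in> M) \<Longrightarrow> pr \<xi> j \<in> M"
  by (induction j arbitrary: \<xi>) (auto simp: pr_Cons)

lemma pr_Suc: "(\<And>i. \<xi> i \<in> M) \<Longrightarrow> pr \<xi> (Suc j) = pr \<xi> j \<odot> \<xi> j"
proof (induction j arbitrary: \<xi>)
  case (Suc j)
  have "pr \<xi> (Suc (Suc j)) = \<xi> 0 \<odot> (pr (\<lambda>i. \<xi> (Suc i)) j \<odot> \<xi> (Suc j))"
    using Suc.IH[of "\<lambda>i. \<xi> (Suc i)"] Suc.prems by (simp add: pr_Cons)
  then show ?case using Suc.prems by (simp add: pr_Cons mult_assoc)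
qed (simp add: pr_Cons)

lemma pr_cong: "(\<And>i. i < j \<Longrightarrow> \<xi> i = \<eta> i) \<Longrightarrow> pr \<xi> j = pr \<eta> j"
  unfolding pr_def by (metis atLeastLessThan_iff map_cong set_upt)

lemma pr_dvs: assumes "\<And>i. \<xi> i \<in> M" "i \<le> j" shows "pr \<xi> i \<preceq> pr \<xi> j"
  using assms(2)
proof (induction rule: dec_induct)
  case (step j)
  then show ?case using assms(1) dvs_mult by (simp add: pr_Suc)
qed (use assms in simp)

lemma pr_E: assumes "\<And>i. \<xi> i \<in> M" "\<And>l. i \<le> l \<Longrightarrow> \<xi> l = E" "i \<le> j" shows "pr \<xi> j = pr \<xi> i"
  using assms(3)
proof (induction rule: dec_induct)
  case (step j)
  then show ?case using assms by (simp add: pr_Suc)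
qed simp

lemma pr_\<phi>: "(\<And>i. \<xi> i \<in> M) \<Longrightarrow> pr (\<lambda>i. \<phi> (\<xi> i)) j = \<phi> (pr \<xi> j)"
  by (induction j) (auto simp: pr_Suc \<phi>_mult)

lemma Mbar_P: "\<xi> \<in> Mbar k n \<Longrightarrow> \<xi> i \<in> P" and Mbar_arrow: "\<xi> \<in> Mbar k n \<Longrightarrow> arrow k n (\<xi> i) (\<xi> (Suc i))"
  unfolding Mbar_def by auto

lemma Mbar_M [simp]: "\<xi> \<in> Mbar k n \<Longrightarrow> \<xi> i \<in> M" by (simp add: Mbar_P)

lemma Mbar_shift: "\<xi> \<in> Mbar k n \<Longrightarrow> (\<lambda>i. \<xi> (Suc i)) \<in> Mbar k n"
  unfolding Mbar_def by auto

lemma Mbar_E: assumes "\<xi> \<in> Mbar k n" "\<xi> i = E" "i \<le> j" shows "\<xi> j = E"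
  using assms(3)
proof (induction rule: dec_induct)
  case (step j)
  then show ?case using arrow_from_E Mbar_arrow[OF assms(1), of j] Mbar_P[OF assms(1)] by simp
qed (use assms in simp)

text \<open>Greediness. The divisor \<open>z\<close> fits into \<open>\<xi> 0 \<odot> w\<close> with
  \<open>w\<close> a simple divisor of the tail. By induction \<open>w\<close> divides
  \<open>\<xi> 1\<close>, so an atom of \<open>w\<close> would be forbidden by the arrow; hence
  \<open>w = E\<close>.\<close>

lemma head_pr: "\<xi> \<in> Mbar k n \<Longrightarrow> z \<in> P \<Longrightarrow> z \<preceq> pr \<xi> j \<Longrightarrow> z \<preceq> \<xi> 0"
proof (induction j arbitrary: \<xi> z)
  case 0
  then have "z = E" using dvs_blen[of z E] by auto
  then show ?case using 0 by simp
next
  case (Suc j)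
  let ?\<xi> = "\<lambda>i. \<xi> (Suc i)"
  have sh: "?\<xi> \<in> Mbar k n" using Suc.prems Mbar_shift by blast
  obtain w u where w: "w \<in> P" "u \<in> P" "\<xi> 0 \<odot> w \<in> P" "w \<preceq> pr ?\<xi> j" "\<xi> 0 \<odot> w = z \<odot> u"
    using simple_compl[of "\<xi> 0" z "pr ?\<xi> j"] Suc.prems Mbar_P sh by (auto simp: pr_Cons)
  have "w \<preceq> \<xi> 1" using Suc.IH[OF sh w(1) w(4)] by simp
  have "w = E"
  proof (rule ccontr)
    assume "w \<noteq> E"
    then obtain s y where s: "s \<in> \<Sigma>" "y \<in> M" "w = g s \<odot> y" using M_decomp w(1) by (metis P_M)
    then have gw: "g s \<preceq> w" by auto
    then have "g s \<preceq> \<xi> 1" using \<open>w \<preceq> \<xi> 1\<close> dvs_trans s by (meson g_in_M)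
    then have "\<xi> 0 \<odot> g s \<notin> P"
      using Mbar_arrow[OF Suc.prems(1), of 0] s unfolding arrow_def Lset_def Rset_def by auto
    moreover have "\<xi> 0 \<odot> g s \<preceq> \<xi> 0 \<odot> w" using gw s Suc.prems by (intro dvs_mult_left) auto
    ultimately show False using P_dvs[OF _ _ w(3)] Suc.prems s by simp
  qed
  then have "\<xi> 0 = z \<odot> u" using w(5) Suc.prems by simp
  then show ?case using w(2) by auto
qed

section \<open>Products of a bounded number of simple elements\<close>

fun Hs :: "nat \<Rightarrow> elt set" where
  "Hs 0 = {E}" | "Hs (Suc j) = {a \<odot> b | a b. a \<in> P \<and> b \<in> Hs j}"

lemma Hs_M: "x \<in> Hs j \<Longrightarrow> x \<in> M"
  by (induction j arbitrary: x) auto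

lemma E_Hs: "E \<in> Hs j"
  by (induction j) (auto intro!: exI[of _ E])

lemma Hs_blen: "x \<in> M \<Longrightarrow> x \<in> Hs (blen x)"
proof (induction x rule: M_induct)
  case (gen s y)
  then show ?case using g_P[of s] by (simp, blast)
qed simp

lemma Hs_mono: assumes "i \<le> j" shows "Hs i \<subseteq> Hs j"
  using assms
proof (induction i arbitrary: j)
  case 0
  then show ?case using E_Hs by simp
next
  case (Suc i)
  then obtain j' where "j = Suc j'" "i \<le> j'" by (cases j) auto
  then show ?case using Suc.IH by auto
qed

lemma pr_Hs: "(\<And>i. \<xi> i \<in> P) \<Longrightarrow> pr \<xi> j \<in> Hs j"
proof (induction j arbitrary: \<xi>)
  case (Suc j)
  have "pr (\<lambda>i. \<xi> (Suc i)) j \<in> Hs j" by (rule Suc.IH) (rule Suc.prems)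
  then show ?case unfolding pr_Cons Hs.simps using Suc.prems[of 0] by blast
qed simp

text \<open>\<open>simple_compl\<close> factor by factor: the cofactor \<open>u'\<close> left by one
  join plays the role of \<open>u\<close> for the next.\<close>

lemma Hs_compl:
  "u \<in> P \<Longrightarrow> x \<in> Hs j \<Longrightarrow> m \<in> M \<Longrightarrow> x \<preceq> u \<odot> m \<Longrightarrow> \<exists>w\<in>Hs j. w \<preceq> m \<and> x \<preceq> u \<odot> w"
proof (induction j arbitrary: u x m)
  case 0
  then show ?case by simp
next
  case (Suc j)
  then obtain y x' where x: "x = y \<odot> x'" "y \<in> P" "x' \<in> Hs j" by auto
  have x'M: "x' \<in> M" using Hs_M x by blast
  have "y \<preceq> u \<odot> m" using dvs_trans[OF _ _ Suc.prems(4), of y] dvsI[OF x'M, of y] x by simp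
  then obtain w1 u' where w1: "w1 \<in> P" "u' \<in> P" "u \<odot> w1 \<in> P" "w1 \<preceq> m" "u \<odot> w1 = y \<odot> u'"
    using simple_compl Suc.prems x by metis
  obtain m3 where m3: "m3 \<in> M" "m = w1 \<odot> m3" using w1(4) by (rule dvsE)
  have um: "u \<odot> m = y \<odot> (u' \<odot> m3)" using w1 m3 x Suc.prems by (simp flip: mult_assoc)
  then have "x' \<preceq> u' \<odot> m3" using Suc.prems(4) dvs_cancel[of y x' "u' \<odot> m3"] x x'M w1 m3 by simp
  then obtain w2 where w2: "w2 \<in> Hs j" "w2 \<preceq> m3" "x' \<preceq> u' \<odot> w2" using Suc.IH w1 x m3 by blast
  have w2M: "w2 \<in> M" using Hs_M w2 by blast
  have "w1 \<odot> w2 \<in> Hs (Suc j)" using w1 w2 by auto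
  moreover have "w1 \<odot> w2 \<preceq> m" using m3 w1 w2 w2M by (auto intro: dvs_mult_left)
  moreover have "x \<preceq> u \<odot> (w1 \<odot> w2)"
  proof -
    have "y \<odot> x' \<preceq> y \<odot> (u' \<odot> w2)" using w2 x x'M by (intro dvs_mult_left) auto
    also have "y \<odot> (u' \<odot> w2) = u \<odot> (w1 \<odot> w2)" using w1 x w2M Suc.prems by (simp flip: mult_assoc)
    finally show ?thesis using x by simp
  qed
  ultimately show ?case by blast
qed

text \<open>The first simple factor of \<open>x\<close> is absorbed by \<open>\<xi> 0\<close>. The
  rest divides \<open>u\<close> times the tail, and \<open>Hs_compl\<close> exchanges it for a
  divisor \<open>w\<close> of the tail that still has \<open>j\<close> factors. Hence divisibility
  by \<open>x\<close> is decided by the first \<open>j\<close> entries of a normal sequence.\<close>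

lemma Hs_dvs_pr: "\<xi> \<in> Mbar k n \<Longrightarrow> x \<in> Hs j \<Longrightarrow> x \<preceq> pr \<xi> i \<Longrightarrow> x \<preceq> pr \<xi> j"
proof (induction j arbitrary: \<xi> i x)
  case 0
  then show ?case by simp
next
  case (Suc j)
  obtain x1 x' where x: "x = x1 \<odot> x'" "x1 \<in> P" "x' \<in> Hs j" using Suc.prems by auto
  have x'M: "x' \<in> M" using Hs_M x by blast
  let ?\<xi> = "\<lambda>i. \<xi> (Suc i)"
  have sh: "?\<xi> \<in> Mbar k n" using Suc.prems Mbar_shift by blast
  show ?case
  proof (cases i)
    case 0
    then have "x = E" using Suc.prems(3) dvs_blen[of x E] x x'M by auto
    then show ?thesis using Suc.prems by simp
  next
    case (Suc i')
    have "x1 \<preceq> pr \<xi> i" using dvs_trans[OF _ _ Suc.prems(3), of x1] dvsI[OF x'M, of x1] x by simp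
    then have "x1 \<preceq> \<xi> 0" using head_pr Suc.prems x by blast
    then obtain u where u: "u \<in> M" "\<xi> 0 = x1 \<odot> u" by (rule dvsE)
    have uP: "u \<in> P" using right_factor[of x1 u] u x Mbar_P[OF Suc.prems(1), of 0] by simp
    have prM: "pr ?\<xi> i' \<in> M" by (rule pr_M) (use Suc.prems(1) in simp)
    then have "x1 \<odot> x' \<preceq> x1 \<odot> (u \<odot> pr ?\<xi> i')"
      using Suc.prems(3) x u Suc by (simp add: pr_Cons mult_assoc)
    then have "x' \<preceq> u \<odot> pr ?\<xi> i'" using dvs_cancel[of x1 x' "u \<odot> pr ?\<xi> i'"] x x'M u prM by simp
    then obtain w where w: "w \<in> Hs j" "w \<preceq> pr ?\<xi> i'" "x' \<preceq> u \<odot> w"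
      using Hs_compl[OF uP x(3) prM] by blast
    have wM: "w \<in> M" using Hs_M w by blast
    have "w \<preceq> pr ?\<xi> j" using Suc.IH[OF sh w(1,2)] .
    then have 1: "\<xi> 0 \<odot> w \<preceq> pr \<xi> (Suc j)" using wM Suc.prems by (auto simp: pr_Cons intro: dvs_mult_left)
    have "x \<preceq> x1 \<odot> (u \<odot> w)" using w(3) x x'M by (auto intro: dvs_mult_left)
    then have "x \<preceq> \<xi> 0 \<odot> w" using u wM x by (simp add: mult_assoc)
    then show ?thesis using 1 dvs_trans x x'M by (meson P_M mult_in_M)
  qed
qed

lemma pr_inj: "\<xi> \<in> Mbar k n \<Longrightarrow> \<eta> \<in> Mbar k n \<Longrightarrow> pr \<xi> i = pr \<eta> i \<Longrightarrow> l < i \<Longrightarrow> \<xi> l = \<eta> l"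
proof (induction i arbitrary: \<xi> \<eta> l)
  case (Suc i)
  have "\<xi> 0 \<preceq> pr \<xi> (Suc i)" "\<eta> 0 \<preceq> pr \<eta> (Suc i)"
    using pr_dvs[of \<xi> 1 "Suc i"] pr_dvs[of \<eta> 1 "Suc i"] Suc.prems by (auto simp: pr_Cons)
  then have "\<xi> 0 \<preceq> \<eta> 0" "\<eta> 0 \<preceq> \<xi> 0" using head_pr Suc.prems Mbar_P by metis+
  then have 0: "\<xi> 0 = \<eta> 0" using dvs_antisym Suc.prems by auto
  have "pr (\<lambda>i. \<xi> (Suc i)) i = pr (\<lambda>i. \<eta> (Suc i)) i"
    using left_cancel[of "\<xi> 0"] Suc.prems 0 by (simp add: pr_Cons)
  then show ?case
    using Suc.IH[of "\<lambda>i. \<xi> (Suc i)" "\<lambda>i. \<eta> (Suc i)" "l - 1"] Suc.prems Mbar_shift 0 by (cases l) auto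
qed simp

section \<open>Existence and uniqueness of normal forms\<close>

lemma nf_ex: "m \<in> M \<Longrightarrow> \<exists>\<xi>\<in>Mbar k n. (\<forall>i\<ge>blen m. \<xi> i = E) \<and> pr \<xi> (blen m) = m"
proof (induction "blen m" arbitrary: m rule: less_induct)
  case less
  show ?case
  proof (cases "m = E")
    case True
    then show ?thesis by (intro bexI[of _ "\<lambda>_. E"]) (auto simp: Mbar_def)
  next
    case False
    obtain a where a: "a \<in> P" "a \<preceq> m" "\<And>z. z \<in> P \<Longrightarrow> z \<preceq> m \<Longrightarrow> z \<preceq> a"
      using simple_head[OF less.prems] by blast
    obtain m' where m': "m' \<in> M" "m = a \<odot> m'" using a(2) by (rule dvsE)
    obtain s y where s: "s \<in> \<Sigma>" "y \<in> M" "m = g s \<odot> y" using M_decomp[OF less.prems False] by blast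
    have "g s \<preceq> a" using a(3)[of "g s"] s by auto
    then have "1 \<le> blen a" using dvs_blen[of "g s" a] s by simp
    then have lt: "blen m' < blen m" using m' a by simp
    then obtain \<xi> where \<xi>: "\<xi> \<in> Mbar k n" "\<And>i. blen m' \<le> i \<Longrightarrow> \<xi> i = E" "pr \<xi> (blen m') = m'"
      using less.hyps m' by blast
    have pr': "pr \<xi> i = m'" if "blen m' \<le> i" for i using pr_E[of \<xi> "blen m'" i] \<xi> that by simp
    have "\<xi> 0 \<preceq> pr \<xi> (Suc (blen m'))" using pr_dvs[of \<xi> 1 "Suc (blen m')"] \<xi> by (simp add: pr_Cons)
    then have \<xi>0: "\<xi> 0 \<preceq> m'" using pr' by simp
    \<comment> \<open>An atom of the next factor that fitted behind \<open>a\<close> would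
      contradict the maximality of \<open>a\<close>.\<close>
    have "arrow k n a (\<xi> 0)"
      unfolding arrow_def
    proof
      fix t assume t: "t \<in> Lset k n (\<xi> 0)"
      then have tS: "t \<in> \<Sigma>" "g t \<preceq> m'" using dvs_trans[OF _ _ \<xi>0, of "g t"] unfolding Lset_def by auto
      have "a \<odot> g t \<notin> P"
      proof
        assume p: "a \<odot> g t \<in> P"
        moreover have "a \<odot> g t \<preceq> m" using m' tS a by (auto intro: dvs_mult_left)
        ultimately have "a \<odot> g t \<preceq> a" using a(3) by blast
        then show False using dvs_blen[of "a \<odot> g t" a] a tS by simp
      qed
      then show "t \<in> Rset k n a" using tS unfolding Rset_def by blast
    qed
    then have mb: "case_nat a \<xi> \<in> Mbar k n"
      using \<xi>(1) a(1) unfolding Mbar_def by (auto split: nat.split)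
    have tail: "\<forall>i\<ge>blen m. case_nat a \<xi> i = E" using \<xi>(2) lt by (auto split: nat.split)
    obtain b where b: "blen m = Suc b" using lt by (cases "blen m") auto
    have "pr (case_nat a \<xi>) (Suc b) = a \<odot> pr \<xi> b" by (simp add: pr_Cons)
    then have "pr (case_nat a \<xi>) (blen m) = m" using pr'[of b] lt b m' by simp
    then show ?thesis using mb tail by blast
  qed
qed

lemma nfs_eqI:
  assumes "\<xi> \<in> Mbar k n" "\<And>i. N \<le> i \<Longrightarrow> \<xi> i = E" "pr \<xi> N = m"
  shows "nfs k n m = \<xi>"
  unfolding nfs_def pr_def[symmetric]
proof (rule the_equality)
  show "\<xi> \<in> Mbar k n \<and> (\<exists>N. (\<forall>i\<ge>N. \<xi> i = E) \<and> pr \<xi> N = m)" using assms by blast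
next
  fix \<eta> assume "\<eta> \<in> Mbar k n \<and> (\<exists>N. (\<forall>i\<ge>N. \<eta> i = E) \<and> pr \<eta> N = m)"
  then obtain N' where \<eta>: "\<eta> \<in> Mbar k n" "\<forall>i\<ge>N'. \<eta> i = E" "pr \<eta> N' = m" by blast
  have eq: "pr \<xi> i = pr \<eta> i" if "N \<le> i" "N' \<le> i" for i
    using pr_E[of \<xi> N i] pr_E[of \<eta> N' i] assms \<eta> that by simp
  show "\<eta> = \<xi>"
  proof
    fix l show "\<eta> l = \<xi> l"
      using pr_inj[OF \<eta>(1) assms(1), of "Suc (max l (max N N'))" l] eq[of "Suc (max l (max N N'))"] by simp
  qed
qed

lemma nfs_Mbar [simp]: "m \<in> M \<Longrightarrow> nfs k n m \<in> Mbar k n"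
  and nfs_tail: "m \<in> M \<Longrightarrow> blen m \<le> i \<Longrightarrow> nfs k n m i = E"
  and pr_nfs: "m \<in> M \<Longrightarrow> blen m \<le> i \<Longrightarrow> pr (nfs k n m) i = m"
proof -
  assume "m \<in> M"
  then obtain \<xi> where \<xi>: "\<xi> \<in> Mbar k n" "\<And>i. blen m \<le> i \<Longrightarrow> \<xi> i = E" "pr \<xi> (blen m) = m"
    using nf_ex by blast
  then have nf: "nfs k n m = \<xi>" using nfs_eqI by blast
  show "nfs k n m \<in> Mbar k n" using nf \<xi> by simp
  show "nfs k n m i = E" if "blen m \<le> i" using nf \<xi> that by simp
  show "pr (nfs k n m) i = m" if "blen m \<le> i" using nf \<xi> pr_E[of \<xi> "blen m" i] that by simp
qed

lemma nfs_inj: "x \<in> M \<Longrightarrow> y \<in> M \<Longrightarrow> nfs k n x = nfs k n y \<Longrightarrow> x = y"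
  by (metis pr_nfs max.cobounded1 max.cobounded2)

lemma nfs_E: "nfs k n E = (\<lambda>_. E)"
  by (rule nfs_eqI[where N = 0]) (auto simp: Mbar_def)

lemma nfs_pr:
  assumes "\<xi> \<in> Mbar k n"
  shows "nfs k n (pr \<xi> j) = (\<lambda>i. if i < j then \<xi> i else E)"
proof (rule nfs_eqI[where N = j])
  show "(\<lambda>i. if i < j then \<xi> i else E) \<in> Mbar k n" using assms by (auto simp: Mbar_def)
  show "pr (\<lambda>i. if i < j then \<xi> i else E) j = pr \<xi> j" by (rule pr_cong) simp
qed auto

text \<open>The complements of the factors of a normal sequence, read backwards and twisted by \<open>\<phi>\<close>, form the
  normal sequence of the complement in a power of \<open>\<Delta>\<close>.\<close>

definition cs :: "(nat \<Rightarrow> elt) \<Rightarrow> nat \<Rightarrow> nat \<Rightarrow> elt" where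
  "cs \<xi> r i = (if i < r then (\<phi> ^^ i) (\<partial> (\<xi> (r - 1 - i))) else E)"

lemma \<phi>_pow_P: "x \<in> P \<Longrightarrow> (\<phi> ^^ i) x \<in> P"
  by (induction i) auto

lemma arrow_\<phi>_pow: "x \<in> P \<Longrightarrow> y \<in> P \<Longrightarrow> arrow k n x y \<Longrightarrow> arrow k n ((\<phi> ^^ i) x) ((\<phi> ^^ i) y)"
  by (induction i) (auto simp: arrow_\<phi> \<phi>_pow_P)

lemma cs_Mbar: assumes "\<xi> \<in> Mbar k n" shows "cs \<xi> r \<in> Mbar k n"
proof -
  have P: "cs \<xi> r i \<in> P" for i unfolding cs_def using Mbar_P[OF assms] by (auto simp: \<phi>_pow_P)
  have "arrow k n (cs \<xi> r i) (cs \<xi> r (Suc i))" for i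
  proof (cases "Suc i < r")
    case True
    then have "r - 1 - i = Suc (r - 1 - Suc i)" by simp
    then have "arrow k n (\<partial> (\<xi> (r - 1 - i))) (\<phi> (\<partial> (\<xi> (r - 1 - Suc i))))"
      using arrow_compl[OF _ _ Mbar_arrow[OF assms, of "r - 1 - Suc i"]] Mbar_P[OF assms] by simp
    then show ?thesis using True arrow_\<phi>_pow Mbar_P[OF assms] unfolding cs_def by (simp add: funpow_swap1)
  qed (simp add: cs_def)
  then show ?thesis using P unfolding Mbar_def by blast
qed

text \<open>The innermost pair \<open>\<xi> r \<odot> \<partial> (\<xi> r)\<close> equals
  \<open>\<Delta>\<close>, and \<open>\<phi>\<close> is what lets this \<open>\<Delta>\<close> pass
  to the right of the complement of the shorter prefix.\<close>

lemma cs_mult: assumes "\<xi> \<in> Mbar k n" shows "pr \<xi> r \<odot> pr (cs \<xi> r) r = pr (\<lambda>_. \<Delta>) r"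
proof (induction r)
  case (Suc r)
  have cM: "cs \<xi> r i \<in> M" for r i using cs_Mbar[OF assms] by simp
  have "pr (cs \<xi> (Suc r)) (Suc r) = \<partial> (\<xi> r) \<odot> pr (\<lambda>i. cs \<xi> (Suc r) (Suc i)) r"
    by (simp add: pr_Cons cs_def)
  also have "pr (\<lambda>i. cs \<xi> (Suc r) (Suc i)) r = pr (\<lambda>i. \<phi> (cs \<xi> r i)) r"
    by (rule pr_cong) (simp add: cs_def)
  also have "\<dots> = \<phi> (pr (cs \<xi> r) r)" using cM by (simp add: pr_\<phi>)
  finally have 1: "pr (cs \<xi> (Suc r)) (Suc r) = \<partial> (\<xi> r) \<odot> \<phi> (pr (cs \<xi> r) r)" .
  have pM: "pr (cs \<xi> r) r \<in> M" using cM by simp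
  have dM: "\<partial> (\<xi> r) \<in> M" using Mbar_P[OF assms] by simp
  have "pr \<xi> (Suc r) \<odot> pr (cs \<xi> (Suc r)) (Suc r) = pr \<xi> r \<odot> (\<xi> r \<odot> \<partial> (\<xi> r) \<odot> \<phi> (pr (cs \<xi> r) r))"
    unfolding 1 using assms pM dM by (simp add: pr_Suc mult_assoc)
  also have "\<xi> r \<odot> \<partial> (\<xi> r) \<odot> \<phi> (pr (cs \<xi> r) r) = pr (cs \<xi> r) r \<odot> \<Delta>"
    using compl_mult Mbar_P[OF assms] \<phi>[OF pM] by simp
  also have "pr \<xi> r \<odot> (pr (cs \<xi> r) r \<odot> \<Delta>) = pr (\<lambda>_. \<Delta>) r \<odot> \<Delta>"
    using Suc.IH assms pM by (simp flip: mult_assoc)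
  finally show ?case by (simp add: pr_Suc)
qed simp

text \<open>If \<open>r + 1\<close> factors divide a product of \<open>r\<close>, their complement
  in the power \<open>r + 1\<close> of \<open>\<Delta>\<close> contains a whole
  \<open>\<Delta>\<close> on the left. Greediness pushes it into the first factor
  \<open>\<partial> (\<xi> r)\<close>, which leaves no room for \<open>\<xi> r\<close>.\<close>

lemma pr_Suc_dvs_pr:
  assumes "\<xi> \<in> Mbar k n" "\<eta> \<in> Mbar k n" "pr \<xi> (Suc r) \<preceq> pr \<eta> r"
  shows "\<xi> r = E"
proof -
  have cM: "cs \<xi> r i \<in> M" "cs \<eta> r i \<in> M" for r i using cs_Mbar assms by simp_all
  obtain y where y: "y \<in> M" "pr \<eta> r = pr \<xi> (Suc r) \<odot> y" using assms(3) by (rule dvsE)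
  define y' where "y' = y \<odot> pr (cs \<eta> r) r"
  have y'M: "y' \<in> M" unfolding y'_def using y cM by simp
  have "pr (\<lambda>_. \<Delta>) r = pr \<xi> (Suc r) \<odot> y'"
    unfolding y'_def cs_mult[OF assms(2), symmetric] y(2) using y cM assms by (simp add: mult_assoc)
  then have "pr \<xi> (Suc r) \<odot> pr (cs \<xi> (Suc r)) (Suc r) = pr \<xi> (Suc r) \<odot> (y' \<odot> \<Delta>)"
    unfolding cs_mult[OF assms(1)] using y'M assms by (simp add: pr_Suc mult_assoc)
  then have "pr (cs \<xi> (Suc r)) (Suc r) = \<Delta> \<odot> \<phi> y'"
    using left_cancel[OF pr_M pr_M mult_in_M] Mbar_M[OF assms(1)] cM y'M \<phi>[OF y'M] \<Delta>_M by metis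
  then have "\<Delta> \<preceq> pr (cs \<xi> (Suc r)) (Suc r)" using y'M by auto
  then have "\<Delta> \<preceq> cs \<xi> (Suc r) 0" using head_pr[OF cs_Mbar[OF assms(1)] \<Delta>_P] by blast
  then show ?thesis using compl_eq_\<Delta>[OF Mbar_P[OF assms(1)]] by (simp add: cs_def)
qed

text \<open>Otherwise \<open>g s\<close> could be appended as a further normal factor, and a normal
  product of \<open>j + 2\<close> factors would divide one of \<open>j + 1\<close>.\<close>

lemma pr_mult_gen_dvs:
  assumes \<xi>: "\<xi> \<in> Mbar k n" and \<eta>: "\<eta> \<in> Mbar k n" and s: "s \<in> \<Sigma>" "pr \<xi> (Suc j) \<odot> g s \<preceq> pr \<eta> (Suc j)"
  shows "\<xi> j \<odot> g s \<in> P"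
proof (rule ccontr)
  assume n: "\<xi> j \<odot> g s \<notin> P"
  define \<zeta> where "\<zeta> i = (if i \<le> j then \<xi> i else if i = Suc j then g s else E)" for i
  have "arrow k n (\<xi> j) (g s)" unfolding arrow_def using s n by (simp add: Rset_def)
  then have z: "\<zeta> \<in> Mbar k n" using \<xi> s unfolding Mbar_def \<zeta>_def by (auto simp: le_Suc_eq)
  have "pr \<zeta> (Suc j) = pr \<xi> (Suc j)" by (rule pr_cong) (simp add: \<zeta>_def)
  then have "pr \<zeta> (Suc (Suc j)) = pr \<xi> (Suc j) \<odot> g s" 
    using pr_Suc[of \<zeta> "Suc j"] z \<zeta>_def[of "Suc j"] by (metis Mbar_M Suc_n_not_le_n)
  then have "\<zeta> (Suc j) = E" using pr_Suc_dvs_pr[OF z \<eta>] s by simp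
  then have "g s = E" by (simp add: \<zeta>_def)
  then have "blen (g s) = 0" by simp
  then show False by simp
qed

end

section \<open>Cylinders\<close>

lemma sum_Pow_insert:
  assumes "finite A" "a \<notin> A"
  shows "(\<Sum>X\<in>Pow (insert a A). f X) = (\<Sum>X\<in>Pow A. f X) + (\<Sum>X\<in>Pow A. f (insert a X))"
proof -
  have "inj_on (insert a) (Pow A)" using assms(2) by (auto simp: inj_on_def)
  moreover have "Pow A \<inter> insert a ` Pow A = {}" using assms(2) by auto
  ultimately show ?thesis
    using assms(1) by (simp add: Pow_insert sum.union_disjoint sum.reindex)
qed

lemma alternating_sum_Pow:
  assumes "finite A"
  shows "(\<Sum>X\<in>Pow A. (- 1) ^ card X) = (if A = {} then 1 else 0 :: real)"
proof (cases "A = {}")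
  case False
  then obtain a B where A: "A = insert a B" "a \<notin> B" by (meson Set.set_insert all_not_in_conv)
  have fB: "finite B" using assms A by simp
  have "(\<Sum>X\<in>Pow B. (- 1) ^ card (insert a X)) = (\<Sum>X\<in>Pow B. - ((- 1) ^ card X) :: real)"
  proof (rule sum.cong)
    fix X assume "X \<in> Pow B"
    then have "finite X" "a \<notin> X" using fB A finite_subset by auto
    then show "(- 1) ^ card (insert a X) = (- ((- 1) ^ card X) :: real)" by simp
  qed simp
  then show ?thesis using False unfolding A(1) sum_Pow_insert[OF fB A(2)] by (simp add: sum_negf)
qed simp

context garside
begin

abbreviation "MB \<equiv> Mbar k n"

lemma topspace_Tbar [simp]: "topspace (Tbar k n) = MB"
  unfolding Tbar_def by (auto simp: Mbar_def)

lemma space_Bbar [simp]: "space (Bbar k n) = MB"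
  unfolding Bbar_def borel_of_top_def by (simp add: space_measure_of_conv)

definition cyl :: "(nat \<Rightarrow> elt) \<Rightarrow> nat \<Rightarrow> (nat \<Rightarrow> elt) set" where
  "cyl \<xi> j = {\<eta> \<in> MB. \<forall>i<j. \<eta> i = \<xi> i}"

lemma openin_cyl: assumes "\<xi> \<in> MB" shows "openin (Tbar k n) (cyl \<xi> j)"
proof -
  let ?S = "\<lambda>i. if i < j then {\<xi> i} else P"
  have "finite {i. ?S i \<noteq> P}" by (rule finite_subset[of _ "{..<j}"]) auto
  then have "openin (product_topology (\<lambda>_. discrete_topology P) UNIV) (PiE UNIV ?S)"
    using Mbar_P[OF assms] by (intro product_topology_basis) auto
  moreover have "cyl \<xi> j = PiE UNIV ?S \<inter> MB"
    using Mbar_P unfolding cyl_def by (auto simp: PiE_iff split: if_splits)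
  ultimately show ?thesis unfolding Tbar_def openin_subtopology by blast
qed

lemma cyl_base: assumes "openin (Tbar k n) T" "\<xi> \<in> T" shows "\<exists>j. cyl \<xi> j \<subseteq> T"
proof -
  obtain T' where T': "openin (product_topology (\<lambda>_. discrete_topology P) (UNIV :: nat set)) T'" "T = T' \<inter> MB"
    using assms(1) unfolding Tbar_def openin_subtopology by blast
  then obtain V where V: "finite {i. V i \<noteq> P}" "\<xi> \<in> PiE UNIV V" "PiE UNIV V \<subseteq> T'"
    using assms(2) unfolding openin_product_topology_alt by fastforce
  obtain j where j: "\<And>i. V i \<noteq> P \<Longrightarrow> i < j"
    using V(1) unfolding finite_nat_set_iff_bounded by auto
  have "cyl \<xi> j \<subseteq> T"
  proof
    fix \<eta> assume \<eta>: "\<eta> \<in> cyl \<xi> j"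
    have "\<eta> i \<in> V i" for i
      using \<eta> V(2) j[of i] Mbar_P[of \<eta> i] unfolding cyl_def by (cases "V i = P") (auto simp: PiE_iff)
    then have "\<eta> \<in> PiE UNIV V" by auto
    then show "\<eta> \<in> T" using V(3) T' \<eta> unfolding cyl_def by auto
  qed
  then show ?thesis by blast
qed

definition trunc :: "nat \<Rightarrow> (nat \<Rightarrow> elt) \<Rightarrow> nat \<Rightarrow> elt" where
  "trunc j \<xi> = (\<lambda>i. if i < j then \<xi> i else E)"

text \<open>Canonical finite index set for the cylinders of depth \<open>j\<close>.\<close>

definition NW :: "nat \<Rightarrow> (nat \<Rightarrow> elt) set" where "NW j = trunc j ` MB"

lemma trunc_MB: "\<xi> \<in> MB \<Longrightarrow> trunc j \<xi> \<in> MB"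
  unfolding trunc_def Mbar_def by auto

lemma NW_MB: "\<zeta> \<in> NW j \<Longrightarrow> \<zeta> \<in> MB"
  unfolding NW_def using trunc_MB by auto

lemma finite_NW [simp]: "finite (NW j)"
proof (rule finite_subset)
  show "NW j \<subseteq> (\<lambda>f i. if i < j then f i else E) ` (PiE {..<j} (\<lambda>_. P))"
  proof
    fix \<zeta> assume "\<zeta> \<in> NW j"
    then obtain \<xi> where \<xi>: "\<xi> \<in> MB" "\<zeta> = trunc j \<xi>" unfolding NW_def by blast
    have "\<zeta> = (\<lambda>i. if i < j then restrict \<xi> {..<j} i else E)"
      using \<xi> by (simp add: trunc_def fun_eq_iff)
    moreover have "restrict \<xi> {..<j} \<in> PiE {..<j} (\<lambda>_. P)" using Mbar_P \<xi> by auto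
    ultimately show "\<zeta> \<in> (\<lambda>f i. if i < j then f i else E) ` (PiE {..<j} (\<lambda>_. P))" by blast
  qed
qed (simp add: finite_PiE)

lemma cyl_trunc: "cyl (trunc j \<xi>) j = cyl \<xi> j"
  unfolding cyl_def trunc_def by auto

lemma mem_cyl: "\<xi> \<in> MB \<Longrightarrow> \<xi> \<in> cyl \<xi> j"
  unfolding cyl_def by simp

lemma disjoint_cyl: "disjoint_family_on (\<lambda>\<zeta>. cyl \<zeta> j) (NW j)"
  unfolding disjoint_family_on_def
proof (intro ballI impI)
  fix \<zeta> \<zeta>' assume h: "\<zeta> \<in> NW j" "\<zeta>' \<in> NW j" "\<zeta> \<noteq> \<zeta>'"
  then obtain i where i: "\<zeta> i \<noteq> \<zeta>' i" by (meson ext)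
  then have "i < j" using h unfolding NW_def trunc_def by (auto split: if_splits)
  then show "cyl \<zeta> j \<inter> cyl \<zeta>' j = {}" using i unfolding cyl_def by auto
qed

section \<open>Cylinders as a generator of the Borel sets\<close>

definition Cyls :: "(nat \<Rightarrow> elt) set set" where "Cyls = insert {} {cyl \<xi> j | \<xi> j. \<xi> \<in> MB}"

lemma countable_Cyls: "countable Cyls"
proof -
  have "Cyls \<subseteq> insert {} (\<Union>j. (\<lambda>\<zeta>. cyl \<zeta> j) ` NW j)"
  proof
    fix A assume "A \<in> Cyls"
    then consider "A = {}" | \<xi> j where "A = cyl \<xi> j" "\<xi> \<in> MB" unfolding Cyls_def by blast
    then show "A \<in> insert {} (\<Union>j. (\<lambda>\<zeta>. cyl \<zeta> j) ` NW j)"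
    proof cases
      case 2
      then have "A = cyl (trunc j \<xi>) j" "trunc j \<xi> \<in> NW j" by (auto simp: cyl_trunc NW_def)
      then show ?thesis by blast
    qed simp
  qed
  then show ?thesis by (rule countable_subset) (simp add: countable_finite)
qed

lemma Cyls_Pow: "Cyls \<subseteq> Pow MB" unfolding Cyls_def cyl_def by auto

text \<open>Cylinders form a countable base, so open sets are countable unions of them.\<close>

lemma sets_Bbar: "sets (Bbar k n) = sigma_sets MB Cyls"
proof -
  have "{U. openin (Tbar k n) U} \<subseteq> Pow MB" using openin_subset by fastforce
  then have "sets (Bbar k n) = sigma_sets MB {U. openin (Tbar k n) U}"
    unfolding Bbar_def borel_of_top_def by simp
  also have "\<dots> = sigma_sets MB Cyls"
  proof (rule sigma_sets_eqI)
    fix T assume "T \<in> {U. openin (Tbar k n) U}"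
    then have T: "openin (Tbar k n) T" by simp
    have "T = \<Union>{A \<in> Cyls. A \<subseteq> T}"
    proof
      show "T \<subseteq> \<Union>{A \<in> Cyls. A \<subseteq> T}"
      proof
        fix \<xi> assume \<xi>: "\<xi> \<in> T"
        then have mb: "\<xi> \<in> MB" using openin_subset[OF T] by auto
        obtain j where "cyl \<xi> j \<subseteq> T" using cyl_base[OF T \<xi>] by blast
        then show "\<xi> \<in> \<Union>{A \<in> Cyls. A \<subseteq> T}" using mem_cyl[OF mb] mb unfolding Cyls_def by blast
      qed
    qed auto
    moreover have "\<Union>{A \<in> Cyls. A \<subseteq> T} \<in> sigma_sets MB Cyls"
      using countable_Cyls by (intro sigma_sets_UNION) (auto intro: countable_subset[of _ Cyls])
    ultimately show "T \<in> sigma_sets MB Cyls" by simp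
  next
    fix A assume "A \<in> Cyls"
    then show "A \<in> sigma_sets MB {U. openin (Tbar k n) U}"
      unfolding Cyls_def using openin_cyl by auto
  qed
  finally show ?thesis .
qed

lemma cyl_sets [measurable]: "\<xi> \<in> MB \<Longrightarrow> cyl \<xi> j \<in> sets (Bbar k n)"
  unfolding sets_Bbar Cyls_def by auto

lemma Int_stable_Cyls: "Int_stable Cyls"
proof (rule Int_stableI)
  fix A B assume "A \<in> Cyls" "B \<in> Cyls"
  have *: "cyl \<xi> i \<inter> cyl \<eta> j \<in> Cyls" if h: "\<xi> \<in> MB" "\<eta> \<in> MB" "i \<le> j" for \<xi> \<eta> i j
  proof (cases "\<forall>l<i. \<xi> l = \<eta> l")
    case True
    then have "cyl \<xi> i \<inter> cyl \<eta> j = cyl \<eta> j" using h unfolding cyl_def by auto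
    then show ?thesis using h unfolding Cyls_def by auto
  next
    case False
    then obtain l where l: "l < i" "\<xi> l \<noteq> \<eta> l" by blast
    have "False" if "\<zeta> \<in> cyl \<xi> i" "\<zeta> \<in> cyl \<eta> j" for \<zeta>
      using that l h(3) order_less_le_trans[of l i j] unfolding cyl_def by simp
    then have "cyl \<xi> i \<inter> cyl \<eta> j = {}" by blast
    then show ?thesis unfolding Cyls_def by simp
  qed
  show "A \<inter> B \<in> Cyls"
  proof (cases "A = {} \<or> B = {}")
    case False
    then obtain \<xi> i \<eta> j where "A = cyl \<xi> i" "B = cyl \<eta> j" "\<xi> \<in> MB" "\<eta> \<in> MB"
      using \<open>A \<in> Cyls\<close> \<open>B \<in> Cyls\<close> unfolding Cyls_def by auto
    then show ?thesis using *[of \<xi> \<eta> i j] *[of \<eta> \<xi> j i] by (cases "i \<le> j") (auto simp: Int_commute)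
  qed (auto simp: Cyls_def)
qed

lemma prob_on_eqI:
  assumes \<nu>: "prob_on k n \<nu>" and \<nu>': "prob_on k n \<nu>'"
    and eq: "\<And>\<xi> j. \<xi> \<in> MB \<Longrightarrow> measure \<nu> (cyl \<xi> (Suc j)) = measure \<nu>' (cyl \<xi> (Suc j))"
  shows "\<nu> = \<nu>'"
proof -
  interpret \<nu>: prob_space \<nu> using \<nu> unfolding prob_on_def by blast
  interpret \<nu>': prob_space \<nu>' using \<nu>' unfolding prob_on_def by blast
  have s: "sets \<nu> = sets (Bbar k n)" "sets \<nu>' = sets (Bbar k n)" using \<nu> \<nu>' unfolding prob_on_def by auto
  then have sp: "space \<nu> = MB" "space \<nu>' = MB" using sets_eq_imp_space_eq space_Bbar by metis+
  have c0: "cyl \<xi> 0 = MB" for \<xi> unfolding cyl_def by simp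
  show ?thesis
  proof (rule measure_eqI_generator_eq[OF Int_stable_Cyls Cyls_Pow _ _ _ , where A = "\<lambda>_. MB"])
    fix A assume "A \<in> Cyls"
    then consider "A = {}" | \<xi> j where "A = cyl \<xi> j" "\<xi> \<in> MB" unfolding Cyls_def by blast
    then show "emeasure \<nu> A = emeasure \<nu>' A"
    proof cases
      case 2
      show ?thesis
      proof (cases j)
        case 0
        then show ?thesis using 2 c0 sp \<nu>.emeasure_space_1 \<nu>'.emeasure_space_1 by simp
      next
        case (Suc i)
        then show ?thesis
          using 2 eq[of \<xi> i] by (simp add: \<nu>.emeasure_eq_measure \<nu>'.emeasure_eq_measure)
      qed
    qed simp
  next
    have "(\<lambda>_. E) \<in> MB" by (simp add: Mbar_def)
    then have "cyl (\<lambda>_. E) 0 \<in> Cyls" unfolding Cyls_def by blast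
    then show "range (\<lambda>_. MB) \<subseteq> Cyls" using c0 by auto
  qed (auto simp: s sets_Bbar)
qed

section \<open>Cylinders and the sets \<open>Up\<close>\<close>

lemma Up_eq: assumes "x \<in> Hs j" shows "Up k n x = {\<eta> \<in> MB. x \<preceq> pr \<eta> j}"
proof -
  have xM: "x \<in> M" using assms Hs_M by blast
  show ?thesis
  proof (intro set_eqI iffI)
    fix \<xi> assume \<xi>: "\<xi> \<in> Up k n x"
    then have mb: "\<xi> \<in> MB" unfolding Up_def in_closure_of by simp
    obtain z where z: "z \<in> M" "nfs k n (x \<odot> z) \<in> cyl \<xi> j"
      using \<xi> openin_cyl[OF mb, of j] mem_cyl[OF mb, of j] unfolding Up_def in_closure_of by blast
    have xz: "x \<odot> z \<in> M" using xM z by simp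
    have "x \<preceq> pr (nfs k n (x \<odot> z)) (blen (x \<odot> z))" using pr_nfs[OF xz order_refl] z by auto
    then have "x \<preceq> pr (nfs k n (x \<odot> z)) j" using Hs_dvs_pr[OF nfs_Mbar[OF xz] assms] by blast
    also have "pr (nfs k n (x \<odot> z)) j = pr \<xi> j" using z(2) by (intro pr_cong) (simp add: cyl_def)
    finally show "\<xi> \<in> {\<eta> \<in> MB. x \<preceq> pr \<eta> j}" using mb by simp
  next
    fix \<xi> assume "\<xi> \<in> {\<eta> \<in> MB. x \<preceq> pr \<eta> j}"
    then have \<xi>: "\<xi> \<in> MB" "x \<preceq> pr \<xi> j" by auto
    have "\<exists>\<eta>. \<eta> \<in> {nfs k n (x \<odot> z) |z. z \<in> M} \<and> \<eta> \<in> T" if T: "\<xi> \<in> T" "openin (Tbar k n) T" for T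
    proof -
      obtain i where i: "cyl \<xi> i \<subseteq> T" using cyl_base T by blast
      have "x \<preceq> pr \<xi> (max i j)" using dvs_trans[OF xM \<xi>(2)] pr_dvs[of \<xi> j "max i j"] \<xi>(1) by simp
      then obtain z where z: "z \<in> M" "pr \<xi> (max i j) = x \<odot> z" by (rule dvsE)
      have "nfs k n (x \<odot> z) = trunc (max i j) \<xi>"
        using nfs_pr[OF \<xi>(1), of "max i j"] z unfolding trunc_def by simp
      moreover have "trunc (max i j) \<xi> \<in> cyl \<xi> i"
        using trunc_MB[OF \<xi>(1), of "max i j"] by (auto simp: cyl_def trunc_def less_max_iff_disj)
      ultimately have "nfs k n (x \<odot> z) \<in> T" using i by auto
      then show ?thesis using z(1) by blast
    qed
    then show "\<xi> \<in> Up k n x" using \<xi> unfolding Up_def in_closure_of by auto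
  qed
qed

text \<open>Turns the topological closure into a finite disjoint union, so that measurability and
  additivity become available.\<close>

lemma Up_cyl: assumes "x \<in> Hs j" shows "Up k n x = (\<Union>\<zeta>\<in>{\<zeta>\<in>NW j. x \<preceq> pr \<zeta> j}. cyl \<zeta> j)"
proof (intro set_eqI iffI)
  fix \<xi> assume \<xi>: "\<xi> \<in> Up k n x"
  have "pr (trunc j \<xi>) j = pr \<xi> j" by (rule pr_cong) (simp add: trunc_def)
  then have "trunc j \<xi> \<in> {\<zeta>\<in>NW j. x \<preceq> pr \<zeta> j}" "\<xi> \<in> cyl (trunc j \<xi>) j"
    using \<xi> mem_cyl unfolding Up_eq[OF assms] by (auto simp: NW_def cyl_trunc)
  then show "\<xi> \<in> (\<Union>\<zeta>\<in>{\<zeta>\<in>NW j. x \<preceq> pr \<zeta> j}. cyl \<zeta> j)" by blast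
next
  fix \<xi> assume "\<xi> \<in> (\<Union>\<zeta>\<in>{\<zeta>\<in>NW j. x \<preceq> pr \<zeta> j}. cyl \<zeta> j)"
  then obtain \<zeta> where \<zeta>: "\<zeta> \<in> NW j" "x \<preceq> pr \<zeta> j" "\<xi> \<in> cyl \<zeta> j" by blast
  have "pr \<xi> j = pr \<zeta> j" using \<zeta>(3) by (intro pr_cong) (simp add: cyl_def)
  then show "\<xi> \<in> Up k n x" using \<zeta> unfolding Up_eq[OF assms] cyl_def by simp
qed

lemma Up_sets [measurable]: "x \<in> M \<Longrightarrow> Up k n x \<in> sets (Bbar k n)"
  unfolding Up_cyl[OF Hs_blen] using NW_MB by (intro sets.finite_UN) auto

text \<open>Let \<open>x\<close> be the product of the first \<open>j + 1\<close> factors of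
  \<open>\<xi>\<close>. If that of \<open>\<eta>\<close> is a proper multiple of \<open>x\<close>,
  it is a multiple of some \<open>x \<odot> g s\<close>, and by \<open>pr_mult_gen_dvs\<close> such
  an \<open>s\<close> extends the last factor inside \<open>P\<close>. So only these atoms have to
  be excluded.\<close>

lemma cyl_Up:
  assumes \<xi>: "\<xi> \<in> MB"
  shows "cyl \<xi> (Suc j) = Up k n (pr \<xi> (Suc j)) - (\<Union>s\<in>\<Sigma> - Rset k n (\<xi> j). Up k n (pr \<xi> (Suc j) \<odot> g s))"
proof -
  let ?x = "pr \<xi> (Suc j)"
  have xM: "?x \<in> M" using \<xi> by simp
  have xH: "?x \<in> Hs (Suc j)" using pr_Hs Mbar_P[OF \<xi>] by blast
  \<comment> \<open>The atom merges with the last factor, so the number of simple factors stays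
    \<open>j + 1\<close> and \<open>Up_eq\<close> applies at the same depth.\<close>
  have H: "?x \<odot> g s \<in> Hs (Suc j)" if s: "s \<in> \<Sigma> - Rset k n (\<xi> j)" for s
  proof -
    have sP: "\<xi> j \<odot> g s \<in> P" "s \<in> \<Sigma>" using s unfolding Rset_def by auto
    let ?\<zeta> = "\<xi>(j := \<xi> j \<odot> g s)"
    have \<zeta>P: "?\<zeta> i \<in> P" for i using sP Mbar_P[OF \<xi>] by simp
    have "pr ?\<zeta> (Suc j) = pr ?\<zeta> j \<odot> (\<xi> j \<odot> g s)" using pr_Suc[of ?\<zeta> j] P_M[OF \<zeta>P] by simp
    also have "pr ?\<zeta> j = pr \<xi> j" by (rule pr_cong) simp
    also have "pr \<xi> j \<odot> (\<xi> j \<odot> g s) = ?x \<odot> g s" using \<xi> sP by (simp add: pr_Suc mult_assoc)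
    finally show ?thesis using pr_Hs[of ?\<zeta> "Suc j"] \<zeta>P by metis
  qed
  have eq: "\<eta> \<in> cyl \<xi> (Suc j) \<longleftrightarrow> pr \<eta> (Suc j) = ?x" if "\<eta> \<in> MB" for \<eta>
  proof
    assume "\<eta> \<in> cyl \<xi> (Suc j)"
    then show "pr \<eta> (Suc j) = ?x" by (intro pr_cong) (simp add: cyl_def)
  next
    assume "pr \<eta> (Suc j) = ?x"
    then show "\<eta> \<in> cyl \<xi> (Suc j)" unfolding cyl_def using that pr_inj[OF that \<xi>] by blast
  qed
  have key: "\<eta> \<in> cyl \<xi> (Suc j) \<longleftrightarrow> ?x \<preceq> pr \<eta> (Suc j) \<and> (\<forall>s\<in>\<Sigma> - Rset k n (\<xi> j). \<not> ?x \<odot> g s \<preceq> pr \<eta> (Suc j))"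
    if \<eta>: "\<eta> \<in> MB" for \<eta>
  proof
    assume "\<eta> \<in> cyl \<xi> (Suc j)"
    then have e: "pr \<eta> (Suc j) = ?x" using eq \<eta> by blast
    have "\<not> ?x \<odot> g s \<preceq> ?x" if "s \<in> \<Sigma>" for s
      using dvs_blen[of "?x \<odot> g s" ?x] xM that by auto
    then show "?x \<preceq> pr \<eta> (Suc j) \<and> (\<forall>s\<in>\<Sigma> - Rset k n (\<xi> j). \<not> ?x \<odot> g s \<preceq> pr \<eta> (Suc j))"
      unfolding e using xM by simp
  next
    assume h: "?x \<preceq> pr \<eta> (Suc j) \<and> (\<forall>s\<in>\<Sigma> - Rset k n (\<xi> j). \<not> ?x \<odot> g s \<preceq> pr \<eta> (Suc j))"
    then obtain y where y: "y \<in> M" "pr \<eta> (Suc j) = ?x \<odot> y" by (auto elim: dvsE)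
    have "y = E"
    proof (rule ccontr)
      assume "y \<noteq> E"
      then obtain s y' where s: "s \<in> \<Sigma>" "y' \<in> M" "y = g s \<odot> y'" using M_decomp y(1) by metis
      then have d: "?x \<odot> g s \<preceq> pr \<eta> (Suc j)" using y xM by (auto simp flip: mult_assoc)
      then have "\<xi> j \<odot> g s \<in> P" using pr_mult_gen_dvs[OF \<xi> \<eta> s(1)] by blast
      then show False using h d s unfolding Rset_def by blast
    qed
    then show "\<eta> \<in> cyl \<xi> (Suc j)" using eq[OF \<eta>] y xM by simp
  qed
  have sub: "cyl \<xi> (Suc j) \<subseteq> MB" unfolding cyl_def by blast
  have un: "(\<Union>s\<in>\<Sigma> - Rset k n (\<xi> j). Up k n (?x \<odot> g s)) =
      (\<Union>s\<in>\<Sigma> - Rset k n (\<xi> j). {\<eta> \<in> MB. ?x \<odot> g s \<preceq> pr \<eta> (Suc j)})"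
    by (rule SUP_cong[OF refl Up_eq[OF H]])
  have "\<eta> \<in> cyl \<xi> (Suc j) \<longleftrightarrow> \<eta> \<in> {\<eta> \<in> MB. ?x \<preceq> pr \<eta> (Suc j)} -
      (\<Union>s\<in>\<Sigma> - Rset k n (\<xi> j). {\<eta> \<in> MB. ?x \<odot> g s \<preceq> pr \<eta> (Suc j)})" for \<eta>
    using key[of \<eta>] sub by (cases "\<eta> \<in> MB") auto
  then show ?thesis unfolding Up_eq[OF xH] un by (rule set_eqI)
qed

lemma Up_mult_DeltaX:
  assumes x: "x \<in> M" and X: "X \<subseteq> \<Sigma>"
  shows "Up k n (x \<odot> DeltaX k n X) = Up k n x \<inter> (\<Inter>s\<in>X. Up k n (x \<odot> g s))"
proof -
  \<comment> \<open>A depth large enough for all the elements in question to be products of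
    \<open>N\<close> simple ones.\<close>
  define N where "N = blen x + blen (DeltaX k n X) + 1"
  have dM: "DeltaX k n X \<in> M" using DeltaX_M X by blast
  have H: "y \<in> Hs N" if "y \<in> M" "blen y \<le> N" for y using Hs_blen Hs_mono that by blast
  have "Up k n (x \<odot> DeltaX k n X) = {\<eta> \<in> MB. x \<odot> DeltaX k n X \<preceq> pr \<eta> N}"
    by (rule Up_eq[OF H]) (use x dM in \<open>auto simp: N_def\<close>)
  moreover have "Up k n x = {\<eta> \<in> MB. x \<preceq> pr \<eta> N}"
    by (rule Up_eq[OF H]) (use x in \<open>auto simp: N_def\<close>)
  moreover have "Up k n (x \<odot> g s) = {\<eta> \<in> MB. x \<odot> g s \<preceq> pr \<eta> N}" if "s \<in> X" for s
    by (rule Up_eq[OF H]) (use x X that in \<open>auto simp: N_def\<close>)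
  moreover have "x \<odot> DeltaX k n X \<preceq> m \<longleftrightarrow> x \<preceq> m \<and> (\<forall>s\<in>X. x \<odot> g s \<preceq> m)" if m: "m \<in> M" for m
  proof (cases "x \<preceq> m")
    case True
    then obtain y where y: "y \<in> M" "m = x \<odot> y" by (rule dvsE)
    have "g s \<in> M" if "s \<in> X" for s using X that by auto
    then show ?thesis using True dvs_cancel_iff[OF x _ y(1)] DeltaX_dvs[OF X y(1)] dM y(2) by auto
  next
    case False
    then show ?thesis using dvs_trans[OF x dvsI[OF dM]] by blast
  qed
  ultimately show ?thesis by auto
qed

section \<open>Cylinder weights and uniqueness\<close>

text \<open>The set \<open>B\<close> of atoms already imposed is generalised: excluding one more
  atom \<open>a\<close> is the difference of the instances for \<open>B\<close> and for
  \<open>insert a B\<close>.\<close>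

lemma measure_inclusion_exclusion:
  assumes \<nu>: "prob_on k n \<nu>" and x: "x \<in> M" and "A \<subseteq> \<Sigma>" "B \<subseteq> \<Sigma>" "A \<inter> B = {}"
  shows "measure \<nu> (Up k n (x \<odot> DeltaX k n B) - (\<Union>s\<in>A. Up k n (x \<odot> g s))) =
    (\<Sum>X\<in>Pow A. (- 1) ^ card X * measure \<nu> (Up k n (x \<odot> DeltaX k n (B \<union> X))))"
proof -
  interpret \<nu>: prob_space \<nu> using \<nu> unfolding prob_on_def by blast
  have s: "sets \<nu> = sets (Bbar k n)" using \<nu> unfolding prob_on_def by auto
  have "finite A" using assms(3) finite_subset finite_gens by blast
  then show ?thesis using assms(3-5)
  proof (induction A arbitrary: B rule: finite_induct)
    case empty
    then show ?case by simp
  next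
    case (insert a A)
    let ?U = "\<lambda>B. Up k n (x \<odot> DeltaX k n B)" and ?V = "\<Union>s\<in>A. Up k n (x \<odot> g s)"
    have a: "a \<in> \<Sigma>" "insert a B \<subseteq> \<Sigma>" "A \<inter> insert a B = {}" "A \<subseteq> \<Sigma>" using insert by auto
    have US: "?U B \<in> sets \<nu>" if "B \<subseteq> \<Sigma>" for B using that x DeltaX_M unfolding s by simp
    have VS: "?V \<in> sets \<nu>" unfolding s
    proof (rule sets.finite_UN)
      fix t assume "t \<in> A"
      then have "t \<in> \<Sigma>" using a by blast
      then show "Up k n (x \<odot> g t) \<in> sets (Bbar k n)" using x by simp
    qed (use insert in simp)
    have sub: "?U (insert a B) = ?U B \<inter> Up k n (x \<odot> g a)"
      using Up_mult_DeltaX[OF x] insert.prems a by auto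
    have "?U B - (\<Union>s\<in>insert a A. Up k n (x \<odot> g s)) = (?U B - ?V) - (?U (insert a B) - ?V)"
      unfolding sub by auto
    moreover have "?U (insert a B) - ?V \<subseteq> ?U B - ?V" unfolding sub by auto
    ultimately have "measure \<nu> (?U B - (\<Union>s\<in>insert a A. Up k n (x \<odot> g s))) =
        measure \<nu> (?U B - ?V) - measure \<nu> (?U (insert a B) - ?V)"
      using \<nu>.finite_measure_Diff[of "?U B - ?V" "?U (insert a B) - ?V"] US VS insert.prems a by auto
    also have "measure \<nu> (?U B - ?V) = (\<Sum>X\<in>Pow A. (- 1) ^ card X * measure \<nu> (?U (B \<union> X)))"
      using insert.IH insert.prems by auto
    also have "measure \<nu> (?U (insert a B) - ?V) = (\<Sum>X\<in>Pow A. (- 1) ^ card X * measure \<nu> (?U (insert a B \<union> X)))"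
      using insert.IH[OF a(4) a(2) a(3)] .
    also have "\<dots> = - (\<Sum>X\<in>Pow A. (- 1) ^ card (insert a X) * measure \<nu> (?U (B \<union> insert a X)))"
      unfolding sum_negf[symmetric]
    proof (rule sum.cong)
      fix X assume "X \<in> Pow A"
      then have "finite X" "a \<notin> X" using insert finite_subset by auto
      then show "(- 1) ^ card X * measure \<nu> (?U (insert a B \<union> X)) =
          - ((- 1) ^ card (insert a X) * measure \<nu> (?U (B \<union> insert a X)))" by simp
    qed simp
    finally show ?case unfolding sum_Pow_insert[OF insert.hyps(1,2)] by simp
  qed
qed

text \<open>A truncated Moebius polynomial: only atoms that still fit behind the last simple factor
  \<open>x\<close> enter. At \<open>x = E\<close> all of them do.\<close>

definition gp :: "real \<Rightarrow> elt \<Rightarrow> real" where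
  "gp p x = (\<Sum>X\<in>Pow (\<Sigma> - Rset k n x). (- 1) ^ card X * p ^ blen (DeltaX k n X))"

lemma gp_E: "gp p E = Hn k n p" unfolding gp_def Hn_def by simp

lemma DeltaX_empty: "DeltaX k n {} = E"
  using DeltaX_dvs[of "{}" E] DeltaX_M[of "{}"] dvs_blen[of "DeltaX k n {}" E] by simp

lemma gp_\<Delta>: "gp p \<Delta> = 1" unfolding gp_def Rset_\<Delta> by (simp add: DeltaX_empty)

lemma uniform_cyl:
  assumes u: "uniform k n p \<nu>" and \<xi>: "\<xi> \<in> MB"
  shows "measure \<nu> (cyl \<xi> (Suc j)) = p ^ blen (pr \<xi> (Suc j)) * gp p (\<xi> j)"
proof -
  have \<nu>: "prob_on k n \<nu>" and U: "\<And>x. x \<in> M \<Longrightarrow> measure \<nu> (Up k n x) = p ^ blen x"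
    using u unfolding uniform_def by auto
  let ?A = "\<Sigma> - Rset k n (\<xi> j)" and ?x = "pr \<xi> (Suc j)"
  have xM: "?x \<in> M" using \<xi> by simp
  have "measure \<nu> (cyl \<xi> (Suc j)) = (\<Sum>X\<in>Pow ?A. (- 1) ^ card X * measure \<nu> (Up k n (?x \<odot> DeltaX k n ({} \<union> X))))"
    unfolding cyl_Up[OF \<xi>] using measure_inclusion_exclusion[OF \<nu> xM, of ?A "{}"] xM by (simp add: DeltaX_empty)
  also have "\<dots> = (\<Sum>X\<in>Pow ?A. p ^ blen ?x * ((- 1) ^ card X * p ^ blen (DeltaX k n X)))"
  proof (rule sum.cong)
    fix X assume "X \<in> Pow ?A"
    then have "DeltaX k n X \<in> M" using DeltaX_M by auto
    then show "(- 1) ^ card X * measure \<nu> (Up k n (?x \<odot> DeltaX k n ({} \<union> X))) =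
        p ^ blen ?x * ((- 1) ^ card X * p ^ blen (DeltaX k n X))"
      using U[of "?x \<odot> DeltaX k n X"] xM by (simp add: power_add)
  qed simp
  finally show ?thesis unfolding gp_def sum_distrib_left .
qed

lemma uniform_unique: "uniform k n p \<nu> \<Longrightarrow> uniform k n p \<nu>' \<Longrightarrow> \<nu> = \<nu>'"
  by (rule prob_on_eqI) (auto simp: uniform_cyl, auto simp: uniform_def)

text \<open>There are at most \<open>blen x\<close> nontrivial factors, so at depth
  \<open>blen x + 1\<close> the last recorded entry is \<open>E\<close>, and arrows allow only
  \<open>E\<close> after it.\<close>

lemma singleton_cyl: assumes "x \<in> M" shows "{nfs k n x} = cyl (nfs k n x) (Suc (blen x))"
proof (intro set_eqI iffI)
  fix \<eta> assume "\<eta> \<in> cyl (nfs k n x) (Suc (blen x))"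
  then have \<eta>: "\<eta> \<in> MB" "\<And>i. i \<le> blen x \<Longrightarrow> \<eta> i = nfs k n x i" unfolding cyl_def by auto
  then have "\<eta> (blen x) = E" using nfs_tail[OF assms] by simp
  then have "\<eta> i = nfs k n x i" for i
    using \<eta> Mbar_E[of \<eta> "blen x" i] nfs_tail[OF assms, of i] by (cases "i \<le> blen x") auto
  then show "\<eta> \<in> {nfs k n x}" by auto
qed (use assms mem_cyl in simp)

lemma singleton_sets: "x \<in> M \<Longrightarrow> {nfs k n x} \<in> sets (Bbar k n)"
  using singleton_cyl cyl_sets nfs_Mbar by metis

lemma uniform_singleton:
  assumes "uniform k n p \<nu>" "x \<in> M"
  shows "measure \<nu> {nfs k n x} = Hn k n p * p ^ blen x"
  unfolding singleton_cyl[OF assms(2)]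
  using uniform_cyl[OF assms(1) nfs_Mbar[OF assms(2)], of "blen x"] pr_nfs[OF assms(2)] nfs_tail[OF assms(2)]
  by (simp add: gp_E)

lemma Mimg_sets: "Mimg k n \<in> sets (Bbar k n)"
proof -
  have "Mimg k n = (\<Union>x\<in>M. {nfs k n x})" unfolding Mimg_def by auto
  then show ?thesis using singleton_sets countable_M by (simp add: sets.countable_UN'')
qed

lemma measure_Up_cyl:
  assumes \<nu>: "prob_on k n \<nu>" and x: "x \<in> Hs j"
  shows "measure \<nu> (Up k n x) = (\<Sum>\<zeta>\<in>{\<zeta>\<in>NW j. x \<preceq> pr \<zeta> j}. measure \<nu> (cyl \<zeta> j))"
proof -
  interpret \<nu>: prob_space \<nu> using \<nu> unfolding prob_on_def by blast
  have s: "sets \<nu> = sets (Bbar k n)" using \<nu> unfolding prob_on_def by auto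
  show ?thesis unfolding Up_cyl[OF x]
    by (rule \<nu>.finite_measure_finite_Union)
      (use disjoint_cyl[of j] NW_MB in \<open>auto simp: s disjoint_family_on_def\<close>)
qed

end

section \<open>Generating series\<close>

locale nontrivial_garside = garside +
  assumes gens_ne: "\<Sigma> \<noteq> {}"
begin

abbreviation "Ml m \<equiv> {x \<in> M. blen x = m}"
abbreviation "a m \<equiv> card (Ml m)"
abbreviation "q \<equiv> qn k n"

lemma Ml_M: "{x \<in> Ml m. x \<in> M} = Ml m" by auto

lemma a_0: "a 0 = 1"
proof -
  have "Ml 0 = {E}" by auto
  then show ?thesis by simp
qed

lemma a_pos: "a m \<ge> 1"
proof -
  obtain s where s: "s \<in> \<Sigma>" using gens_ne by blast
  have "replicate m s \<in> lists \<Sigma>" using s by auto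
  then have "W (replicate m s) \<in> Ml m" by simp
  then have "0 < a m" using finite_M_blen[of m] card_gt_0_iff by blast
  then show ?thesis by simp
qed

lemma a_mult: "a (m + l) \<le> a m * a l"
proof -
  have "Ml (m + l) \<subseteq> (\<lambda>(x, y). x \<odot> y) ` (Ml m \<times> Ml l)"
  proof
    fix x assume x: "x \<in> Ml (m + l)"
    then obtain w where w: "w \<in> lists \<Sigma>" "x = W w" by (auto elim: in_M_cases)
    then have len: "length w = m + l" using x by simp
    have "x = W (take m w) \<odot> W (drop m w)" using w by (simp add: W_append)
    moreover have "W (take m w) \<in> Ml m" "W (drop m w) \<in> Ml l"
      using w(1) len by (auto simp: in_lists_conv_set dest: in_set_takeD in_set_dropD)
    ultimately show "x \<in> (\<lambda>(x, y). x \<odot> y) ` (Ml m \<times> Ml l)" by force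
  qed
  then have "a (m + l) \<le> card (Ml m \<times> Ml l)"
    using finite_M_blen by (intro surj_card_le) auto
  then show ?thesis by (simp add: card_cartesian_product)
qed

lemma a_mult_pow: "a (j * m + i) \<le> a m ^ j * a i"
proof (induction j)
  case (Suc j)
  have "a (Suc j * m + i) \<le> a m * a (j * m + i)" using a_mult[of m "j * m + i"] by (simp add: add.assoc)
  also have "\<dots> \<le> a m * (a m ^ j * a i)" using Suc by (rule mult_le_mono2)
  finally show ?case by (simp add: mult.assoc)
qed simp

text \<open>Submultiplicativity propagates a bound at one exponent \<open>m\<close> to all
  exponents: after division by \<open>m\<close> only the remainder contributes, and \<open>C\<close>
  sums over the possible remainders.\<close>

lemma conv_radius_ge:
  assumes "0 < r" "m > 0" "real (a m) * r ^ m \<le> 1"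
  shows "conv_radius (\<lambda>m. real (a m)) \<ge> ereal r"
proof (rule conv_radius_geI_ex')
  fix r' :: real assume r': "0 < r'" "ereal r' < ereal r"
  define C where "C = (\<Sum>i<m. real (a i) * r ^ i)"
  have b: "real (a i) * r ^ i \<le> C" for i
  proof -
    have i: "i = (i div m) * m + i mod m" by simp
    have "real (a i) * r ^ i \<le> real (a m ^ (i div m) * a (i mod m)) * r ^ i"
      using a_mult_pow[of "i div m" m "i mod m"] assms(1) by (intro mult_right_mono) (auto simp flip: of_nat_mult of_nat_power)
    also have "\<dots> = (real (a m) * r ^ m) ^ (i div m) * (real (a (i mod m)) * r ^ (i mod m))"
    proof -
      have "r ^ i = r ^ (i div m * m + i mod m)" by simp
      also have "\<dots> = (r ^ m) ^ (i div m) * r ^ (i mod m)"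
        by (simp only: power_add power_mult mult.commute[of "i div m" m])
      finally show ?thesis by (simp add: power_mult_distrib)
    qed
    also have "\<dots> \<le> 1 * (real (a (i mod m)) * r ^ (i mod m))"
      using assms by (intro mult_right_mono power_le_one) auto
    also have "\<dots> \<le> C" unfolding C_def
      using assms member_le_sum[of "i mod m" "{..<m}" "\<lambda>i. real (a i) * r ^ i"] by auto
    finally show ?thesis .
  qed
  show "summable (\<lambda>i. real (a i) * of_real r' ^ i)"
  proof (rule summable_comparison_test)
    show "summable (\<lambda>i. C * (r' / r) ^ i)" using r' assms by (intro summable_mult summable_geometric) auto
    have "real (a i) * r' ^ i \<le> C * (r' / r) ^ i" for i
    proof -
      have "real (a i) * r' ^ i = (real (a i) * r ^ i) * (r' / r) ^ i" using assms(1) by (simp add: power_divide)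
      also have "\<dots> \<le> C * (r' / r) ^ i" using b r' assms by (intro mult_right_mono) auto
      finally show ?thesis .
    qed
    then show "\<exists>N. \<forall>i\<ge>N. norm (real (a i) * of_real r' ^ i) \<le> C * (r' / r) ^ i" using r' by auto
  qed
qed

lemma conv_radius_eq: "conv_radius (\<lambda>m. real (a m)) = ereal q" and q_pos: "0 < q"
proof -
  let ?R = "conv_radius (\<lambda>m. real (a m))"
  have "?R \<ge> ereal (1 / real (a 1))" using a_pos[of 1] by (intro conv_radius_ge[of _ 1]) auto
  moreover have "(0::ereal) < ereal (1 / real (a 1))" using a_pos[of 1] by simp
  ultimately have pos: "0 < ?R" by order
  \<comment> \<open>Powers of one atom provide an element of every length, so the series diverges at
    \<open>1\<close>. The radius is thus finite, and \<open>qn\<close> is not the default value of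
    \<open>real_of_ereal\<close> at infinity.\<close>
  have le: "?R \<le> 1"
  proof (rule ccontr)
    assume "\<not> ?R \<le> 1"
    then have "summable (\<lambda>m. real (a m) * 1 ^ m)" 
      by (intro summable_in_conv_radius) (simp add: not_le one_ereal_def)
    then have "(\<lambda>m. real (a m)) \<longlonglongrightarrow> 0" using summable_LIMSEQ_zero by fastforce
    then have "eventually (\<lambda>m. real (a m) < 1) sequentially" by (rule order_tendstoD) simp
    then obtain m where "real (a m) < 1" by (auto simp: eventually_sequentially)
    then show False using a_pos[of m] by simp
  qed
  then show eq: "?R = ereal q" unfolding qn_def using pos by (cases ?R) auto
  then show "0 < q" using pos by auto
qed

text \<open>\<open>real (a m) * r ^ m < 1\<close> is an open condition on \<open>r\<close>; if it
  held at \<open>q\<close> it would hold slightly to the right, and \<open>conv_radius_ge\<close>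
  would enlarge the radius.\<close>

lemma a_q_ge: assumes "p \<ge> q" shows "real (a m) * p ^ m \<ge> 1"
proof (cases "m = 0")
  case False
  have "real (a m) * q ^ m \<ge> 1"
  proof (rule ccontr)
    assume "\<not> real (a m) * q ^ m \<ge> 1"
    then have lt: "real (a m) * q ^ m < 1" by simp
    have "((\<lambda>r. real (a m) * r ^ m) \<longlongrightarrow> real (a m) * q ^ m) (at_right q)" by (intro tendsto_intros)
    then have "eventually (\<lambda>r. real (a m) * r ^ m < 1) (at_right q)" using lt by (rule order_tendstoD)
    moreover have "eventually (\<lambda>r. r > q) (at_right q)" by (simp add: eventually_at_right_less)
    ultimately have "eventually (\<lambda>r. real (a m) * r ^ m < 1 \<and> r > q) (at_right q)" by eventually_elim auto
    then obtain r where "real (a m) * r ^ m < 1" "r > q"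
      using eventually_happens[of _ "at_right q"] by (auto simp: trivial_limit_at_right_real)
    then have "ereal q \<ge> ereal r" using conv_radius_ge[of r m] False q_pos conv_radius_eq by simp
    then show False using \<open>r > q\<close> by simp
  qed
  also have "real (a m) * q ^ m \<le> real (a m) * p ^ m" using assms q_pos by (intro mult_left_mono power_mono) auto
  finally show ?thesis .
qed (simp add: a_0)

section \<open>The growth series and its inverse\<close>

definition Gn :: "real \<Rightarrow> real" where "Gn p = (\<Sum>m. real (a m) * p ^ m)"

lemma sums_Gn: assumes "0 \<le> p" "p < q" shows "(\<lambda>m. real (a m) * p ^ m) sums Gn p"
  unfolding Gn_def using assms conv_radius_eq by (intro summable_sums summable_in_conv_radius) auto

lemma card_multiples:
  assumes "d \<in> M"
  shows "card {x \<in> Ml m. d \<preceq> x} = (if blen d \<le> m then a (m - blen d) else 0)"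
proof (cases "blen d \<le> m")
  case True
  have "{x \<in> Ml m. d \<preceq> x} = (\<lambda>y. d \<odot> y) ` Ml (m - blen d)"
  proof (intro set_eqI iffI)
    fix x assume x: "x \<in> {x \<in> Ml m. d \<preceq> x}"
    then obtain y where y: "y \<in> M" "x = d \<odot> y" by (auto elim: dvsE)
    then have "y \<in> Ml (m - blen d)" using x assms by auto
    then show "x \<in> (\<lambda>y. d \<odot> y) ` Ml (m - blen d)" using y by blast
  next
    fix x assume "x \<in> (\<lambda>y. d \<odot> y) ` Ml (m - blen d)"
    then show "x \<in> {x \<in> Ml m. d \<preceq> x}" using True assms by auto
  qed
  moreover have "inj_on (\<lambda>y. d \<odot> y) (Ml (m - blen d))"
    by (rule inj_onI) (use left_cancel[OF assms] in blast)
  ultimately show ?thesis using True by (simp add: card_image)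
next
  case False
  then have e: "{x \<in> Ml m. d \<preceq> x} = {}" using dvs_blen[OF assms] by auto
  show ?thesis using False unfolding e by simp
qed

lemma sums_multiples:
  assumes "0 \<le> p" "p < q" "d \<in> M"
  shows "(\<lambda>m. real (card {x \<in> Ml m. d \<preceq> x}) * p ^ m) sums (p ^ blen d * Gn p)"
proof -
  have "(\<lambda>m. p ^ blen d * (real (a m) * p ^ m)) sums (p ^ blen d * Gn p)"
    using sums_Gn[OF assms(1,2)] by (rule sums_mult)
  then have "(\<lambda>m. real (card {x \<in> Ml (m + blen d). d \<preceq> x}) * p ^ (m + blen d)) sums (p ^ blen d * Gn p)"
    unfolding card_multiples[OF assms(3)] by (simp add: power_add mult_ac)
  then show ?thesis
    using sums_iff_shift[of "\<lambda>m. real (card {x \<in> Ml m. d \<preceq> x}) * p ^ m" "blen d" "p ^ blen d * Gn p"]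
    unfolding card_multiples[OF assms(3)] by simp
qed

text \<open>Exchanging sums, each \<open>x\<close> receives the sign \<open>(-1) ^ card X\<close>
  once for every \<open>X\<close> inside \<open>Lset k n x\<close>. These signs cancel unless
  \<open>x = E\<close>, so only the coefficient of degree \<open>0\<close> survives.\<close>

lemma Hn_Gn: assumes "0 \<le> p" "p < q" shows "Hn k n p * Gn p = 1"
proof -
  have "(\<lambda>m. \<Sum>X\<in>Pow \<Sigma>. (- 1) ^ card X * (real (card {x \<in> Ml m. DeltaX k n X \<preceq> x}) * p ^ m)) sums
      (\<Sum>X\<in>Pow \<Sigma>. (- 1) ^ card X * (p ^ blen (DeltaX k n X) * Gn p))"
    using sums_multiples[OF assms DeltaX_M] by (intro sums_sum sums_mult) auto
  moreover have "(\<Sum>X\<in>Pow \<Sigma>. (- 1) ^ card X * (real (card {x \<in> Ml m. DeltaX k n X \<preceq> x}) * p ^ m)) =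
      (if m = 0 then 1 else 0)" for m
  proof -
    have "(\<Sum>X\<in>Pow \<Sigma>. (- 1) ^ card X * (real (card {x \<in> Ml m. DeltaX k n X \<preceq> x}) * p ^ m)) =
        p ^ m * (\<Sum>X\<in>Pow \<Sigma>. \<Sum>x\<in>Ml m. if X \<subseteq> Lset k n x then (- 1) ^ card X else 0)"
      unfolding sum_distrib_left
    proof (rule sum.cong[OF refl])
      fix X assume X: "X \<in> Pow \<Sigma>"
      have L: "DeltaX k n X \<preceq> x \<longleftrightarrow> X \<subseteq> Lset k n x" if "x \<in> Ml m" for x
        using DeltaX_dvs[of X x] X that unfolding Lset_def by auto
      have "(\<Sum>x\<in>Ml m. if X \<subseteq> Lset k n x then (- 1) ^ card X else (0::real)) =
          (\<Sum>x\<in>{x \<in> Ml m. DeltaX k n X \<preceq> x}. (- 1) ^ card X)"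
        using L finite_M_blen[of m] by (intro sum.mono_neutral_cong_right) auto
      then show "(- 1) ^ card X * (real (card {x \<in> Ml m. DeltaX k n X \<preceq> x}) * p ^ m) =
          (\<Sum>x\<in>Ml m. p ^ m * (if X \<subseteq> Lset k n x then (- 1) ^ card X else 0))"
        by (simp flip: sum_distrib_left)
    qed
    also have "(\<Sum>X\<in>Pow \<Sigma>. \<Sum>x\<in>Ml m. if X \<subseteq> Lset k n x then (- 1) ^ card X else (0::real)) =
        (\<Sum>x\<in>Ml m. \<Sum>X\<in>Pow \<Sigma>. if X \<subseteq> Lset k n x then (- 1) ^ card X else 0)" by (rule sum.swap)
    also have "\<dots> = (\<Sum>x\<in>Ml m. if x = E then 1 else 0)"
    proof (rule sum.cong[OF refl])
      fix x assume x: "x \<in> Ml m"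
      have LS: "Lset k n x \<subseteq> \<Sigma>" unfolding Lset_def by blast
      have "(\<Sum>X\<in>Pow \<Sigma>. if X \<subseteq> Lset k n x then (- 1) ^ card X else (0::real)) =
          (\<Sum>X\<in>Pow (Lset k n x). (- 1) ^ card X)"
        using LS by (intro sum.mono_neutral_cong_right) auto
      also have "\<dots> = (if x = E then 1 else 0)"
      proof -
        have "Lset k n x = {} \<longleftrightarrow> x = E" using Lset_empty[of x] Lset_E x by blast
        then show ?thesis using alternating_sum_Pow[OF finite_subset[OF LS finite_gens]] by simp
      qed
      finally show "(\<Sum>X\<in>Pow \<Sigma>. if X \<subseteq> Lset k n x then (- 1) ^ card X else (0::real)) = (if x = E then 1 else 0)" .
    qed
    also have "\<dots> = (if m = 0 then 1 else 0)"
      using finite_M_blen[of m] by (auto simp: sum.delta)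
    finally show ?thesis by auto
  qed
  ultimately have "(\<lambda>m. if m = 0 then 1 else 0 :: real) sums (\<Sum>X\<in>Pow \<Sigma>. (- 1) ^ card X * (p ^ blen (DeltaX k n X) * Gn p))"
    by simp
  moreover have "(\<lambda>m. if m = 0 then 1 else 0 :: real) sums 1" using sums_single[of 0 "\<lambda>_. 1 :: real"] by simp
  ultimately have "(\<Sum>X\<in>Pow \<Sigma>. (- 1) ^ card X * (p ^ blen (DeltaX k n X) * Gn p)) = 1" using sums_unique2 by blast
  then show ?thesis unfolding Hn_def sum_distrib_right by (simp add: mult.assoc)
qed

lemma Gn_ge_1: assumes "0 \<le> p" "p < q" shows "Gn p \<ge> 1"
proof -
  have "(\<Sum>m\<in>{0}. real (a m) * p ^ m) \<le> Gn p"
    unfolding Gn_def using sums_summable[OF sums_Gn[OF assms]] assms by (intro sum_le_suminf) auto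
  then show ?thesis by (simp add: a_0)
qed

lemma Hn_pos: assumes "0 \<le> p" "p < q" shows "Hn k n p > 0"
  using Hn_Gn[OF assms] Gn_ge_1[OF assms] by (metis less_le_trans zero_less_mult_pos2 zero_less_one)

section \<open>Measures carried by the monoid\<close>

lemma sums_measure_nfs:
  assumes \<nu>: "prob_on k n \<nu>" and H: "\<And>x. x \<in> M \<Longrightarrow> measure \<nu> {nfs k n x} = h * p ^ blen x" and "A \<subseteq> M"
  shows "(\<lambda>m. h * (real (card {x \<in> Ml m. x \<in> A}) * p ^ m)) sums measure \<nu> (nfs k n ` A)"
proof -
  interpret \<nu>: prob_space \<nu> using \<nu> unfolding prob_on_def by blast
  have s: "sets \<nu> = sets (Bbar k n)" using \<nu> unfolding prob_on_def by auto
  let ?A = "\<lambda>m. {x \<in> Ml m. x \<in> A}"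
  have fin: "finite (?A m)" for m using finite_M_blen[of m] by (rule rev_finite_subset) auto
  have un: "nfs k n ` B = (\<Union>x\<in>B. {nfs k n x})" for B by auto
  have m: "measure \<nu> (nfs k n ` ?A m) = h * (real (card (?A m)) * p ^ m)" for m
  proof -
    have "measure \<nu> (nfs k n ` ?A m) = (\<Sum>x\<in>?A m. measure \<nu> {nfs k n x})"
      unfolding un using fin singleton_sets nfs_inj s
      by (intro \<nu>.finite_measure_finite_Union) (auto simp: disjoint_family_on_def)
    also have "\<dots> = (\<Sum>x\<in>?A m. h * p ^ m)" by (rule sum.cong) (auto simp: H)
    finally show ?thesis by simp
  qed
  have "(\<lambda>m. measure \<nu> (nfs k n ` ?A m)) sums measure \<nu> (\<Union>m. nfs k n ` ?A m)"
  proof (rule \<nu>.finite_measure_UNION)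
    show "range (\<lambda>m. nfs k n ` ?A m) \<subseteq> sets \<nu>"
      unfolding un s using fin singleton_sets by (auto intro!: sets.finite_UN)
    show "disjoint_family (\<lambda>m. nfs k n ` ?A m)"
      using nfs_inj by (auto simp: disjoint_family_on_def)
  qed
  moreover have "(\<Union>m. nfs k n ` ?A m) = nfs k n ` A" using assms(3) by auto
  ultimately show ?thesis unfolding m by simp
qed

lemma measure_Mimg:
  assumes "0 \<le> p" "p < q" "prob_on k n \<nu>"
    and "\<And>x. x \<in> M \<Longrightarrow> measure \<nu> {nfs k n x} = Hn k n p * p ^ blen x"
  shows "measure \<nu> (Mimg k n) = 1"
proof -
  have "(\<lambda>m. Hn k n p * (real (a m) * p ^ m)) sums measure \<nu> (Mimg k n)"
    using sums_measure_nfs[OF assms(3,4) order_refl] unfolding Mimg_def Ml_M .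
  moreover have "(\<lambda>m. Hn k n p * (real (a m) * p ^ m)) sums (Hn k n p * Gn p)"
    using sums_Gn[OF assms(1,2)] by (rule sums_mult)
  ultimately have "measure \<nu> (Mimg k n) = Hn k n p * Gn p" by (rule sums_unique2)
  then show ?thesis using Hn_Gn[OF assms(1,2)] by simp
qed

lemma Up_Mimg: assumes "x \<in> M" shows "Up k n x \<inter> Mimg k n = nfs k n ` {y \<in> M. x \<preceq> y}"
proof -
  have "nfs k n y \<in> Up k n x \<longleftrightarrow> x \<preceq> y" if y: "y \<in> M" for y
  proof -
    have "x \<preceq> pr (nfs k n y) (blen x) \<longleftrightarrow> x \<preceq> pr (nfs k n y) (max (blen x) (blen y))"
      using Hs_dvs_pr[OF nfs_Mbar[OF y] Hs_blen[OF assms]]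
        dvs_trans[OF assms _ pr_dvs[of "nfs k n y" "blen x" "max (blen x) (blen y)"]] y by auto
    then show ?thesis using Up_eq[OF Hs_blen[OF assms]] pr_nfs[OF y, of "max (blen x) (blen y)"] y by simp
  qed
  then show ?thesis unfolding Mimg_def by auto
qed

text \<open>\<open>Hn_Gn\<close> enters twice: it shows that \<open>M\<close> carries all the mass,
  so that \<open>Up\<close> may be replaced by its trace on \<open>M\<close>, and it evaluates the
  series over the multiples of \<open>x\<close>.\<close>

lemma uniformI:
  assumes p: "0 \<le> p" "p < q" and \<nu>: "prob_on k n \<nu>"
    and H: "\<And>x. x \<in> M \<Longrightarrow> measure \<nu> {nfs k n x} = Hn k n p * p ^ blen x"
  shows "uniform k n p \<nu>"
  unfolding uniform_def
proof (intro conjI ballI)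
  interpret \<nu>: prob_space \<nu> using \<nu> unfolding prob_on_def by blast
  have s: "sets \<nu> = sets (Bbar k n)" using \<nu> unfolding prob_on_def by auto
  fix x assume x: "x \<in> M"
  have 1: "(\<lambda>m. Hn k n p * (real (card {y \<in> Ml m. y \<in> {y \<in> M. x \<preceq> y}}) * p ^ m)) sums measure \<nu> (nfs k n ` {y \<in> M. x \<preceq> y})"
    by (rule sums_measure_nfs[OF \<nu> H]) auto
  have e: "{y \<in> Ml m. y \<in> {y \<in> M. x \<preceq> y}} = {y \<in> Ml m. x \<preceq> y}" for m by auto
  have 2: "(\<lambda>m. Hn k n p * (real (card {y \<in> Ml m. x \<preceq> y}) * p ^ m)) sums (Hn k n p * (p ^ blen x * Gn p))"
    using sums_multiples[OF p x] by (rule sums_mult)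
  have "measure \<nu> (nfs k n ` {y \<in> M. x \<preceq> y}) = Hn k n p * (p ^ blen x * Gn p)"
    using sums_unique2[OF 1[unfolded e] 2] .
  also have "\<dots> = p ^ blen x" using Hn_Gn[OF p] by (simp add: mult_ac)
  finally have 3: "measure \<nu> (Up k n x \<inter> Mimg k n) = p ^ blen x" unfolding Up_Mimg[OF x] .
  have "measure \<nu> (Mimg k n) = 1" using measure_Mimg[OF p \<nu> H] by blast
  then have "AE \<xi> in \<nu>. \<xi> \<in> Mimg k n" using \<nu>.AE_prob_1 by blast
  then have "measure \<nu> (Up k n x) = measure \<nu> (Up k n x \<inter> Mimg k n)"
    using x Mimg_sets by (intro \<nu>.finite_measure_eq_AE) (auto simp: s)
  then show "measure \<nu> (Up k n x) = p ^ blen x" using 3 by simp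
qed (rule \<nu>)

text \<open>By \<open>a_q_ge\<close> each layer of equal length has mass at least
  \<open>Hn k n p\<close>; the layers are disjoint and infinite in number, so this value must be
  zero.\<close>

lemma uniform_ge_q:
  assumes "p \<ge> q" "uniform k n p \<nu>"
  shows "Hn k n p = 0" "measure \<nu> (Mimg k n) = 0"
proof -
  have \<nu>: "prob_on k n \<nu>" using assms unfolding uniform_def by blast
  note H = uniform_singleton[OF assms(2)]
  have s: "(\<lambda>m. Hn k n p * (real (a m) * p ^ m)) sums measure \<nu> (Mimg k n)"
    using sums_measure_nfs[OF \<nu> H order_refl] unfolding Mimg_def Ml_M .
  have "Hn k n p \<ge> 0" using H[of E] measure_nonneg[of \<nu> "{nfs k n E}"] by simp
  moreover have "(\<lambda>m. Hn k n p * (real (a m) * p ^ m)) \<longlonglongrightarrow> 0"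
    using s sums_summable summable_LIMSEQ_zero by blast
  then have "Hn k n p \<le> 0"
    using a_q_ge[OF assms(1)] calculation mult_left_mono[of 1 _ "Hn k n p"]
    by (intro LIMSEQ_le_const[where X = "\<lambda>m. Hn k n p * (real (a m) * p ^ m)"]) (auto intro!: exI[of _ 0])
  ultimately show 0: "Hn k n p = 0" by simp
  then show "measure \<nu> (Mimg k n) = 0" using s sums_unique2[OF s, of 0] by simp
qed

lemma uniform_exists_less:
  assumes p: "0 \<le> p" "p < q"
  shows "\<exists>\<nu>. uniform k n p \<nu>"
proof -
  \<comment> \<open>The law is sampled in two stages: \<open>N\<close> chooses a length, then an
    element of that length is drawn uniformly.\<close>
  define N where "N = embed_pmf (\<lambda>m. Hn k n p * (real (a m) * p ^ m))"
  have nonneg: "0 \<le> Hn k n p * (real (a m) * p ^ m)" for m using Hn_pos[OF p] p by simp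
  have "(\<lambda>m. Hn k n p * (real (a m) * p ^ m)) sums 1"
    using sums_mult[OF sums_Gn[OF p], of "Hn k n p"] Hn_Gn[OF p] by simp
  then have "(\<Sum>m. ennreal (Hn k n p * (real (a m) * p ^ m))) = ennreal 1"
    using nonneg by (subst suminf_ennreal2) (auto simp: sums_iff)
  then have "(\<integral>\<^sup>+m. ennreal (Hn k n p * (real (a m) * p ^ m)) \<partial>count_space UNIV) = 1"
    by (simp add: nn_integral_count_space_nat)
  then have pN: "pmf N m = Hn k n p * (real (a m) * p ^ m)" for m
    unfolding N_def using nonneg by (intro pmf_embed_pmf) auto
  define Q where "Q = bind_pmf N (\<lambda>m. pmf_of_set (Ml m))"
  have ne: "Ml m \<noteq> {}" for m using a_pos[of m] by (metis card.empty not_one_le_zero)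
  have Q: "measure (measure_pmf Q) {x} = Hn k n p * p ^ blen x" if x: "x \<in> M" for x
  proof -
    have "emeasure (measure_pmf Q) {x} = (\<integral>\<^sup>+m. emeasure (measure_pmf (pmf_of_set (Ml m))) {x} \<partial>measure_pmf N)"
      unfolding Q_def by (rule emeasure_bind_pmf)
    also have "\<dots> = (\<integral>\<^sup>+m. ennreal (1 / real (a (blen x))) * indicator {blen x} m \<partial>measure_pmf N)"
      using ne finite_M_blen x
      by (intro nn_integral_cong) (auto simp: emeasure_pmf_single indicator_def)
    also have "\<dots> = ennreal (1 / real (a (blen x))) * ennreal (Hn k n p * (real (a (blen x)) * p ^ blen x))"
      by (simp add: nn_integral_cmult_indicator emeasure_pmf_single pN)
    also have "\<dots> = ennreal (Hn k n p * p ^ blen x)"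
      using a_pos[of "blen x"] nonneg by (simp flip: ennreal_mult)
    finally show ?thesis using Hn_pos[OF p] p by (simp add: measure_pmf.emeasure_eq_measure)
  qed
  \<comment> \<open>Outside \<open>M\<close>, a set of probability zero, the value only has to lie
    in \<open>MB\<close>.\<close>
  define F where "F x = (if x \<in> M then nfs k n x else nfs k n E)" for x
  define \<nu> where "\<nu> = distr (measure_pmf Q) (Bbar k n) F"
  have FM: "F \<in> measurable (measure_pmf Q) (Bbar k n)"
    unfolding F_def by (auto simp: measurable_def)
  have \<nu>: "prob_on k n \<nu>"
    unfolding prob_on_def \<nu>_def using measure_pmf.prob_space_distr[OF FM] by simp
  have "set_pmf Q \<subseteq> M" unfolding Q_def using ne finite_M_blen by auto
  then have AE: "AE x in measure_pmf Q. x \<in> M" by (auto simp: AE_measure_pmf_iff)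
  have "measure \<nu> {nfs k n x} = Hn k n p * p ^ blen x" if x: "x \<in> M" for x
  proof -
    have "measure \<nu> {nfs k n x} = measure (measure_pmf Q) (F -` {nfs k n x})"
      unfolding \<nu>_def using measure_distr[OF FM singleton_sets[OF x]] by simp
    also have "\<dots> = measure (measure_pmf Q) {x}"
      using AE nfs_inj x by (intro measure_pmf.finite_measure_eq_AE) (auto simp: F_def)
    finally show ?thesis using Q[OF x] by simp
  qed
  then show ?thesis using uniformI[OF p \<nu>] by blast
qed

end

section \<open>Existence and uniqueness of uniform measures\<close>

context nontrivial_garside
begin

section \<open>Bounds and recursion for the cylinder weights\<close>

abbreviation "T x \<equiv> {y \<in> P. arrow k n x y}"

lemma one_factor_MB: "x \<in> P \<Longrightarrow> (\<lambda>i. if i = 0 then x else E) \<in> MB"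
  unfolding Mbar_def by auto

lemma two_factor_MB: "x \<in> P \<Longrightarrow> y \<in> T x \<Longrightarrow> (\<lambda>i. if i = 0 then x else if i = 1 then y else E) \<in> MB"
  unfolding Mbar_def by auto

lemma gp_nonneg:
  assumes "uniform k n p \<nu>" "0 < p" "x \<in> P" shows "0 \<le> gp p x"
proof -
  have "0 \<le> p ^ blen (pr (\<lambda>i. if i = 0 then x else E) (Suc 0)) * gp p x"
    using uniform_cyl[OF assms(1) one_factor_MB[OF assms(3)], of 0]
      measure_nonneg[of \<nu> "cyl (\<lambda>i. if i = 0 then x else E) (Suc 0)"] by simp
  then show ?thesis using assms(2) zero_less_power[OF assms(2)] by (meson mult_pos_neg not_le)
qed

lemma gp_le_1:
  assumes u: "uniform k n p \<nu>" "0 < p" and x: "x \<in> P" shows "gp p x \<le> 1"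
proof -
  interpret \<nu>: prob_space \<nu> using u unfolding uniform_def prob_on_def by blast
  have s: "sets \<nu> = sets (Bbar k n)" using u unfolding uniform_def prob_on_def by auto
  let ?\<xi> = "\<lambda>i. if i = 0 then x else E"
  have mb: "?\<xi> \<in> MB" using one_factor_MB[OF x] .
  have M: "pr ?\<xi> (Suc 0) \<in> M" using pr_M[of ?\<xi>] x by simp
  have "measure \<nu> (cyl ?\<xi> (Suc 0)) \<le> measure \<nu> (Up k n (pr ?\<xi> (Suc 0)))"
    using cyl_Up[OF mb, of 0] Up_sets[OF M] s by (intro \<nu>.finite_measure_mono) auto
  also have "\<dots> = p ^ blen (pr ?\<xi> (Suc 0))" using u M unfolding uniform_def by blast
  finally have "p ^ blen (pr ?\<xi> (Suc 0)) * gp p x \<le> p ^ blen (pr ?\<xi> (Suc 0)) * 1"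
    using uniform_cyl[OF u(1) mb, of 0] by simp
  then show ?thesis using u(2) by simp
qed

text \<open>Split the event that the first factor is \<open>x\<close> according to the second factor
  and divide by \<open>p ^ blen x\<close>. Both sides are polynomials in \<open>p\<close>, so the
  identity can later be continued to \<open>q\<close>.\<close>

lemma gp_rec:
  assumes u: "uniform k n p \<nu>" "0 < p" and x: "x \<in> P"
  shows "gp p x = (\<Sum>y\<in>T x. p ^ blen y * gp p y)"
proof -
  interpret \<nu>: prob_space \<nu> using u unfolding uniform_def prob_on_def by blast
  have s: "sets \<nu> = sets (Bbar k n)" using u unfolding uniform_def prob_on_def by auto
  let ?\<xi> = "\<lambda>i. if i = 0 then x else E" and ?\<zeta> = "\<lambda>y i. if i = 0 then x else if i = 1 then y else E"
  have mb: "?\<xi> \<in> MB" "\<And>y. y \<in> T x \<Longrightarrow> ?\<zeta> y \<in> MB" using one_factor_MB[OF x] two_factor_MB[OF x] by blast+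
  have pr1: "pr ?\<xi> (Suc 0) = x" using x by (simp add: pr_Cons)
  have pr2: "pr (?\<zeta> y) (Suc (Suc 0)) = x \<odot> y" if "y \<in> T x" for y using x that by (simp add: pr_Cons)
  have mem: "\<eta> \<in> cyl (?\<zeta> y) (Suc (Suc 0)) \<longleftrightarrow> \<eta> \<in> MB \<and> \<eta> 0 = x \<and> \<eta> 1 = y" for \<eta> y
    by (auto simp: cyl_def less_Suc_eq)
  have "cyl ?\<xi> (Suc 0) = (\<Union>y\<in>T x. cyl (?\<zeta> y) (Suc (Suc 0)))"
  proof (intro set_eqI iffI)
    fix \<eta> assume "\<eta> \<in> cyl ?\<xi> (Suc 0)"
    then have \<eta>: "\<eta> \<in> MB" "\<eta> 0 = x" by (simp_all add: cyl_def)
    then have "\<eta> 1 \<in> T x" using Mbar_P[of \<eta> 1] Mbar_arrow[of \<eta> 0] by simp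
    then show "\<eta> \<in> (\<Union>y\<in>T x. cyl (?\<zeta> y) (Suc (Suc 0)))" using \<eta> mem by blast
  next
    fix \<eta> assume "\<eta> \<in> (\<Union>y\<in>T x. cyl (?\<zeta> y) (Suc (Suc 0)))"
    then have "\<eta> \<in> MB" "\<eta> 0 = x" using mem by blast+
    then show "\<eta> \<in> cyl ?\<xi> (Suc 0)" by (simp add: cyl_def)
  qed
  moreover have "measure \<nu> (\<Union>y\<in>T x. cyl (?\<zeta> y) (Suc (Suc 0))) = (\<Sum>y\<in>T x. measure \<nu> (cyl (?\<zeta> y) (Suc (Suc 0))))"
  proof (rule \<nu>.finite_measure_finite_Union)
    show "(\<lambda>y. cyl (?\<zeta> y) (Suc (Suc 0))) ` T x \<subseteq> sets \<nu>" using mb cyl_sets unfolding s by blast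
    show "disjoint_family_on (\<lambda>y. cyl (?\<zeta> y) (Suc (Suc 0))) (T x)"
      unfolding disjoint_family_on_def
    proof (intro ballI impI)
      fix y z :: elt assume "y \<noteq> z"
      then have "\<eta> \<notin> cyl (?\<zeta> z) (Suc (Suc 0))" if "\<eta> \<in> cyl (?\<zeta> y) (Suc (Suc 0))" for \<eta>
        using that unfolding mem by simp
      then show "cyl (?\<zeta> y) (Suc (Suc 0)) \<inter> cyl (?\<zeta> z) (Suc (Suc 0)) = {}" by blast
    qed
  qed simp
  ultimately have "p ^ blen x * gp p x = (\<Sum>y\<in>T x. measure \<nu> (cyl (?\<zeta> y) (Suc (Suc 0))))"
    using uniform_cyl[OF u(1) mb(1), of 0] pr1 by simp
  also have "\<dots> = (\<Sum>y\<in>T x. p ^ blen x * (p ^ blen y * gp p y))"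
  proof (rule sum.cong[OF refl])
    fix y assume y: "y \<in> T x"
    show "measure \<nu> (cyl (?\<zeta> y) (Suc (Suc 0))) = p ^ blen x * (p ^ blen y * gp p y)"
      using uniform_cyl[OF u(1) mb(2)[OF y], of "Suc 0"] pr2[OF y] x y by (simp add: power_add)
  qed
  finally show ?thesis using u(2) by (simp flip: sum_distrib_left)
qed

lemma continuous_gp [continuous_intros]: "continuous_on UNIV (\<lambda>p. gp p x)"
  unfolding gp_def by (intro continuous_intros)

section \<open>Passage to the critical parameter by continuity\<close>

lemma nonneg_at_q:
  fixes f :: "real \<Rightarrow> real"
  assumes "continuous_on UNIV f" "\<And>p. 0 < p \<Longrightarrow> p < q \<Longrightarrow> 0 \<le> f p"
  shows "0 \<le> f q"
proof (rule tendsto_lowerbound)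
  show "(f \<longlongrightarrow> f q) (at_left q)"
    using assms(1) by (simp add: continuous_on_eq_continuous_at isCont_def filterlim_at_split)
  have "eventually (\<lambda>p. p \<in> {0<..<q}) (at_left q)" using q_pos by (rule eventually_at_left_real)
  then show "eventually (\<lambda>p. 0 \<le> f p) (at_left q)" by eventually_elim (use assms(2) in auto)
qed simp

lemma eq_at_q:
  fixes f h :: "real \<Rightarrow> real"
  assumes "continuous_on UNIV f" "continuous_on UNIV h" "\<And>p. 0 < p \<Longrightarrow> p < q \<Longrightarrow> f p = h p"
  shows "f q = h q"
proof -
  have "0 \<le> f q - h q" "0 \<le> h q - f q"
    by (rule nonneg_at_q, intro continuous_intros assms(1,2), simp add: assms(3))+
  then show ?thesis by simp
qed

lemma gp_q_nonneg: "x \<in> P \<Longrightarrow> 0 \<le> gp q x"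
proof (rule nonneg_at_q[OF continuous_gp])
  fix p assume "x \<in> P" "0 < p" "p < q"
  then show "0 \<le> gp p x" using uniform_exists_less[of p] gp_nonneg[of p _ x] by auto
qed

lemma gp_q_rec: "x \<in> P \<Longrightarrow> gp q x = (\<Sum>y\<in>T x. q ^ blen y * gp q y)"
proof (rule eq_at_q[where f = "\<lambda>p. gp p x" and h = "\<lambda>p. \<Sum>y\<in>T x. p ^ blen y * gp p y"])
  fix p assume "x \<in> P" "0 < p" "p < q"
  then show "gp p x = (\<Sum>y\<in>T x. p ^ blen y * gp p y)"
    using uniform_exists_less[of p] gp_rec by auto
qed (intro continuous_intros)+

lemma uniform_sum_NW:
  assumes "uniform k n p \<nu>" "x \<in> Hs (Suc j)"
  shows "(\<Sum>\<zeta>\<in>{\<zeta>\<in>NW (Suc j). x \<preceq> pr \<zeta> (Suc j)}. p ^ blen (pr \<zeta> (Suc j)) * gp p (\<zeta> j)) = p ^ blen x"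
proof -
  have "measure \<nu> (Up k n x) = (\<Sum>\<zeta>\<in>{\<zeta>\<in>NW (Suc j). x \<preceq> pr \<zeta> (Suc j)}. measure \<nu> (cyl \<zeta> (Suc j)))"
    using measure_Up_cyl assms unfolding uniform_def by blast
  also have "\<dots> = (\<Sum>\<zeta>\<in>{\<zeta>\<in>NW (Suc j). x \<preceq> pr \<zeta> (Suc j)}. p ^ blen (pr \<zeta> (Suc j)) * gp p (\<zeta> j))"
    by (rule sum.cong[OF refl]) (use uniform_cyl[OF assms(1)] NW_MB in blast)
  finally show ?thesis using assms Hs_M unfolding uniform_def by metis
qed

text \<open>Below \<open>q\<close> this is additivity of an existing uniform measure; at
  \<open>q\<close> it is what will make the law of the chain uniform.\<close>

lemma sum_NW_q:
  assumes "x \<in> Hs (Suc j)"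
  shows "(\<Sum>\<zeta>\<in>{\<zeta>\<in>NW (Suc j). x \<preceq> pr \<zeta> (Suc j)}. q ^ blen (pr \<zeta> (Suc j)) * gp q (\<zeta> j)) = q ^ blen x"
proof (rule eq_at_q[where h = "\<lambda>p. p ^ blen x" and
    f = "\<lambda>p. \<Sum>\<zeta>\<in>{\<zeta>\<in>NW (Suc j). x \<preceq> pr \<zeta> (Suc j)}. p ^ blen (pr \<zeta> (Suc j)) * gp p (\<zeta> j)"])
  fix p assume "0 < p" "p < q"
  then show "(\<Sum>\<zeta>\<in>{\<zeta>\<in>NW (Suc j). x \<preceq> pr \<zeta> (Suc j)}. p ^ blen (pr \<zeta> (Suc j)) * gp p (\<zeta> j)) = p ^ blen x"
    using uniform_exists_less[of p] uniform_sum_NW[OF _ assms] by auto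
qed (intro continuous_intros)+

subsection \<open>The Markov chain of Garside factors\<close>

text \<open>The Doob transform of the weights \<open>p ^ blen y\<close> by the harmonic function
  \<open>gp p\<close>. Where \<open>gp p x\<close> vanishes, \<open>E\<close> is a placeholder: it
  may follow any state.\<close>

definition tr :: "real \<Rightarrow> elt \<Rightarrow> elt pmf" where
  "tr p x = (if gp p x > 0 then embed_pmf (\<lambda>y. if y \<in> T x then p ^ blen y * gp p y / gp p x else 0) else return_pmf E)"

text \<open>\<open>F\<close> proposes a successor for every state at once, so independent maps drive
  the chain and a product measure suffices. The default \<open>E\<close> keeps every path in
  \<open>MB\<close>, not only almost every one.\<close>

definition step :: "elt \<Rightarrow> (elt \<Rightarrow> elt) \<Rightarrow> elt" where
  "step x F = (if F x \<in> T x then F x else E)"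

text \<open>The chain leaves from a fictitious \<open>\<Delta>\<close>: every simple element may
  follow it and \<open>gp p \<Delta> = 1\<close>, so the first step has the initial law
  \<open>p ^ blen x * gp p x\<close>.\<close>

primrec chain :: "(nat \<Rightarrow> elt \<Rightarrow> elt) \<Rightarrow> nat \<Rightarrow> elt" where
  "chain \<omega> 0 = step \<Delta> (\<omega> 0)"
| "chain \<omega> (Suc i) = step (chain \<omega> i) (\<omega> (Suc i))"

definition prev :: "(nat \<Rightarrow> elt) \<Rightarrow> nat \<Rightarrow> elt" where
  "prev \<zeta> i = (case i of 0 \<Rightarrow> \<Delta> | Suc j \<Rightarrow> \<zeta> j)"

lemma step_T: "step x F \<in> T x" unfolding step_def by simp

lemma chain_MB: "chain \<omega> \<in> MB"
proof -
  have "chain \<omega> i \<in> P" for i using step_T by (cases i) auto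
  then show ?thesis using step_T unfolding Mbar_def by auto
qed

lemma chain_step: "chain \<omega> i = step (prev (chain \<omega>) i) (\<omega> i)"
  by (cases i) (auto simp: prev_def)

lemma chain_cyl: "chain \<omega> \<in> cyl \<zeta> j \<longleftrightarrow> (\<forall>i\<in>{..<j}. \<omega> i \<in> {F. step (prev \<zeta> i) F = \<zeta> i})"
proof -
  have "(\<forall>i<j. chain \<omega> i = \<zeta> i) \<longleftrightarrow> (\<forall>i<j. step (prev \<zeta> i) (\<omega> i) = \<zeta> i)"
  proof (induction j)
    case (Suc j)
    have "chain \<omega> j = step (prev \<zeta> j) (\<omega> j)" if "\<forall>i<j. chain \<omega> i = \<zeta> i"
      using chain_step[of \<omega> j] that by (cases j) (auto simp: prev_def)
    then show ?case using Suc by (auto simp: less_Suc_eq)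
  qed simp
  then show ?thesis using chain_MB unfolding cyl_def by auto
qed

lemma prev_T: assumes "\<zeta> \<in> MB" shows "prev \<zeta> i \<in> P" "\<zeta> i \<in> T (prev \<zeta> i)"
proof -
  have "arrow k n \<Delta> x" for x unfolding arrow_def Rset_\<Delta> Lset_def by blast
  then show "prev \<zeta> i \<in> P" "\<zeta> i \<in> T (prev \<zeta> i)"
    using Mbar_P[OF assms] Mbar_arrow[OF assms] by (cases i; auto simp: prev_def)+
qed

context
  fixes p :: real
  assumes p0: "0 < p" and nn: "\<And>x. x \<in> P \<Longrightarrow> 0 \<le> gp p x"
    and rec: "\<And>x. x \<in> P \<Longrightarrow> gp p x = (\<Sum>y\<in>T x. p ^ blen y * gp p y)"
begin

lemma pmf_tr_pos:
  assumes x: "x \<in> P" and pos: "gp p x > 0"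
  shows "pmf (tr p x) y = (if y \<in> T x then p ^ blen y * gp p y / gp p x else 0)"
proof -
  let ?f = "\<lambda>y. if y \<in> T x then p ^ blen y * gp p y / gp p x else 0"
  have f0: "0 \<le> ?f y" for y using p0 nn pos by simp
  have "(\<integral>\<^sup>+y. ennreal (?f y) \<partial>count_space UNIV) = (\<Sum>y\<in>T x. ennreal (?f y))"
    by (rule nn_integral_count_space') auto
  also have "\<dots> = ennreal (\<Sum>y\<in>T x. ?f y)" by (rule sum_ennreal) (rule f0)
  also have "(\<Sum>y\<in>T x. ?f y) = (\<Sum>y\<in>T x. p ^ blen y * gp p y) / gp p x"
    unfolding sum_divide_distrib by (rule sum.cong) auto
  also have "\<dots> = 1" using rec[OF x] pos by simp
  finally have "(\<integral>\<^sup>+y. ennreal (?f y) \<partial>count_space UNIV) = 1" by simp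
  then show ?thesis unfolding tr_def using pos f0 by (simp add: pmf_embed_pmf)
qed

lemma set_tr: assumes "x \<in> P" shows "set_pmf (tr p x) \<subseteq> T x"
proof (cases "gp p x > 0")
  case True
  then show ?thesis using pmf_tr_pos[OF assms] by (auto simp: set_pmf_eq split: if_splits)
qed (simp add: tr_def)

text \<open>If \<open>gp p x = 0\<close>, the recursion is a vanishing sum of nonnegative terms, so
  both sides are zero and the placeholder law does no harm.\<close>

lemma pmf_tr: assumes x: "x \<in> P" and y: "y \<in> T x" shows "gp p x * pmf (tr p x) y = p ^ blen y * gp p y"
proof (cases "gp p x > 0")
  case True
  then show ?thesis using pmf_tr_pos[OF x] y by simp
next
  case False
  then have 0: "gp p x = 0" using nn[OF x] by simp
  have "p ^ blen y * gp p y = 0"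
  proof (rule sum_nonneg_0[where s = "T x" and f = "\<lambda>y. p ^ blen y * gp p y"])
    show "(\<Sum>y\<in>T x. p ^ blen y * gp p y) = 0" using rec[OF x] 0 by simp
    show "0 \<le> p ^ blen z * gp p z" if "z \<in> T x" for z using that nn[of z] p0 by simp
  qed (use y in simp_all)
  then show ?thesis using 0 by simp
qed

lemma measure_step:
  assumes x: "x \<in> P"
  shows "measure (measure_pmf (Pi_pmf P E (tr p))) {F. step x F = y} = pmf (tr p x) y"
proof -
  let ?D = "Pi_pmf P E (tr p)"
  have "F x \<in> T x" if F: "F \<in> set_pmf ?D" for F
  proof -
    have "F x \<in> set_pmf (tr p x)" using F x set_Pi_pmf_subset'[of P E "tr p"] unfolding PiE_dflt_def by auto
    then show ?thesis using set_tr[OF x] by blast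
  qed
  then have "AE F in measure_pmf ?D. F x \<in> T x" by (auto simp: AE_measure_pmf_iff)
  then have "measure (measure_pmf ?D) {F. step x F = y} = measure (measure_pmf ?D) {F. F x = y}"
    by (intro measure_pmf.finite_measure_eq_AE) (auto simp: step_def)
  also have "\<dots> = measure (measure_pmf (map_pmf (\<lambda>F. F x) ?D)) {y}"
    by (simp add: measure_map_pmf vimage_def)
  also have "map_pmf (\<lambda>F. F x) ?D = tr p x" using x by (simp add: Pi_pmf_component)
  finally show ?thesis by (simp add: measure_pmf_single)
qed

text \<open>Multiplying \<open>pmf_tr\<close> along the path telescopes the weights, beginning with
  \<open>gp p \<Delta> = 1\<close>.\<close>

lemma prod_tr:
  assumes \<zeta>: "\<zeta> \<in> MB"
  shows "(\<Prod>i<Suc j. pmf (tr p (prev \<zeta> i)) (\<zeta> i)) = p ^ blen (pr \<zeta> (Suc j)) * gp p (\<zeta> j)"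
proof (induction j)
  case 0
  show ?case using pmf_tr[OF prev_T[OF \<zeta>, of 0]] \<zeta> by (simp add: prev_def gp_\<Delta> pr_Cons)
next
  case (Suc j)
  have "(\<Prod>i<Suc (Suc j). pmf (tr p (prev \<zeta> i)) (\<zeta> i)) =
      p ^ blen (pr \<zeta> (Suc j)) * gp p (\<zeta> j) * pmf (tr p (\<zeta> j)) (\<zeta> (Suc j))"
    using Suc by (simp add: prev_def)
  also have "\<dots> = p ^ blen (pr \<zeta> (Suc j)) * (p ^ blen (\<zeta> (Suc j)) * gp p (\<zeta> (Suc j)))"
    using pmf_tr[OF prev_T[OF \<zeta>, of "Suc j"]] by (simp add: prev_def)
  also have "\<dots> = p ^ blen (pr \<zeta> (Suc (Suc j))) * gp p (\<zeta> (Suc j))"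
    using \<zeta> by (simp add: pr_Suc power_add)
  finally show ?case .
qed

lemma chain_measure:
  "\<exists>\<nu>. prob_on k n \<nu> \<and> (\<forall>\<zeta>\<in>MB. \<forall>j. measure \<nu> (cyl \<zeta> (Suc j)) = p ^ blen (pr \<zeta> (Suc j)) * gp p (\<zeta> j))"
proof -
  define D where "D = Pi_pmf P E (tr p)"
  define \<Omega> where "\<Omega> = PiM (UNIV :: nat set) (\<lambda>_. measure_pmf D)"
  interpret P: product_prob_space "\<lambda>_. measure_pmf D" "UNIV :: nat set" by standard
  \<comment> \<open>A cylinder becomes a finite intersection of conditions on single coordinates;
    this gives both measurability and, by independence, the product formula.\<close>
  have pre: "chain -` cyl \<zeta> j \<inter> space \<Omega> = {\<omega> \<in> space \<Omega>. \<forall>i\<in>{..<j}. \<omega> i \<in> {F. step (prev \<zeta> i) F = \<zeta> i}}" for \<zeta> j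
    using chain_cyl by auto
  have preS: "chain -` cyl \<zeta> j \<inter> space \<Omega> \<in> sets \<Omega>" for \<zeta> j
    unfolding pre
  proof (rule sets.sets_Collect_finite_All)
    fix i
    have "(\<lambda>\<omega>. \<omega> i) -` {F. step (prev \<zeta> i) F = \<zeta> i} \<inter> space \<Omega> \<in> sets \<Omega>"
      unfolding \<Omega>_def by (rule measurable_sets[OF measurable_component_singleton]) simp_all
    then show "{\<omega> \<in> space \<Omega>. \<omega> i \<in> {F. step (prev \<zeta> i) F = \<zeta> i}} \<in> sets \<Omega>"
      by (simp add: vimage_def Int_def conj_commute)
  qed simp
  have "chain \<in> measurable \<Omega> (sigma MB Cyls)"
  proof (rule measurable_measure_of[OF Cyls_Pow])
    fix A assume "A \<in> Cyls"
    then show "chain -` A \<inter> space \<Omega> \<in> sets \<Omega>" unfolding Cyls_def using preS by auto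
  qed (simp add: chain_MB)
  then have meas: "chain \<in> measurable \<Omega> (Bbar k n)"
    using sets_Bbar Cyls_Pow by (subst measurable_cong_sets[OF refl, of _ "sigma MB Cyls"]) auto
  define \<nu> where "\<nu> = distr \<Omega> (Bbar k n) chain"
  have "prob_space \<Omega>" unfolding \<Omega>_def by (rule P.prob_space_axioms)
  then have "prob_on k n \<nu>" unfolding prob_on_def \<nu>_def using prob_space.prob_space_distr meas by auto
  moreover have "measure \<nu> (cyl \<zeta> (Suc j)) = p ^ blen (pr \<zeta> (Suc j)) * gp p (\<zeta> j)" if \<zeta>: "\<zeta> \<in> MB" for \<zeta> j
  proof -
    have "measure \<nu> (cyl \<zeta> (Suc j)) = measure \<Omega> (chain -` cyl \<zeta> (Suc j) \<inter> space \<Omega>)"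
      unfolding \<nu>_def by (rule measure_distr[OF meas cyl_sets[OF \<zeta>]])
    also have "\<dots> = (\<Prod>i<Suc j. measure (measure_pmf D) {F. step (prev \<zeta> i) F = \<zeta> i})"
      unfolding pre unfolding \<Omega>_def
      using P.emeasure_PiM_Collect[of "{..<Suc j}" "\<lambda>i. {F. step (prev \<zeta> i) F = \<zeta> i}"]
      unfolding P.emeasure_eq_measure measure_pmf.emeasure_eq_measure
      by (simp add: prod_ennreal prod_nonneg del: prod.lessThan_Suc)
    also have "\<dots> = (\<Prod>i<Suc j. pmf (tr p (prev \<zeta> i)) (\<zeta> i))"
      unfolding D_def by (rule prod.cong[OF refl]) (rule measure_step[OF prev_T(1)[OF \<zeta>]])
    also have "\<dots> = p ^ blen (pr \<zeta> (Suc j)) * gp p (\<zeta> j)" by (rule prod_tr[OF \<zeta>])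
    finally show ?thesis .
  qed
  ultimately show ?thesis by blast
qed

end

lemma uniform_exists_q: "\<exists>\<nu>. uniform k n q \<nu>"
proof -
  obtain \<nu> where \<nu>: "prob_on k n \<nu>"
    "\<And>\<zeta> j. \<zeta> \<in> MB \<Longrightarrow> measure \<nu> (cyl \<zeta> (Suc j)) = q ^ blen (pr \<zeta> (Suc j)) * gp q (\<zeta> j)"
    using chain_measure[OF q_pos gp_q_nonneg gp_q_rec] by blast
  have "measure \<nu> (Up k n x) = q ^ blen x" if x: "x \<in> M" for x
  proof -
    have H: "x \<in> Hs (Suc (blen x))" using Hs_blen[OF x] Hs_mono[of "blen x" "Suc (blen x)"] by auto
    show ?thesis unfolding measure_Up_cyl[OF \<nu>(1) H] sum_NW_q[OF H, symmetric]
      by (rule sum.cong[OF refl]) (use \<nu>(2) NW_MB in blast)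
  qed
  then show ?thesis using \<nu>(1) unfolding uniform_def by blast
qed

section \<open>Nonexistence for the remaining parameters\<close>

lemma DeltaX_single: "s \<in> \<Sigma> \<Longrightarrow> DeltaX k n {s} = g s"
  using DeltaX_dvs[of "{s}" "g s"] DeltaX_dvs[of "{s}" "DeltaX k n {s}"] DeltaX_M[of "{s}"]
  by (intro dvs_antisym) auto

text \<open>By \<open>gp_rec\<close> a zero spreads along arrows. From \<open>x \<noteq> E\<close>
  an arrow leads to an atom, and \<open>mixing\<close> leads on to a \<open>z\<close> whose weight
  is \<open>1\<close> or \<open>1 - p\<close>.\<close>

lemma gp_pos:
  assumes u: "uniform k n p \<nu>" and p: "0 < p" "p < 1" and x: "x \<in> P" "x \<noteq> E"
  shows "0 < gp p x"
proof (rule ccontr)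
  assume "\<not> 0 < gp p x"
  then have x0: "gp p x = 0" using gp_nonneg[OF u p(1) x(1)] by simp
  have vanish: "gp p z = 0" if h: "y \<in> P" "z \<in> P" "arrow k n y z" "gp p y = 0" for y z
  proof -
    have "p ^ blen z * gp p z = 0"
    proof (rule sum_nonneg_0[where s = "T y" and f = "\<lambda>y. p ^ blen y * gp p y"])
      show "(\<Sum>y\<in>T y. p ^ blen y * gp p y) = 0" using gp_rec[OF u p(1) h(1)] h(4) by simp
      show "0 \<le> p ^ blen w * gp p w" if "w \<in> T y" for w using that gp_nonneg[OF u p(1), of w] p by simp
    qed (use h in simp_all)
    then show ?thesis using p by simp
  qed
  obtain s where s: "s \<in> Rset k n x" using Rset_empty x by blast
  then have sS: "s \<in> \<Sigma>" unfolding Rset_def by blast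
  have s0: "gp p (g s) = 0" by (rule vanish[OF x(1) _ _ x0]) (use s sS in \<open>auto simp: arrow_def\<close>)
  obtain z where z: "(g s, z) \<in> {(x, y). x \<in> P \<and> y \<in> P \<and> arrow k n x y}\<^sup>*" "card (\<Sigma> - Rset k n z) \<le> 1"
    using mixing[OF sS] by blast
  from z(1) have z0: "gp p z = 0"
    by (induction rule: rtrancl_induct) (use s0 vanish in auto)
  have "finite (\<Sigma> - Rset k n z)" by simp
  then consider "\<Sigma> - Rset k n z = {}" | t where "\<Sigma> - Rset k n z = {t}"
    using z(2) by (metis card_0_eq card_1_singletonE le_neq_implies_less less_one)
  then show False
  proof cases
    case 1
    have "gp p z = 1" unfolding gp_def 1 by (simp add: DeltaX_empty)
    then show ?thesis using z0 by simp
  next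
    case 2
    then have "t \<in> \<Sigma>" by blast
    have "gp p z = (\<Sum>X\<in>{{}, {t}}. (- 1) ^ card X * p ^ blen (DeltaX k n X))"
      unfolding gp_def 2 by (rule sum.cong) auto
    also have "\<dots> = 1 - p" using DeltaX_single[OF \<open>t \<in> \<Sigma>\<close>] by (simp add: DeltaX_empty)
    finally show ?thesis using z0 p by simp
  qed
qed

lemma blen_pr_ge:
  assumes "\<zeta> \<in> MB" "\<zeta> j \<noteq> E"
  shows "Suc j \<le> blen (pr \<zeta> (Suc j))"
proof -
  have ne: "\<zeta> i \<noteq> E" if "i \<le> j" for i using Mbar_E[OF assms(1) _ that] assms(2) by blast
  have "i \<le> blen (pr \<zeta> i)" if "i \<le> Suc j" for i
    using that
  proof (induction i)
    case (Suc i)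
    have "blen (\<zeta> i) \<noteq> 0" using ne[of i] Suc.prems blen_0_iff[of "\<zeta> i"] assms(1) by auto
    then have "1 \<le> blen (\<zeta> i)" by simp
    moreover have "blen (pr \<zeta> (Suc i)) = blen (pr \<zeta> i) + blen (\<zeta> i)" using assms(1) by (simp add: pr_Suc)
    ultimately show ?case using Suc by simp
  qed simp
  then show ?thesis by blast
qed

lemma no_uniform:
  assumes "q < p" "p \<noteq> 1" shows "\<not> uniform k n p \<nu>"
proof
  assume u: "uniform k n p \<nu>"
  interpret \<nu>: prob_space \<nu> using u unfolding uniform_def prob_on_def by blast
  obtain s where s: "s \<in> \<Sigma>" using gens_ne by blast
  then have "measure \<nu> (Up k n (g s)) = p" using u unfolding uniform_def by simp
  \<comment> \<open>\<open>p\<close> is the probability of \<open>Up k n (g s)\<close>, hence at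
    most \<open>1\<close>.\<close>
  then have p: "0 < p" "p < 1" using \<nu>.prob_le_1[of "Up k n (g s)"] assms q_pos by auto
  obtain \<mu> where \<mu>: "uniform k n q \<mu>" using uniform_exists_q by blast
  have H0: "gp p E = 0" "gp q E = 0" using uniform_ge_q u \<mu> assms by (auto simp: gp_E)
  \<comment> \<open>A common lower bound for the weights at \<open>p\<close>. The factor
    \<open>E\<close>, which has no such bound, has weight zero at both parameters and drops out of
    the sums.\<close>
  define c where "c = Min (gp p ` (P - {E}))"
  have gE: "g s \<noteq> E" using blen_g[of s] blen_E by (metis zero_neq_one)
  have fin: "finite (P - {E})" "P - {E} \<noteq> {}" using s gE g_P[OF s] by (simp, blast)
  have c: "0 < c" unfolding c_def using gp_pos[OF u p] fin by (subst Min_gr_iff) auto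
  have cle: "c \<le> gp p y" if "y \<in> P" "y \<noteq> E" for y unfolding c_def using fin that by simp
  have main: "c * (p / q) ^ Suc j \<le> 1" for j
  proof -
    let ?N = "{\<zeta> \<in> NW (Suc j). \<zeta> j \<noteq> E}"
    have all: "{\<zeta> \<in> NW (Suc j). E \<preceq> pr \<zeta> (Suc j)} = NW (Suc j)" using NW_MB by auto
    have red: "(\<Sum>\<zeta>\<in>?N. r ^ blen (pr \<zeta> (Suc j)) * gp r (\<zeta> j)) = 1" if h: "uniform k n r \<nu>'" "gp r E = 0" for r \<nu>'
    proof -
      have "(\<Sum>\<zeta>\<in>?N. r ^ blen (pr \<zeta> (Suc j)) * gp r (\<zeta> j)) = (\<Sum>\<zeta>\<in>NW (Suc j). r ^ blen (pr \<zeta> (Suc j)) * gp r (\<zeta> j))"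
        by (rule sum.mono_neutral_left) (use h(2) in auto)
      also have "\<dots> = 1" using uniform_sum_NW[OF h(1) E_Hs, of j] unfolding all by simp
      finally show ?thesis .
    qed
    have "1 = (\<Sum>\<zeta>\<in>?N. q ^ blen (pr \<zeta> (Suc j)) * gp q (\<zeta> j))" using red[OF \<mu> H0(2)] by simp
    also have "\<dots> \<le> (\<Sum>\<zeta>\<in>?N. q ^ blen (pr \<zeta> (Suc j)) * 1)"
      using gp_le_1[OF \<mu> q_pos] q_pos NW_MB Mbar_P by (intro sum_mono mult_left_mono) auto
    finally have 1: "1 \<le> (\<Sum>\<zeta>\<in>?N. q ^ blen (pr \<zeta> (Suc j)))" by simp
    have "c * (p / q) ^ Suc j * 1 \<le> c * (p / q) ^ Suc j * (\<Sum>\<zeta>\<in>?N. q ^ blen (pr \<zeta> (Suc j)))"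
      using 1 c p q_pos by (intro mult_left_mono) auto
    also have "\<dots> = (\<Sum>\<zeta>\<in>?N. c * ((p / q) ^ Suc j * q ^ blen (pr \<zeta> (Suc j))))"
      by (simp add: sum_distrib_left mult.assoc)
    also have "\<dots> \<le> (\<Sum>\<zeta>\<in>?N. p ^ blen (pr \<zeta> (Suc j)) * gp p (\<zeta> j))"
    proof (rule sum_mono)
      fix \<zeta> assume \<zeta>: "\<zeta> \<in> ?N"
      let ?l = "blen (pr \<zeta> (Suc j))"
      have mb: "\<zeta> \<in> MB" using \<zeta> NW_MB by blast
      \<comment> \<open>A word with \<open>j + 1\<close> nontrivial factors has length at least
        \<open>j + 1\<close>, so replacing \<open>q\<close> by \<open>p\<close> gains at least this
        factor in each term.\<close>
      have "(p / q) ^ Suc j \<le> (p / q) ^ ?l"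
        using blen_pr_ge[OF mb] \<zeta> assms(1) q_pos by (intro power_increasing) auto
      then have "(p / q) ^ Suc j * q ^ ?l \<le> (p / q) ^ ?l * q ^ ?l" using q_pos by (intro mult_right_mono) auto
      also have "\<dots> = p ^ ?l" using q_pos by (simp add: power_divide)
      finally have "c * ((p / q) ^ Suc j * q ^ ?l) \<le> gp p (\<zeta> j) * p ^ ?l"
        using cle[OF Mbar_P[OF mb, of j]] \<zeta> c p q_pos by (intro mult_mono) auto
      then show "c * ((p / q) ^ Suc j * q ^ ?l) \<le> p ^ ?l * gp p (\<zeta> j)" by (simp add: mult.commute)
    qed
    also have "\<dots> = 1" using red[OF u H0(1)] .
    finally show ?thesis by simp
  qed
  have "1 < p / q" using assms q_pos by simp
  then obtain j where "1 / c < (p / q) ^ j" using real_arch_pow by blast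
  also have "\<dots> \<le> (p / q) ^ Suc j" using \<open>1 < p / q\<close> by (intro power_increasing) auto
  finally have "1 < c * (p / q) ^ Suc j" using c by (simp add: field_simps)
  then show False using main[of j] by simp
qed

section \<open>The Dirac cases and the boundary\<close>

lemma prob_on_return: "\<xi> \<in> MB \<Longrightarrow> prob_on k n (return (Bbar k n) \<xi>)"
  unfolding prob_on_def by (simp add: prob_space_return)

lemma uniform_0: "uniform k n 0 (return (Bbar k n) (nfs k n E))"
  unfolding uniform_def
proof (intro conjI ballI)
  show "prob_on k n (return (Bbar k n) (nfs k n E))" by (rule prob_on_return) simp
  fix x assume x: "x \<in> M"
  have "pr (\<lambda>_. E) j = E" for j by (induction j) (auto simp: pr_Suc)
  then have "nfs k n E \<in> Up k n x \<longleftrightarrow> x \<preceq> E"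
    unfolding Up_eq[OF Hs_blen[OF x]] nfs_E using nfs_Mbar[of E] unfolding nfs_E by simp
  also have "\<dots> \<longleftrightarrow> blen x = 0" using dvs_blen[OF x, of E] x by auto
  finally show "measure (return (Bbar k n) (nfs k n E)) (Up k n x) = 0 ^ blen x"
    using Up_sets[OF x] by (auto simp: measure_return indicator_def power_0_left)
qed

lemma \<Delta>_MB: "(\<lambda>_. \<Delta>) \<in> MB"
proof -
  have "arrow k n \<Delta> \<Delta>" unfolding arrow_def Rset_\<Delta> Lset_def by blast
  then show ?thesis unfolding Mbar_def by simp
qed

lemma uniform_1: "uniform k n 1 (return (Bbar k n) (\<lambda>_. \<Delta>))"
  unfolding uniform_def
proof (intro conjI ballI)
  show "prob_on k n (return (Bbar k n) (\<lambda>_. \<Delta>))" by (rule prob_on_return[OF \<Delta>_MB])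
  fix x assume x: "x \<in> M"
  have "cs (nfs k n x) (blen x) i \<in> M" for i using Mbar_M[OF cs_Mbar[OF nfs_Mbar[OF x]]] .
  \<comment> \<open>Every \<open>x\<close> divides the power \<open>blen x\<close> of
    \<open>\<Delta>\<close>; \<open>cs\<close> supplies the cofactor.\<close>
  then have "x \<preceq> pr (\<lambda>_. \<Delta>) (blen x)"
    using cs_mult[OF nfs_Mbar[OF x], of "blen x"] pr_nfs[OF x order_refl]
      dvsI[of "pr (cs (nfs k n x) (blen x)) (blen x)" x] by simp
  then have "(\<lambda>_. \<Delta>) \<in> Up k n x" unfolding Up_eq[OF Hs_blen[OF x]] using \<Delta>_MB by simp
  then show "measure (return (Bbar k n) (\<lambda>_. \<Delta>)) (Up k n x) = 1 ^ blen x"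
    using Up_sets[OF x] by (simp add: measure_return)
qed

lemma bdry_sets: "bdry k n \<in> sets (Bbar k n)"
  unfolding bdry_def using Mimg_sets sets.compl_sets[of "Mimg k n" "Bbar k n"] by simp

lemma uniform_q_bdry: assumes "uniform k n q \<nu>" shows "measure \<nu> (bdry k n) = 1"
proof -
  interpret \<nu>: prob_space \<nu> using assms unfolding uniform_def prob_on_def by blast
  have s: "sets \<nu> = sets (Bbar k n)" using assms unfolding uniform_def prob_on_def by auto
  have sp: "space \<nu> = MB" using sets_eq_imp_space_eq[OF s] by simp
  have "measure \<nu> (space \<nu> - Mimg k n) = 1 - measure \<nu> (Mimg k n)"
    by (rule \<nu>.prob_compl) (simp add: s Mimg_sets)
  then show ?thesis using uniform_ge_q(2)[OF order_refl assms] unfolding sp bdry_def by simp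
qed

lemma measure_up:
  assumes \<nu>: "prob_on k n \<nu>" and b: "measure \<nu> (bdry k n) = 1" and x: "x \<in> M"
  shows "measure \<nu> (up k n x) = measure \<nu> (Up k n x)"
proof -
  interpret \<nu>: prob_space \<nu> using \<nu> unfolding prob_on_def by blast
  have s: "sets \<nu> = sets (Bbar k n)" using \<nu> unfolding prob_on_def by auto
  have "AE \<xi> in \<nu>. \<xi> \<in> bdry k n" using \<nu>.AE_prob_1 b by blast
  then show ?thesis
    unfolding up_def using Up_sets[OF x] bdry_sets by (intro \<nu>.finite_measure_eq_AE) (auto simp: s)
qed

theorem uniform_measures:
  assumes "p \<ge> 0"
  shows "((\<exists>\<nu>. uniform k n p \<nu>) \<longleftrightarrow> (p \<le> qn k n \<or> p = 1))
    \<and> ((p \<le> qn k n \<or> p = 1) \<longrightarrow> (\<exists>!\<nu>. uniform k n p \<nu>))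
    \<and> (\<forall>\<nu>. uniform k n 0 \<nu> \<longrightarrow> \<nu> = return (Bbar k n) (nfs k n (unit_e k n)))
    \<and> (\<forall>\<nu>. uniform k n 1 \<nu> \<longrightarrow> \<nu> = return (Bbar k n) (\<lambda>_. Delta k n))
    \<and> (0 < p \<and> p < qn k n \<longrightarrow>
         (\<forall>\<nu>. uniform k n p \<nu> \<longrightarrow> measure \<nu> (Mimg k n) = 1 \<and>
              (\<forall>x\<in>Mon k n. measure \<nu> {nfs k n x} = Hn k n p * p ^ blen x))
       \<and> (\<forall>\<nu>. prob_on k n \<nu> \<longrightarrow>
            ((\<forall>x\<in>Mon k n. measure \<nu> {nfs k n x} = Hn k n p * p ^ blen x)
              \<longleftrightarrow> uniform k n p \<nu>)))
    \<and> (p = qn k n \<longrightarrow>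
         (\<forall>\<nu>. uniform k n p \<nu> \<longrightarrow> measure \<nu> (bdry k n) = 1)
       \<and> (\<forall>\<nu>. prob_on k n \<nu> \<longrightarrow>
            ((\<forall>x\<in>Mon k n. measure \<nu> (up k n x) = qn k n ^ blen x)
              \<longleftrightarrow> uniform k n p \<nu>)))"
proof -
  have ex: "\<exists>\<nu>. uniform k n p \<nu>" if "p \<le> q \<or> p = 1"
    using that uniform_exists_less[OF assms] uniform_exists_q uniform_1 by (metis order_le_less)
  have nex: "\<not> uniform k n p \<nu>" if "\<not> (p \<le> q \<or> p = 1)" for \<nu> using no_uniform that by auto
  have lt: "measure \<nu> (Mimg k n) = 1 \<and> (\<forall>x\<in>M. measure \<nu> {nfs k n x} = Hn k n p * p ^ blen x)"
    if "p < q" "uniform k n p \<nu>" for \<nu>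
    using measure_Mimg[OF assms that(1), of \<nu>] uniform_singleton[OF that(2)] that(2)
    unfolding uniform_def by blast
  have lt': "uniform k n p \<nu>"
    if "p < q" "prob_on k n \<nu>" "\<forall>x\<in>M. measure \<nu> {nfs k n x} = Hn k n p * p ^ blen x" for \<nu>
    using uniformI[OF assms that(1,2)] that(3) by blast
  have eq1: "\<forall>x\<in>M. measure \<nu> (up k n x) = q ^ blen x" if "uniform k n q \<nu>" for \<nu>
    using measure_up uniform_q_bdry[OF that] that unfolding uniform_def by simp
  have eq2: "uniform k n q \<nu>" if h: "prob_on k n \<nu>" "\<forall>x\<in>M. measure \<nu> (up k n x) = q ^ blen x" for \<nu>
  proof -
    \<comment> \<open>At \<open>x = E\<close> the hypothesis itself says that the boundary has full
      mass.\<close>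
    have "Up k n E = MB" unfolding Up_eq[of E 0, simplified] by simp
    then have "up k n E = bdry k n" unfolding up_def bdry_def by auto
    then have "measure \<nu> (bdry k n) = 1" using h(2) E_in_M by (metis blen_E power_0)
    then show ?thesis using measure_up[OF h(1)] h unfolding uniform_def by simp
  qed
  show ?thesis
  proof (intro conjI)
    show "(\<exists>\<nu>. uniform k n p \<nu>) \<longleftrightarrow> p \<le> q \<or> p = 1" using ex nex by blast
    show "p \<le> q \<or> p = 1 \<longrightarrow> (\<exists>!\<nu>. uniform k n p \<nu>)" using ex uniform_unique by blast
    show "\<forall>\<nu>. uniform k n 0 \<nu> \<longrightarrow> \<nu> = return (Bbar k n) (nfs k n E)"
      using uniform_unique uniform_0 by blast
    show "\<forall>\<nu>. uniform k n 1 \<nu> \<longrightarrow> \<nu> = return (Bbar k n) (\<lambda>_. \<Delta>)"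
      using uniform_unique uniform_1 by blast
  qed (use lt lt' eq1 eq2 uniform_q_bdry in blast)+
qed

end

section \<open>From an automaton to the Garside properties\<close>

lemma (in germ0) atom_state:
  assumes "s \<in> \<Sigma>"
  shows "\<exists>j\<in>S. rd [s] j = Some e \<and> s \<in> D j \<and> (\<forall>x\<in>S. s \<in> D x \<longrightarrow> le j x)"
proof -
  have "D e = {}" using D_empty e_S by blast
  then obtain j where "j \<in> S" "s \<in> D j" "q s j = e" using prefix[OF e_S assms] by auto
  then show ?thesis unfolding le_def by (intro bexI[of _ j]) (auto intro!: exI[of _ "[s]"])
qed

lemma (in germ) garsideI:
  assumes mix: "\<And>s. s \<in> \<Sigma> \<Longrightarrow> \<exists>x z. x \<in> S \<and> rd [s] x = Some e \<and>
    (x, z) \<in> {(x, y). x \<in> S \<and> y \<in> S \<and> D y \<inter> D (K x) = {}}\<^sup>* \<and> card (D (K z)) \<le> 1"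
  shows "garside k n"
proof
  show "a = b" if "x \<in> M" "a \<in> M" "b \<in> M" "x \<odot> a = x \<odot> b" for x a b using left_cancel that by blast
  show "b \<in> Simples k n" if "a \<in> M" "b \<in> M" "a \<odot> b \<in> Simples k n" for a b
    using P_factors that unfolding Simples_eq by blast
  show "\<exists>j\<in>Simples k n. a \<preceq> j \<and> b \<preceq> j \<and> (\<forall>m\<in>M. a \<preceq> m \<longrightarrow> b \<preceq> m \<longrightarrow> j \<preceq> m)"
    if "a \<in> Simples k n" "b \<in> Simples k n" for a b
  proof -
    have ab: "a \<in> rr ` S" "b \<in> rr ` S" using that unfolding Simples_eq by auto
    then obtain j where j: "lub a b j" using P_lub by blast
    then show ?thesis using lub_M[OF ab j] unfolding lub_def Simples_eq by blast
  qed
  show "DeltaX k n X \<in> M" if "X \<subseteq> \<Sigma>" for X using DeltaX_spec[OF that] by simp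
  show "DeltaX k n X \<preceq> m \<longleftrightarrow> (\<forall>s\<in>X. g s \<preceq> m)" if "X \<subseteq> \<Sigma>" "m \<in> M" for X m
    using DeltaX_spec[OF that(1)] that(2) by blast
  show "s = t" if "s \<in> \<Sigma>" "t \<in> \<Sigma>" "g s \<odot> Delta k n = g t \<odot> Delta k n" for s t
    using \<phi>_inj that unfolding Delta_eq by blast
  show "\<exists>z. (g s, z) \<in> {(x, y). x \<in> Simples k n \<and> y \<in> Simples k n \<and> arrow k n x y}\<^sup>* \<and> card (\<Sigma> - Rset k n z) \<le> 1"
    if s: "s \<in> \<Sigma>" for s
  proof -
    obtain x z where x: "x \<in> S" "rd [s] x = Some e" and z: "card (D (K z)) \<le> 1"
      and path: "(x, z) \<in> {(x, y). x \<in> S \<and> y \<in> S \<and> D y \<inter> D (K x) = {}}\<^sup>*" using mix[OF s] by blast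
    have gs: "rr x = g s" using rr_eq[OF x] by (simp add: gel_def)
    from path have "z \<in> S \<and> (rr x, rr z) \<in> {(x, y). x \<in> Simples k n \<and> y \<in> Simples k n \<and> arrow k n x y}\<^sup>*"
    proof (induction rule: rtrancl_induct)
      case base
      then show ?case using x by simp
    next
      case (step y z)
      then have "(rr y, rr z) \<in> {(x, y). x \<in> Simples k n \<and> y \<in> Simples k n \<and> arrow k n x y}"
        using arrow_rr unfolding Simples_eq by auto
      then show ?case using step by (auto intro: rtrancl_into_rtrancl)
    qed
    moreover from this have "\<Sigma> - Rset k n (rr z) = D (K z)"
      using Rset_rr rr_complement D_sub by blast
    ultimately show ?thesis using z gs by (intro exI[of _ "rr z"]) simp
  qed
qed

section \<open>The positive braid monoid\<close>

text \<open>A permutation braid is represented by the inverse of its permutation, so that dividing by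
  \<open>\<sigma>\<^sub>i\<close> swaps the values at the positions \<open>i\<close> and \<open>i + 1\<close>.\<close>

definition desc :: "nat \<Rightarrow> (nat \<Rightarrow> nat) \<Rightarrow> gen set" where
  "desc n f = {(i, i + 1) | i. 1 \<le> i \<and> i + 1 \<le> n \<and> f (i + 1) < f i}"

definition swp :: "gen \<Rightarrow> (nat \<Rightarrow> nat) \<Rightarrow> nat \<Rightarrow> nat" where
  "swp s f = f \<circ> Transposition.transpose (fst s) (snd s)"

text \<open>The longest permutation, which represents \<open>\<Delta>\<close>.\<close>

definition rv :: "nat \<Rightarrow> nat \<Rightarrow> nat" where
  "rv n i = (if 1 \<le> i \<and> i \<le> n then n + 1 - i else i)"

lemma desc_iff: "(i, j) \<in> desc n f \<longleftrightarrow> j = Suc i \<and> 1 \<le> i \<and> Suc i \<le> n \<and> f (Suc i) < f i"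
  by (auto simp: desc_def)

lemma gens_Artin_iff: "(i, j) \<in> gens Artin n \<longleftrightarrow> j = Suc i \<and> 1 \<le> i \<and> Suc i \<le> n"
  by (auto simp: gens_def)

lemma permutesI_inverse:
  assumes "\<And>x. x \<notin> A \<Longrightarrow> f x = x" "\<And>x. h (f x) = x" "\<And>x. f (h x) = x"
  shows "f permutes A" "inv f = h"
proof -
  have "\<exists>!x. f x = y" for y using assms(2,3) by metis
  then show "f permutes A" unfolding permutes_def using assms(1) by blast
  show "inv f = h" by (rule inv_unique_comp) (auto simp: fun_eq_iff assms)
qed

lemma rv_rv [simp]: "rv n (rv n i) = i" by (auto simp: rv_def)

lemma rv_permutes: "rv n permutes {1..n}" and inv_rv: "inv (rv n) = rv n"
proof -
  have "rv n x = x" if "x \<notin> {1..n}" for x using that by (auto simp: rv_def)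
  note * = permutesI_inverse[OF this rv_rv rv_rv]
  show "rv n permutes {1..n}" by (rule *(1))
  show "inv (rv n) = rv n" by (rule *(2))
qed

lemma swp_permutes: "f permutes {1..n} \<Longrightarrow> 1 \<le> i \<Longrightarrow> Suc i \<le> n \<Longrightarrow> swp (i, Suc i) f permutes {1..n}"
  unfolding swp_def by (intro permutes_compose permutes_swap_id) auto

lemma swp_swp [simp]: "swp s (swp s f) = f"
  by (auto simp: swp_def fun_eq_iff)

lemma increasing_permutation:
  assumes f: "f permutes {1..n}" and inc: "\<And>i. 1 \<le> i \<Longrightarrow> Suc i \<le> n \<Longrightarrow> f i < f (Suc i)"
  shows "f = id"
proof (rule permutes_natset_ge[OF f], rule ballI)
  fix i assume "i \<in> {1..n}"
  then have "1 \<le> i" "i \<le> n" by auto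
  then show "i \<le> f i"
  proof (induction i rule: dec_induct)
    case base
    then show ?case using permutes_in_image[OF f, of 1] by auto
  next
    case (step i)
    then show ?case using inc[of i] by simp
  qed
qed

text \<open>A run multiplies on the right by transpositions that do not depend on the start, whence
  the formula. The moves stay legal from \<open>h\<close> because its inversions include those of
  \<open>f\<close>, a property that survives each swap.\<close>

lemma run_swp:
  assumes "f permutes {1..n}" "h permutes {1..n}" "run (desc n) swp w f = Some f'"
    and "\<And>a b. 1 \<le> a \<Longrightarrow> a < b \<Longrightarrow> b \<le> n \<Longrightarrow> f b < f a \<Longrightarrow> h b < h a"
  shows "run (desc n) swp w h = Some (h \<circ> inv f \<circ> f')"
  using assms
proof (induction w arbitrary: f h)
  case Nil
  have "h \<circ> inv f \<circ> f = h" using permutes_inv_o(2)[OF Nil.prems(1)] by (simp add: comp_assoc)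
  moreover have "f' = f" using Nil.prems(3) by simp
  ultimately show ?case by (simp only: run.simps)
next
  case (Cons s w)
  obtain i where s: "s = (i, Suc i)" "1 \<le> i" "Suc i \<le> n" "f (Suc i) < f i"
    and run: "run (desc n) swp w (swp s f) = Some f'"
    using Cons.prems(3) by (cases s) (auto simp: desc_iff split: if_splits)
  have h: "s \<in> desc n h" using Cons.prems(4)[of i "Suc i"] s by (simp add: desc_iff)
  let ?t = "Transposition.transpose i (Suc i)"
  have "run (desc n) swp w (swp s h) = Some (swp s h \<circ> inv (swp s f) \<circ> f')"
  proof (rule Cons.IH[OF _ _ run])
    show "swp s f permutes {1..n}" "swp s h permutes {1..n}" using swp_permutes Cons.prems(1,2) s by auto
    fix a b assume ab: "1 \<le> a" "a < b" "b \<le> n" "swp s f b < swp s f a"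
    show "swp s h b < swp s h a"
    proof (cases "a = i \<and> b = Suc i")
      case True
      then show ?thesis using ab s by (simp add: swp_def)
    next
      case False
      have "1 \<le> ?t a" "?t a < ?t b" "?t b \<le> n" using False ab s by (auto simp: Transposition.transpose_def)
      then show ?thesis using Cons.prems(4)[of "?t a" "?t b"] ab s by (simp add: swp_def)
    qed
  qed
  then have run': "run (desc n) swp (s # w) h = Some (swp s h \<circ> inv (swp s f) \<circ> f')" using h by simp
  have "inv (swp s f) = ?t \<circ> inv f"
    using o_inv_distrib[OF permutes_bij[OF Cons.prems(1)] bij_transpose, of i "Suc i"]
    by (simp add: swp_def s inv_transpose_eq)
  then have "swp s h \<circ> inv (swp s f) \<circ> f' = h \<circ> inv f \<circ> f'" by (simp add: swp_def s fun_eq_iff)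
  then show ?case using run' by (simp only:)
qed

text \<open>The rank is a convenient substitute for the number of inversions: a swap at a descent
  moves the larger value to the position with the smaller weight, so the weighted sum drops.\<close>

lemma Artin_germ0:
  "germ0 Artin n {f. f permutes {1..n}} (desc n) swp id (rv n) (\<lambda>f. \<Sum>i\<in>{1..n}. (n - i) * f i) (\<lambda>f. rv n \<circ> inv f)"
proof
  show "id \<in> {f. f permutes {1..n}}" "rv n \<in> {f. f permutes {1..n}}"
    using permutes_id rv_permutes by auto
next
  fix f show "desc n f \<subseteq> gens Artin n" by (auto simp: desc_iff gens_Artin_iff)
next
  fix s f assume f: "f \<in> {f. f permutes {1..n}}" and s: "s \<in> desc n f"
  obtain i where i: "s = (i, Suc i)" "1 \<le> i" "Suc i \<le> n" "f (Suc i) < f i"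
    using s by (cases s) (auto simp: desc_iff)
  show "swp s f \<in> {f. f permutes {1..n}}" using swp_permutes f i by auto
  have eq: "{1..n} = insert i (insert (Suc i) ({1..n} - {i, Suc i}))" using i by auto
  have split: "(\<Sum>j\<in>{1..n}. (n - j) * h j) =
      (n - i) * h i + ((n - Suc i) * h (Suc i) + (\<Sum>j\<in>{1..n} - {i, Suc i}. (n - j) * h j))" for h :: "nat \<Rightarrow> nat"
    by (subst eq) simp
  have rest: "(\<Sum>j\<in>{1..n} - {i, Suc i}. (n - j) * swp s f j) = (\<Sum>j\<in>{1..n} - {i, Suc i}. (n - j) * f j)"
    by (rule sum.cong) (auto simp: swp_def i)
  have "n - i = Suc (n - Suc i)" using i by simp
  then show "(\<Sum>i\<in>{1..n}. (n - i) * swp s f i) < (\<Sum>i\<in>{1..n}. (n - i) * f i)"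
    unfolding split rest using i by (simp add: swp_def)
next
  fix f assume f: "f \<in> {f. f permutes {1..n}}"
  show "desc n f = {} \<longleftrightarrow> f = id"
  proof
    assume e: "desc n f = {}"
    show "f = id"
    proof (rule increasing_permutation)
      fix i assume i: "1 \<le> i" "Suc i \<le> n"
      then have "\<not> f (Suc i) < f i" using e desc_iff by blast
      moreover have "f i \<noteq> f (Suc i)" using injD[OF permutes_inj, of f "{1..n}" i "Suc i"] f by auto
      ultimately show "f i < f (Suc i)" by simp
    qed (use f in simp)
  qed (auto simp: desc_def)
next
  show "desc n (rv n) = gens Artin n" by (auto simp: desc_iff gens_Artin_iff rv_def)
next
  fix f assume f: "f \<in> {f. f permutes {1..n}}" and D: "desc n f = gens Artin n"
  have "rv n \<circ> f = id"
  proof (rule increasing_permutation)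
    show "rv n \<circ> f permutes {1..n}" using f rv_permutes by (intro permutes_compose) auto
    fix i assume i: "1 \<le> i" "Suc i \<le> n"
    then have "(i, Suc i) \<in> desc n f" unfolding D by (simp add: gens_Artin_iff)
    then have "f (Suc i) < f i" by (simp add: desc_iff)
    moreover have "f i \<in> {1..n}" "f (Suc i) \<in> {1..n}"
      using permutes_in_image[of f "{1..n}" i] permutes_in_image[of f "{1..n}" "Suc i"] f i by simp_all
    ultimately show "(rv n \<circ> f) i < (rv n \<circ> f) (Suc i)" by (auto simp: rv_def)
  qed
  then show "f = rv n" by (metis comp_apply id_apply rv_rv ext)
next
  fix s f assume f: "f \<in> {f. f permutes {1..n}}" and s: "s \<in> gens Artin n" and D: "desc n f \<subseteq> desc n (swp s (rv n))"
  obtain i where i: "s = (i, Suc i)" "1 \<le> i" "Suc i \<le> n" using s by (cases s) (auto simp: gens_Artin_iff)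
  have "s \<notin> desc n (swp s (rv n))" using i by (auto simp: desc_iff swp_def rv_def)
  then have "\<not> f (Suc i) < f i" using D i desc_iff by blast
  moreover have "f i \<noteq> f (Suc i)" using injD[OF permutes_inj, of f "{1..n}" i "Suc i"] f by auto
  ultimately have "s \<in> desc n (swp s f)" using i by (simp add: desc_iff swp_def)
  then show "\<exists>h\<in>{f. f permutes {1..n}}. s \<in> desc n h \<and> swp s h = f"
    using swp_permutes f i by (intro bexI[of _ "swp s f"]) auto
next
  fix u v f assume "(u, v) \<in> rels Artin n" "f \<in> {f. f permutes {1..n}}"
  then show "run (desc n) swp u f = run (desc n) swp v f"
    unfolding rels_def mkind.case
  proof (elim UnE)
    assume "(u, v) \<in> {([(i, i+1), (j, j+1)], [(j, j+1), (i, i+1)]) | i j.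
            1 \<le> i \<and> i < n \<and> 1 \<le> j \<and> j < n \<and> (i + 2 \<le> j \<or> j + 2 \<le> i)}"
    then obtain i j where uv: "u = [(i, Suc i), (j, Suc j)]" "v = [(j, Suc j), (i, Suc i)]"
      and ij: "1 \<le> i" "i < n" "1 \<le> j" "j < n" "i + 2 \<le> j \<or> j + 2 \<le> i" by auto
    have "swp (j, Suc j) (swp (i, Suc i) f) = swp (i, Suc i) (swp (j, Suc j) f)"
      using ij by (auto simp: swp_def fun_eq_iff Transposition.transpose_def)
    then show ?thesis unfolding uv using ij by (auto simp: desc_iff swp_def Transposition.transpose_def)
  next
    assume "(u, v) \<in> {([(i, i+1), (j, j+1), (i, i+1)], [(j, j+1), (i, i+1), (j, j+1)]) | i j.
            1 \<le> i \<and> i < n \<and> 1 \<le> j \<and> j < n \<and> (i = j + 1 \<or> j = i + 1)}"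
    then obtain i j where uv: "u = [(i, Suc i), (j, Suc j), (i, Suc i)]" "v = [(j, Suc j), (i, Suc i), (j, Suc j)]"
      and ij: "1 \<le> i" "i < n" "1 \<le> j" "j < n" "i = j + 1 \<or> j = i + 1" by auto
    have "swp (i, Suc i) (swp (j, Suc j) (swp (i, Suc i) f)) = swp (j, Suc j) (swp (i, Suc i) (swp (j, Suc j) f))"
      using ij by (auto simp: swp_def fun_eq_iff Transposition.transpose_def)
    then show ?thesis unfolding uv using ij by (auto simp: desc_iff swp_def Transposition.transpose_def)
  qed
next
  fix s t u v f assume "(s # u, t # v) \<in> rels Artin n" "s \<in> desc n f" "t \<in> desc n f"
  then show "run (desc n) swp (s # u) f \<noteq> None"
    unfolding rels_def mkind.case by (elim UnE) (auto simp: desc_iff swp_def Transposition.transpose_def)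
next
  fix s t f assume s: "s \<in> desc n f" and t: "t \<in> desc n f"
  obtain i where i: "s = (i, Suc i)" "1 \<le> i" "Suc i \<le> n" using s by (cases s) (auto simp: desc_iff)
  obtain j where j: "t = (j, Suc j)" "1 \<le> j" "Suc j \<le> n" using t by (cases t) (auto simp: desc_iff)
  \<comment> \<open>Any two distinct generators head a relation, so the chain has at most one
    link.\<close>
  have "\<exists>u v. (s # u, t # v) \<in> rels Artin n" if "i \<noteq> j"
  proof (cases "i + 2 \<le> j \<or> j + 2 \<le> i")
    case True
    then have "(s # [t], t # [s]) \<in> rels Artin n" unfolding rels_def using i j by auto
    then show ?thesis by blast
  next
    case False
    then have "(s # [t, s], t # [s, t]) \<in> rels Artin n" unfolding rels_def using i j that by auto
    then show ?thesis by blast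
  qed
  then show "(s, t) \<in> {(a, b). a \<in> desc n f \<and> b \<in> desc n f \<and>
      (\<exists>u v. (a # u, b # v) \<in> rels Artin n \<or> (b # v, a # u) \<in> rels Artin n)}\<^sup>*"
    using s t i j by (cases "i = j") (auto intro!: r_into_rtrancl)
next
  fix w f assume "f \<in> {f. f permutes {1..n}}" "run (desc n) swp w f = Some id"
  then show "run (desc n) swp w (rv n) = Some (rv n \<circ> inv f)"
    using run_swp[of f n "rv n" w id] rv_permutes by (auto simp: rv_def)
next
  fix s t assume st: "s \<in> gens Artin n" "t \<in> gens Artin n"
    "desc n (rv n \<circ> inv (swp s (rv n))) \<inter> desc n (rv n \<circ> inv (swp t (rv n))) \<noteq> {}"
  \<comment> \<open>Conjugation by \<open>\<Delta>\<close> exchanges the generators of index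
    \<open>i\<close> and \<open>n - i\<close>; the latter is the only possible descent here.\<close>
  have *: "a = n - i" if s: "s = (i, Suc i)" "1 \<le> i" "Suc i \<le> n"
    and a: "(a, b) \<in> desc n (rv n \<circ> inv (swp s (rv n)))" for s i a b
  proof -
    have "inv (swp s (rv n)) = Transposition.transpose i (Suc i) \<circ> rv n"
      using o_inv_distrib[OF permutes_bij[OF rv_permutes] bij_transpose, of n i "Suc i"]
      by (simp add: swp_def s inv_transpose_eq inv_rv)
    then have lt: "rv n (Transposition.transpose i (Suc i) (rv n (Suc a))) < rv n (Transposition.transpose i (Suc i) (rv n a))"
      and a1: "1 \<le> a" "Suc a \<le> n" using a by (auto simp: desc_iff)
    define b where "b = n - a"
    let ?t = "Transposition.transpose i (Suc i)"
    have b: "rv n (Suc a) = b" "rv n a = Suc b" "1 \<le> b" "Suc b \<le> n" using a1 by (auto simp: rv_def b_def)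
    have "b = i"
    proof (rule ccontr)
      assume "b \<noteq> i"
      then have "1 \<le> ?t b" "?t b < ?t (Suc b)" "?t (Suc b) \<le> n" using b s by (auto simp: Transposition.transpose_def)
      then have "rv n (?t (Suc b)) < rv n (?t b)" by (simp add: rv_def)
      then show False using lt b by simp
    qed
    then show ?thesis using a1 unfolding b_def by simp
  qed
  obtain i where i: "s = (i, Suc i)" "1 \<le> i" "Suc i \<le> n" using st by (cases s) (auto simp: gens_Artin_iff)
  obtain j where j: "t = (j, Suc j)" "1 \<le> j" "Suc j \<le> n" using st by (cases t) (auto simp: gens_Artin_iff)
  obtain a b where "(a, b) \<in> desc n (rv n \<circ> inv (swp s (rv n)))" "(a, b) \<in> desc n (rv n \<circ> inv (swp t (rv n)))"
    using st(3) by fast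
  then have "n - i = n - j" using *[OF i] *[OF j] by simp
  then show "s = t" using i j by simp
qed

text \<open>Distinct generators always head a relation, whose common value is their join by
  \<open>rel_state\<close>.\<close>

lemma Artin_germ:
  "germ Artin n {f. f permutes {1..n}} (desc n) swp id (rv n) (\<lambda>f. \<Sum>i\<in>{1..n}. (n - i) * f i) (\<lambda>f. rv n \<circ> inv f)"
proof -
  interpret germ0 Artin n "{f. f permutes {1..n}}" "desc n" swp id "rv n" "\<lambda>f. \<Sum>i\<in>{1..n}. (n - i) * f i" "\<lambda>f. rv n \<circ> inv f"
    by (rule Artin_germ0)
  show ?thesis
  proof
    fix s t assume st: "s \<in> \<Sigma>" "t \<in> \<Sigma>"
    show "\<exists>j\<in>{f. f permutes {1..n}}. s \<in> desc n j \<and> t \<in> desc n j \<and>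
        (\<forall>x\<in>{f. f permutes {1..n}}. s \<in> desc n x \<longrightarrow> t \<in> desc n x \<longrightarrow> le j x)"
    proof (cases "s = t")
      case True
      then show ?thesis using atom_state[OF st(1)] by blast
    next
      case False
      obtain i where i: "s = (i, Suc i)" "1 \<le> i" "Suc i \<le> n" using st by (cases s) (auto simp: gens_Artin_iff)
      obtain j where j: "t = (j, Suc j)" "1 \<le> j" "Suc j \<le> n" using st by (cases t) (auto simp: gens_Artin_iff)
      show ?thesis
      proof (cases "i + 2 \<le> j \<or> j + 2 \<le> i")
        case True
        then have "(s # [t], t # [s]) \<in> rels Artin n" unfolding rels_def using i j by auto
        then show ?thesis using rel_state by blast
      next
        case nf: False
        then have "(s # [t, s], t # [s, t]) \<in> rels Artin n" unfolding rels_def using i j False by auto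
        then show ?thesis using rel_state by blast
      qed
    qed
  qed
qed

section \<open>Paths of arrows between permutation braids\<close>

lemma desc_compl: assumes "f permutes {1..n}"
  shows "desc n (rv n \<circ> inv f) = {(i, i + 1) | i. 1 \<le> i \<and> i + 1 \<le> n \<and> inv f i < inv f (i + 1)}"
proof -
  have "inv f i \<in> {1..n}" if "i \<in> {1..n}" for i
    using permutes_in_image[OF permutes_inv[OF assms], of i] that by simp
  then have "rv n (inv f (i + 1)) < rv n (inv f i) \<longleftrightarrow> inv f i < inv f (i + 1)" if "1 \<le> i" "i + 1 \<le> n" for i
    using that by (fastforce simp: rv_def)
  then show ?thesis unfolding desc_def by auto
qed

lemma Artin_garside: assumes "n \<ge> 2" shows "garside Artin n"
proof -
  interpret germ Artin n "{f. f permutes {1..n}}" "desc n" swp id "rv n" "\<lambda>f. \<Sum>i\<in>{1..n}. (n - i) * f i" "\<lambda>f. rv n \<circ> inv f"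
    by (rule Artin_germ)
  let ?R = "{(x, y). x \<in> {f. f permutes {1..n}} \<and> y \<in> {f. f permutes {1..n}} \<and> desc n y \<inter> desc n (rv n \<circ> inv x) = {}}"
  \<comment> \<open>The descents of the complement of \<open>f\<close> are the ascents of
    \<open>inv f\<close>, so an arrow asks that every descent of \<open>h\<close> be one of
    \<open>inv f\<close>.\<close>
  have arr: "(f, h) \<in> ?R" if "f permutes {1..n}" "h permutes {1..n}" "inv f = f'"
    "\<And>i. 1 \<le> i \<Longrightarrow> Suc i \<le> n \<Longrightarrow> h (Suc i) < h i \<Longrightarrow> f' (Suc i) < f' i" for f h f'
  proof -
    have "desc n h \<inter> desc n (rv n \<circ> inv f) = {}"
      using desc_compl[OF that(1)] that(4) unfolding that(3) by (force simp: desc_def)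
    then show ?thesis using that(1,2) by simp
  qed
  let ?t = "\<lambda>i. Transposition.transpose i (Suc i)"
  have tp: "?t i permutes {1..n}" if "1 \<le> i" "Suc i \<le> n" for i
    using permutes_swap_id[of i "{1..n}" "Suc i"] that by simp
  have tt: "?t i \<circ> ?t j permutes {1..n}" if "1 \<le> i" "Suc i \<le> n" "1 \<le> j" "Suc j \<le> n" for i j
    using permutes_compose[OF tp tp] that by blast
  have it: "inv (?t i \<circ> ?t j) = ?t j \<circ> ?t i" for i j
    by (simp add: o_inv_distrib inv_transpose_eq)
  \<comment> \<open>Neighbouring generators are linked through their product.\<close>
  have up: "(?t i, ?t (Suc i)) \<in> ?R\<^sup>*" if i: "1 \<le> i" "Suc (Suc i) \<le> n" for i
  proof -
    have "(?t i, ?t (Suc i) \<circ> ?t i) \<in> ?R"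
      by (rule arr[OF tp tt inv_transpose_eq]) (use i in \<open>auto simp: Transposition.transpose_def split: if_splits\<close>)
    moreover have "(?t (Suc i) \<circ> ?t i, ?t (Suc i)) \<in> ?R"
      by (rule arr[OF tt tp it]) (use i in \<open>auto simp: Transposition.transpose_def split: if_splits\<close>)
    ultimately show ?thesis by (meson converse_rtrancl_into_rtrancl r_into_rtrancl)
  qed
  have down: "(?t (Suc i), ?t i) \<in> ?R\<^sup>*" if i: "1 \<le> i" "Suc (Suc i) \<le> n" for i
  proof -
    have "(?t (Suc i), ?t i \<circ> ?t (Suc i)) \<in> ?R"
      by (rule arr[OF tp tt inv_transpose_eq]) (use i in \<open>auto simp: Transposition.transpose_def split: if_splits\<close>)
    moreover have "(?t i \<circ> ?t (Suc i), ?t i) \<in> ?R"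
      by (rule arr[OF tt tp it]) (use i in \<open>auto simp: Transposition.transpose_def split: if_splits\<close>)
    ultimately show ?thesis by (meson converse_rtrancl_into_rtrancl r_into_rtrancl)
  qed
  have ups: "(?t i, ?t j) \<in> ?R\<^sup>*" if "i \<le> j" "1 \<le> i" "Suc j \<le> n" for i j
    using that
  proof (induction rule: dec_induct)
    case (step j)
    then show ?case using up[of j] by (meson Suc_leD order_trans rtrancl_trans)
  qed simp
  have downs: "(?t j, ?t i) \<in> ?R\<^sup>*" if "i \<le> j" "1 \<le> i" "Suc j \<le> n" for i j
    using that
  proof (induction rule: dec_induct)
    case (step j)
    then show ?case using down[of j] by (meson Suc_leD order_trans rtrancl_trans)
  qed simp
  define m where "m = n div 2"
  have m: "1 \<le> m" "Suc m \<le> n" "2 * m \<le> n" "n \<le> 2 * m + 1" using assms unfolding m_def by auto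
  \<comment> \<open>\<open>f2\<close> descends only at \<open>m\<close>, while its inverse
    \<open>y2\<close> descends at every odd position. \<open>f3\<close> descends exactly at the odd
    positions, and its inverse \<open>y3\<close> descends everywhere except possibly at
    \<open>m\<close>, so at most one atom extends \<open>f3\<close>.\<close>
  define f2 where "f2 v = (if 1 \<le> v \<and> v \<le> n then if v \<le> m then 2 * v else 2 * (v - m) - 1 else v)" for v
  define y2 where "y2 v = (if 1 \<le> v \<and> v \<le> n then if even v then v div 2 else m + (v + 1) div 2 else v)" for v
  define f3 where "f3 v = (if 1 \<le> v \<and> v \<le> n then if even v then m + 1 - v div 2 else n + 1 - (v + 1) div 2 else v)" for v
  define y3 where "y3 v = (if 1 \<le> v \<and> v \<le> n then if v \<le> m then 2 * (m + 1 - v) else 2 * (n + 1 - v) - 1 else v)" for v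
  have 2: "y2 (f2 v) = v" "f2 (y2 v) = v" for v
    using m unfolding f2_def y2_def by (auto elim!: evenE oddE)
  have 3: "y3 (f3 v) = v" "f3 (y3 v) = v" for v
    using m unfolding f3_def y3_def by (auto elim!: evenE oddE)
  have f2: "f2 permutes {1..n}" "inv f2 = y2" 
  proof -
    have "f2 x = x" if "x \<notin> {1..n}" for x using that by (auto simp: f2_def)
    note * = permutesI_inverse[OF this 2]
    show "f2 permutes {1..n}" by (rule *(1))
  show "inv f2 = y2" by (rule *(2))
  qed
  have f3: "f3 permutes {1..n}" "inv f3 = y3" 
  proof -
    have "f3 x = x" if "x \<notin> {1..n}" for x using that by (auto simp: f3_def)
    note * = permutesI_inverse[OF this 3]
    show "f3 permutes {1..n}" by (rule *(1))
  show "inv f3 = y3" by (rule *(2))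
  qed
  have "(?t m, f2) \<in> ?R"
    by (rule arr[OF tp f2(1) inv_transpose_eq]) (use m in \<open>auto simp: f2_def Transposition.transpose_def split: if_splits\<close>)
  moreover have "(f2, f3) \<in> ?R"
    by (rule arr[OF f2(1) f3(1) f2(2)]) (use m in \<open>auto simp: f3_def y2_def elim!: evenE oddE split: if_splits\<close>)
  ultimately have last: "(?t m, f3) \<in> ?R\<^sup>*" by (meson converse_rtrancl_into_rtrancl r_into_rtrancl)
  have "desc n (rv n \<circ> inv f3) \<subseteq> {(m, m + 1)}"
  proof
    fix s assume "s \<in> desc n (rv n \<circ> inv f3)"
    then obtain i where i: "s = (i, i + 1)" "1 \<le> i" "i + 1 \<le> n" "y3 i < y3 (i + 1)"
      using desc_compl[OF f3(1)] unfolding f3(2) by blast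
    then have "i = m" unfolding y3_def by (auto split: if_splits)
    then show "s \<in> {(m, m + 1)}" using i by simp
  qed
  then have card: "card (desc n (rv n \<circ> inv f3)) \<le> 1" using card_mono[of "{(m, m + 1)}"] by fastforce
  show ?thesis
  proof (rule garsideI)
    fix s assume "s \<in> \<Sigma>"
    then obtain i where i: "s = (i, Suc i)" "1 \<le> i" "Suc i \<le> n" by (cases s) (auto simp: gens_Artin_iff)
    have "(?t i, ?t m) \<in> ?R\<^sup>*" using ups[of i m] downs[of m i] i m by (cases "i \<le> m") auto
    then have "(?t i, f3) \<in> ?R\<^sup>*" using last by (rule rtrancl_trans)
    moreover have "run (desc n) swp [s] (?t i) = Some id" using i by (auto simp: desc_iff swp_def fun_eq_iff)
    ultimately show "\<exists>x z. x \<in> {f. f permutes {1..n}} \<and> run (desc n) swp [s] x = Some id \<and> (x, z) \<in> ?R\<^sup>* \<and>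
        card (desc n (rv n \<circ> inv z)) \<le> 1"
      using card tp[OF i(2,3)] by blast
  qed
qed

section \<open>The dual braid monoid\<close>

text \<open>A simple element is represented by the set of pairs \<open>(i, j)\<close> with \<open>i < j\<close> in a common block of its
  noncrossing partition. Dividing by \<open>\<sigma>\<^sub>i\<^sub>j\<close> keeps the pairs lying on one side of the chord from \<open>i\<close> to
  \<open>j\<close>, where a point \<open>a\<close> of the complement is placed between \<open>a\<close> and \<open>a + 1\<close>.\<close>

definition blk :: "gen set \<Rightarrow> nat \<Rightarrow> nat \<Rightarrow> bool" where
  "blk X a b \<longleftrightarrow> a = b \<or> (a, b) \<in> X \<or> (b, a) \<in> X"

definition NC :: "nat \<Rightarrow> gen set set" where
  "NC n = {X. X \<subseteq> gens Dual n \<and> (\<forall>a b c. blk X a b \<longrightarrow> blk X b c \<longrightarrow> blk X a c) \<and>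
    (\<forall>i j k l. i < j \<longrightarrow> j < k \<longrightarrow> k < l \<longrightarrow> blk X i k \<longrightarrow> blk X j l \<longrightarrow> blk X i j)}"

definition sd :: "gen \<Rightarrow> gen set" where
  "sd s = {(a, b). (fst s \<le> a \<and> a < snd s) = (fst s \<le> b \<and> b < snd s)}"

definition cut :: "gen \<Rightarrow> gen set \<Rightarrow> gen set" where "cut s X = X \<inter> sd s"

text \<open>The Kreweras complement: the shifted chords crossing no chord of
  \<open>X\<close>.\<close>

definition kr :: "nat \<Rightarrow> gen set \<Rightarrow> gen set" where "kr n X = {t \<in> gens Dual n. \<forall>s\<in>X. t \<in> sd s}"

lemma gens_Dual_iff: "(i, j) \<in> gens Dual n \<longleftrightarrow> 1 \<le> i \<and> i < j \<and> j \<le> n"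
  by (auto simp: gens_def)

lemma sd_iff: "(a, b) \<in> sd (i, j) \<longleftrightarrow> (i \<le> a \<and> a < j) = (i \<le> b \<and> b < j)"
  by (simp add: sd_def)

lemma blk_refl [simp]: "blk X a a" and blk_sym: "blk X a b \<Longrightarrow> blk X b a"
  by (auto simp: blk_def)

lemma NC_sub: "X \<in> NC n \<Longrightarrow> X \<subseteq> gens Dual n"
  and NC_trans: "X \<in> NC n \<Longrightarrow> blk X a b \<Longrightarrow> blk X b c \<Longrightarrow> blk X a c"
  and NC_cross: "X \<in> NC n \<Longrightarrow> i < j \<Longrightarrow> j < k \<Longrightarrow> k < l \<Longrightarrow> blk X i k \<Longrightarrow> blk X j l \<Longrightarrow> blk X i j"
  unfolding NC_def by blast+

lemma NC_less: "X \<in> NC n \<Longrightarrow> (a, b) \<in> X \<Longrightarrow> 1 \<le> a \<and> a < b \<and> b \<le> n"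
  using NC_sub gens_Dual_iff by blast

lemma NC_blk: "X \<in> NC n \<Longrightarrow> a < b \<Longrightarrow> blk X a b \<longleftrightarrow> (a, b) \<in> X"
  using NC_less unfolding blk_def by fastforce

lemma NC_finite: "X \<in> NC n \<Longrightarrow> finite X"
  using NC_sub finite_gens finite_subset by blast

lemma NCI:
  assumes "X \<subseteq> gens Dual n" "\<And>a b c. blk X a b \<Longrightarrow> blk X b c \<Longrightarrow> blk X a c"
    "\<And>i j k l. i < j \<Longrightarrow> j < k \<Longrightarrow> k < l \<Longrightarrow> blk X i k \<Longrightarrow> blk X j l \<Longrightarrow> blk X i j"
  shows "X \<in> NC n"
  using assms unfolding NC_def by blast

lemma blk_cut: "blk (cut s X) a b \<longleftrightarrow> blk X a b \<and> (fst s \<le> a \<and> a < snd s) = (fst s \<le> b \<and> b < snd s)"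
  by (auto simp: blk_def cut_def sd_def)

lemma cut_NC: assumes "X \<in> NC n" shows "cut s X \<in> NC n"
proof (rule NCI)
  show "cut s X \<subseteq> gens Dual n" using NC_sub[OF assms] unfolding cut_def by blast
  show "blk (cut s X) a c" if "blk (cut s X) a b" "blk (cut s X) b c" for a b c
    using that NC_trans[OF assms] unfolding blk_cut by blast
  show "blk (cut s X) i j" if "i < j" "j < k" "k < l" "blk (cut s X) i k" "blk (cut s X) j l" for i j k l
    using that NC_cross[OF assms that(1-3)] unfolding blk_cut by auto
qed

lemma gens_NC: "gens Dual n \<in> NC n"
  by (rule NCI) (auto simp: blk_def gens_Dual_iff)

lemma empty_NC: "{} \<in> NC n"
  by (rule NCI) (auto simp: blk_def)

text \<open>Closure under intersection is the source of joins: two atoms lie in a least noncrossing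
  partition.\<close>

lemma Inter_NC: assumes "F \<subseteq> NC n" "F \<noteq> {}" shows "\<Inter>F \<in> NC n"
proof -
  have b: "blk (\<Inter>F) a b \<longleftrightarrow> (\<forall>X\<in>F. blk X a b)" for a b
  proof (cases a b rule: linorder_cases)
    case less
    then have "(b, a) \<notin> X" if "X \<in> F" for X using NC_less[of X n b a] that assms(1) by auto
    then show ?thesis using less assms(2) unfolding blk_def by auto
  next
    case greater
    then have "(a, b) \<notin> X" if "X \<in> F" for X using NC_less[of X n a b] that assms(1) by auto
    then show ?thesis using greater assms(2) unfolding blk_def by auto
  qed simp
  show ?thesis
  proof (rule NCI)
    show "\<Inter>F \<subseteq> gens Dual n" using assms NC_sub by blast
    show "blk (\<Inter>F) a c" if "blk (\<Inter>F) a b" "blk (\<Inter>F) b c" for a b c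
      using that assms(1) NC_trans unfolding b by blast
    show "blk (\<Inter>F) i j" if h: "i < j" "j < k" "k < l" "blk (\<Inter>F) i k" "blk (\<Inter>F) j l" for i j k l
      unfolding b
    proof
      fix X assume "X \<in> F"
      then show "blk X i j" using NC_cross[of X n, OF _ h(1-3)] h(4,5) assms(1) unfolding b by blast
    qed
  qed
qed

text \<open>By noncrossing, only the block of the chord itself can meet both sides. The half-open
  test leaves \<open>i\<close> inside and \<open>j\<close> outside, so that block splits into the
  part of \<open>i\<close> and the part of \<open>j\<close>.\<close>

lemma cut_separated:
  assumes X: "X \<in> NC n" and s: "(i, j) \<in> X" and ab: "blk X a b"
    and sep: "i \<le> a" "a < j" "\<not> (i \<le> b \<and> b < j)"
  shows "blk (cut (i, j) X) a i" "blk (cut (i, j) X) b j"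
proof -
  have ij: "i < j" "blk X i j" using NC_less[OF X s] s by (auto simp: blk_def)
  have "blk X a i"
  proof (cases "a = i \<or> b = j")
    case True
    then show ?thesis using NC_trans[OF X] ij ab blk_sym by (metis blk_refl)
  next
    case False
    then have a: "i < a" using sep by simp
    show ?thesis
    proof (cases "b < i")
      case True
      have "blk X b i" using NC_cross[OF X True a sep(2)] ab ij blk_sym by blast
      then show ?thesis using NC_trans[OF X] ab by blast
    next
      case nb: False
      then have "j < b" using sep False by auto
      then show ?thesis using NC_cross[OF X a sep(2)] ab ij blk_sym by blast
    qed
  qed
  moreover from this have "blk X b j" using NC_trans[OF X] ab ij blk_sym by meson
  ultimately show "blk (cut (i, j) X) a i" "blk (cut (i, j) X) b j" unfolding blk_cut using sep ij by auto
qed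

lemma cut_closure:
  assumes X: "X \<in> NC n" and s: "(i, j) \<in> X" and ab: "blk X a b" and nb: "\<not> blk (cut (i, j) X) a b"
  shows "blk (cut (i, j) X) a i \<and> blk (cut (i, j) X) b j \<or> blk (cut (i, j) X) a j \<and> blk (cut (i, j) X) b i"
proof -
  have "(i \<le> a \<and> a < j) \<noteq> (i \<le> b \<and> b < j)" using ab nb unfolding blk_cut by simp
  then show ?thesis
    using cut_separated[OF X s ab] cut_separated[OF X s blk_sym[OF ab]] by auto
qed

section \<open>Runs of cuts and the Kreweras complement\<close>

lemma run_cut_mono: "run (\<lambda>X. X) cut w X = Some Y \<Longrightarrow> X \<subseteq> X' \<Longrightarrow> run (\<lambda>X. X) cut w X' = Some {t \<in> X'. \<forall>s\<in>set w. t \<in> sd s}"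
proof (induction w arbitrary: X X')
  case (Cons s w)
  then have s: "s \<in> X" "run (\<lambda>X. X) cut w (cut s X) = Some Y" by (auto split: if_splits)
  have "cut s X \<subseteq> cut s X'" using Cons.prems unfolding cut_def by blast
  then have "run (\<lambda>X. X) cut w (cut s X') = Some {t \<in> cut s X'. \<forall>s\<in>set w. t \<in> sd s}" using Cons.IH s by blast
  moreover have "{t \<in> cut s X'. \<forall>s\<in>set w. t \<in> sd s} = {t \<in> X'. \<forall>s\<in>set (s # w). t \<in> sd s}"
    unfolding cut_def by auto
  ultimately show ?case using s Cons.prems by auto
qed simp

lemma run_cut_set: "run (\<lambda>X. X) cut w X = Some Y \<Longrightarrow> set w \<subseteq> X"
proof (induction w arbitrary: X)
  case (Cons s w)
  then have "s \<in> X" "set w \<subseteq> cut s X" by (auto split: if_splits)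
  then show ?case unfolding cut_def by auto
qed simp

text \<open>Nonseparation as a parity condition, independent of the order of \<open>u\<close> and
  \<open>v\<close>. For fixed \<open>x\<close> and \<open>y\<close> it is an equivalence relation in
  \<open>u\<close> and \<open>v\<close>, so it passes from chords to blocks.\<close>

definition nsep :: "nat \<Rightarrow> nat \<Rightarrow> nat \<Rightarrow> nat \<Rightarrow> bool" where
  "nsep u v x y \<longleftrightarrow> ((u \<le> x) = (v \<le> x)) = ((u \<le> y) = (v \<le> y))"

lemma sd_nsep: "i < j \<Longrightarrow> (x, y) \<in> sd (i, j) \<longleftrightarrow> nsep i j x y"
  by (auto simp: sd_iff nsep_def)

lemma nsep_sym: "nsep u v x y \<Longrightarrow> nsep v u x y" and nsep_trans: "nsep u v x y \<Longrightarrow> nsep v w x y \<Longrightarrow> nsep u w x y"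
  and nsep_refl: "nsep u u x y"
  unfolding nsep_def by auto

text \<open>The letters of a word for \<open>X\<close> generate its blocks as an equivalence
  relation, since each cut splits a block into two pieces that its letter reconnects.\<close>

lemma run_cut_nsep:
  "X \<in> NC n \<Longrightarrow> run (\<lambda>X. X) cut w X = Some {} \<Longrightarrow> \<forall>s\<in>set w. (x, y) \<in> sd s \<Longrightarrow> blk X a b \<Longrightarrow> nsep a b x y"
proof (induction w arbitrary: X a b)
  case Nil
  then show ?case by (simp add: blk_def nsep_refl)
next
  case (Cons s w)
  then have s: "s \<in> X" "run (\<lambda>X. X) cut w (cut s X) = Some {}" by (auto split: if_splits)
  obtain i j where ij: "s = (i, j)" by (cases s)
  have lt: "i < j" using NC_less[OF Cons.prems(1)] s ij by blast
  have IH: "nsep a b x y" if "blk (cut s X) a b" for a b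
    using Cons.IH[OF cut_NC[OF Cons.prems(1)] s(2)] Cons.prems(3) that by simp
  have sij: "nsep i j x y" using Cons.prems(3) sd_nsep[OF lt] ij by simp
  show ?case
  proof (cases "blk (cut s X) a b")
    case False
    then have "blk (cut s X) a i \<and> blk (cut s X) b j \<or> blk (cut s X) a j \<and> blk (cut s X) b i"
      using cut_closure[OF Cons.prems(1) _ Cons.prems(4)] s(1) unfolding ij by blast
    then show ?thesis using IH sij nsep_sym nsep_trans by meson
  qed (rule IH)
qed

lemma run_cut_kr:
  assumes X: "X \<in> NC n" and w: "run (\<lambda>X. X) cut w X = Some {}"
  shows "run (\<lambda>X. X) cut w (gens Dual n) = Some (kr n X)"
proof -
  have "{t \<in> gens Dual n. \<forall>s\<in>set w. t \<in> sd s} = kr n X"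
  proof
    show "{t \<in> gens Dual n. \<forall>s\<in>set w. t \<in> sd s} \<subseteq> kr n X"
    proof
      fix t assume t: "t \<in> {t \<in> gens Dual n. \<forall>s\<in>set w. t \<in> sd s}"
      obtain x y where xy: "t = (x, y)" by (cases t)
      have "t \<in> sd s" if s: "s \<in> X" for s
      proof -
        obtain i j where ij: "s = (i, j)" by (cases s)
        have "blk X i j" using s ij by (simp add: blk_def)
        then have "nsep i j x y" using run_cut_nsep[OF X w] t xy by blast
        then show ?thesis using sd_nsep[of i j x y] NC_less[OF X] s ij xy by blast
      qed
      then show "t \<in> kr n X" using t unfolding kr_def by blast
    qed
    show "kr n X \<subseteq> {t \<in> gens Dual n. \<forall>s\<in>set w. t \<in> sd s}"
      using run_cut_set[OF w] unfolding kr_def by blast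
  qed
  then show ?thesis using run_cut_mono[OF w NC_sub[OF X]] by simp
qed

text \<open>The inverse of a cut: the blocks of \<open>i\<close> and \<open>j\<close> are united. As
  no block of \<open>X\<close> meets both sides of the chord, a crossing with the united block would
  already be one with the block of \<open>i\<close> or of \<open>j\<close>.\<close>

lemma merge_NC:
  assumes X: "X \<in> NC n" and s: "(i, j) \<in> gens Dual n" and sub: "X \<subseteq> sd (i, j)"
  shows "\<exists>Y\<in>NC n. (i, j) \<in> Y \<and> cut (i, j) Y = X"
proof -
  define m where "m a \<longleftrightarrow> blk X a i \<or> blk X a j" for a
  define Y where "Y = {(a, b) \<in> gens Dual n. blk X a b \<or> m a \<and> m b}"
  have ij: "1 \<le> i" "i < j" "j \<le> n" using s gens_Dual_iff by auto
  have side: "(i \<le> a \<and> a < j) = (i \<le> b \<and> b < j)" if "blk X a b" for a b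
    using that sub unfolding blk_def by (auto simp: sd_iff)
  have inv: "m a \<longleftrightarrow> m b" if "blk X a b" for a b
    using that NC_trans[OF X] blk_sym unfolding m_def by blast
  have rng: "1 \<le> a \<and> a \<le> n" if "m a" for a
    using that ij NC_less[OF X] unfolding m_def blk_def by fastforce
  have rngX: "a = b \<or> 1 \<le> a \<and> a \<le> n" if "blk X a b" for a b
    using that NC_less[OF X] unfolding blk_def by fastforce
  have bY: "blk Y a b \<longleftrightarrow> blk X a b \<or> m a \<and> m b" for a b
  proof (cases a b rule: linorder_cases)
    case less
    then have "blk Y a b \<longleftrightarrow> (a, b) \<in> Y" unfolding blk_def Y_def gens_Dual_iff by auto
    also have "\<dots> \<longleftrightarrow> blk X a b \<or> m a \<and> m b"
      using less rng[of a] rng[of b] rngX[of a b] rngX[of b a] blk_sym[of X] unfolding Y_def gens_Dual_iff by auto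
    finally show ?thesis .
  next
    case greater
    then have "blk Y a b \<longleftrightarrow> (b, a) \<in> Y" unfolding blk_def Y_def gens_Dual_iff by auto
    also have "\<dots> \<longleftrightarrow> blk X a b \<or> m a \<and> m b"
      using greater rng[of a] rng[of b] rngX[of a b] rngX[of b a] blk_sym[of X] unfolding Y_def gens_Dual_iff by auto
    finally show ?thesis .
  qed simp
  have mI: "i \<le> a \<and> a < j" if "blk X a i" for a using side[OF that] ij by simp
  have mJ: "\<not> (i \<le> a \<and> a < j)" if "blk X a j" for a using side[OF that] ij by simp
  note cross = NC_cross[OF X]
  have "Y \<in> NC n"
  proof (rule NCI)
    show "Y \<subseteq> gens Dual n" unfolding Y_def by blast
    show "blk Y a d" if "blk Y a b" "blk Y b d" for a b d
      using that inv NC_trans[OF X] unfolding bY by blast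
    fix a b d e assume lt: "a < b" "b < d" "d < e" and ad: "blk Y a d" and be: "blk Y b e"
    \<comment> \<open>Only the last two cases need work: one of the two chords lies in the united
      block and the other outside it.\<close>
    consider "blk X a d" "blk X b e" | "m a" "m b" | "blk X a d" "\<not> m a" "m b" "m e" | "m a" "m d" "blk X b e" "\<not> m b"
      using ad be inv unfolding bY by blast
    then show "blk Y a b"
    proof cases
      case 1
      then show ?thesis using cross[OF lt] unfolding bY by blast
    next
      case 2
      then show ?thesis unfolding bY by blast
    next
      case 3
      have nmd: "\<not> m d" using 3 inv by blast
      have ne: "a \<noteq> i" "a \<noteq> j" "d \<noteq> i" "d \<noteq> j" using 3 nmd unfolding m_def by auto
      consider "blk X b e" | "blk X b i" "blk X e j" | "blk X b j" "blk X e i"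
        using 3 NC_trans[OF X] blk_sym unfolding m_def by blast
      then show ?thesis
      proof cases
        case be: 1
        then show ?thesis using cross[OF lt] 3 unfolding bY by blast
      next
        case be: 2
        have b: "i \<le> b" "b < j" using mI be by auto
        show ?thesis
        proof (cases "i \<le> a")
          case True
          then have "blk X i a" using cross[of i a b d] ne lt be 3 blk_sym[of X] by auto
          then have "m a" unfolding m_def using blk_sym by blast
          then show ?thesis using 3 by blast
        next
          case False
          then have "j < d" using side[OF 3(1)] ne b lt by auto
          then have "blk X a j" using cross[of a j d e] lt b be 3 blk_sym[of X] by auto
          then have "m a" unfolding m_def by blast
          then show ?thesis using 3 by blast
        qed
      next
        case be: 3
        have "\<not> (i \<le> b \<and> b < j)" "i \<le> e" "e < j" using mI mJ be by auto
        then have "b < i" using lt by simp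
        then have "d < j" using side[OF 3(1)] lt \<open>e < j\<close> by auto
        then have "blk X a b" using cross[of a b d j] lt be 3 by auto
        then show ?thesis unfolding bY by blast
      qed
    next
      case 4
      have nme: "\<not> m e" using 4 inv by blast
      have ne: "b \<noteq> i" "b \<noteq> j" "e \<noteq> i" "e \<noteq> j" using 4 nme unfolding m_def by auto
      consider "blk X a d" | "blk X a i" "blk X d j" | "blk X a j" "blk X d i"
        using 4 NC_trans[OF X] blk_sym unfolding m_def by blast
      then show ?thesis
      proof cases
        case ad: 1
        then show ?thesis using cross[OF lt] 4 unfolding bY by blast
      next
        case ad: 2
        have a: "i \<le> a" "a < j" "\<not> (i \<le> d \<and> d < j)" using mI mJ ad by auto
        then have "j \<le> d" using lt by simp
        then have "j < b" using side[OF 4(3)] lt a ne by auto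
        then have "blk X j b" using cross[of j b d e] lt ad 4 blk_sym[of X] by auto
        then have "m b" unfolding m_def using blk_sym by blast
        then show ?thesis using 4 by blast
      next
        case ad: 3
        have d: "i \<le> d" "d < j" "\<not> (i \<le> a \<and> a < j)" using mI mJ ad by auto
        then have ai: "a < i" using lt by simp
        show ?thesis
        proof (cases "i \<le> b")
          case True
          then have "blk X i b" using cross[of i b d e] ne lt ad 4 blk_sym[of X] by auto
          then have "m b" unfolding m_def using blk_sym by blast
          then show ?thesis using 4 by blast
        next
          case False
          then have "j < e" using side[OF 4(3)] lt d ne by auto
          then have "blk X a b" using cross[of a b j e] lt ad 4 False ij by auto
          then show ?thesis unfolding bY by blast
        qed
      qed
    qed
  qed
  moreover have "(i, j) \<in> Y" unfolding Y_def using s by (simp add: m_def)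
  moreover have "cut (i, j) Y = X"
  proof
    show "X \<subseteq> cut (i, j) Y"
    proof
      fix t assume t: "t \<in> X"
      obtain a b where ab: "t = (a, b)" by (cases t)
      have "blk X a b" using t ab by (simp add: blk_def)
      then show "t \<in> cut (i, j) Y" using t ab sub NC_sub[OF X] unfolding cut_def Y_def by auto
    qed
    show "cut (i, j) Y \<subseteq> X"
    proof
      fix t assume t: "t \<in> cut (i, j) Y"
      obtain a b where ab: "t = (a, b)" by (cases t)
      have h: "(a, b) \<in> gens Dual n" "blk X a b \<or> m a \<and> m b" "(i \<le> a \<and> a < j) = (i \<le> b \<and> b < j)"
        using t ab unfolding cut_def Y_def by (auto simp: sd_iff)
      have "blk X a b"
      proof (rule ccontr)
        assume "\<not> blk X a b"
        then have "blk X a i \<and> blk X b j \<or> blk X a j \<and> blk X b i"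
          using h(2) NC_trans[OF X] blk_sym unfolding m_def by blast
        then show False using mI mJ h(3) by blast
      qed
      then show "t \<in> X" using NC_blk[OF X, of a b] h(1) ab gens_Dual_iff by blast
    qed
  qed
  ultimately show ?thesis by blast
qed

section \<open>Relations between chords\<close>

lemma rels_Dual_cases:
  assumes "(u, v) \<in> rels Dual n"
  obtains (tri1) i j l where "u = [(i, j), (j, l)]" "v = [(j, l), (i, l)]" "1 \<le> i" "i < j" "j < l" "l \<le> n"
  | (tri2) i j l where "u = [(j, l), (i, l)]" "v = [(i, l), (i, j)]" "1 \<le> i" "i < j" "j < l" "l \<le> n"
  | (comm) i j l m where "u = [(i, j), (l, m)]" "v = [(l, m), (i, j)]" "1 \<le> i" "i < j" "j \<le> n" "1 \<le> l" "l < m" "m \<le> n"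
      "j < l \<or> i < l \<and> m < j"
proof -
  have sg: "sg a b = (a, b)" "sg b a = (a, b)" if "a < b" for a b using that by (auto simp: sg_def)
  show ?thesis using assms unfolding rels_def mkind.case
  proof (elim UnE)
    assume "(u, v) \<in> {([sg i j, sg j k], [sg j k, sg k i]) | i j k. 1 \<le> i \<and> i < j \<and> j < k \<and> k \<le> n}"
    then obtain i j l where "u = [sg i j, sg j l]" "v = [sg j l, sg l i]" "1 \<le> i" "i < j" "j < l" "l \<le> n" by blast
    then show thesis using tri1[of i j l] sg by simp
  next
    assume "(u, v) \<in> {([sg j k, sg k i], [sg k i, sg i j]) | i j k. 1 \<le> i \<and> i < j \<and> j < k \<and> k \<le> n}"
    then obtain i j l where "u = [sg j l, sg l i]" "v = [sg l i, sg i j]" "1 \<le> i" "i < j" "j < l" "l \<le> n" by blast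
    then show thesis using tri2[of j l i] sg by simp
  next
    assume "(u, v) \<in> {([sg i j, sg k l], [sg k l, sg i j]) | i j k l.
            1 \<le> i \<and> i < j \<and> j \<le> n \<and> 1 \<le> k \<and> k < l \<and> l \<le> n \<and>
            ((i < j \<and> j < k \<and> k < l) \<or> (i < k \<and> k < l \<and> l < j))}"
    then obtain i j l m where "u = [sg i j, sg l m]" "v = [sg l m, sg i j]" "1 \<le> i" "i < j" "j \<le> n" "1 \<le> l" "l < m" "m \<le> n"
      "j < l \<or> i < l \<and> m < j" by blast
    then show thesis using comm[of i j l m] sg by simp
  qed
qed

lemma rels_DualI:
  "1 \<le> i \<Longrightarrow> i < j \<Longrightarrow> j < l \<Longrightarrow> l \<le> n \<Longrightarrow> ([(i, j), (j, l)], [(j, l), (i, l)]) \<in> rels Dual n"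
  "1 \<le> i \<Longrightarrow> i < j \<Longrightarrow> j < l \<Longrightarrow> l \<le> n \<Longrightarrow> ([(j, l), (i, l)], [(i, l), (i, j)]) \<in> rels Dual n"
  "1 \<le> i \<Longrightarrow> i < j \<Longrightarrow> j \<le> n \<Longrightarrow> 1 \<le> l \<Longrightarrow> l < m \<Longrightarrow> m \<le> n \<Longrightarrow> j < l \<or> i < l \<and> m < j \<Longrightarrow>
    ([(i, j), (l, m)], [(l, m), (i, j)]) \<in> rels Dual n"
proof -
  have sg: "sg a b = (a, b)" "sg b a = (a, b)" if "a < b" for a b using that by (auto simp: sg_def)
  show "([(i, j), (j, l)], [(j, l), (i, l)]) \<in> rels Dual n" if "1 \<le> i" "i < j" "j < l" "l \<le> n"
  proof -
    have "([(i, j), (j, l)], [(j, l), (i, l)]) = ([sg i j, sg j l], [sg j l, sg l i])" using that sg by simp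
    then show ?thesis unfolding rels_def mkind.case using that by blast
  qed
  show "([(j, l), (i, l)], [(i, l), (i, j)]) \<in> rels Dual n" if "1 \<le> i" "i < j" "j < l" "l \<le> n"
  proof -
    have "([(j, l), (i, l)], [(i, l), (i, j)]) = ([sg j l, sg l i], [sg l i, sg i j])" using that sg by simp
    then show ?thesis unfolding rels_def mkind.case using that by blast
  qed
  show "([(i, j), (l, m)], [(l, m), (i, j)]) \<in> rels Dual n"
    if "1 \<le> i" "i < j" "j \<le> n" "1 \<le> l" "l < m" "m \<le> n" "j < l \<or> i < l \<and> m < j"
  proof -
    have "([(i, j), (l, m)], [(l, m), (i, j)]) = ([sg i j, sg l m], [sg l m, sg i j])" using that sg by simp
    then show ?thesis unfolding rels_def mkind.case using that by blast
  qed
qed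

lemma run_two: "run (\<lambda>X. X) cut [s, t] X = (if s \<in> X \<and> t \<in> X \<and> t \<in> sd s then Some (X \<inter> sd s \<inter> sd t) else None)"
  by (simp add: cut_def)

lemma run_tri:
  assumes X: "X \<in> NC n" and lt: "i < j" "j < l"
  shows "run (\<lambda>X. X) cut [(i, j), (j, l)] X = run (\<lambda>X. X) cut [(j, l), (i, l)] X"
    "run (\<lambda>X. X) cut [(j, l), (i, l)] X = run (\<lambda>X. X) cut [(i, l), (i, j)] X"
proof -
  have il: "i < l" using lt by simp
  note iff = NC_blk[OF X lt(1), symmetric] NC_blk[OF X lt(2), symmetric] NC_blk[OF X il, symmetric]
  have mem: "(i, j) \<in> X \<and> (j, l) \<in> X \<longleftrightarrow> (j, l) \<in> X \<and> (i, l) \<in> X" "(j, l) \<in> X \<and> (i, l) \<in> X \<longleftrightarrow> (i, l) \<in> X \<and> (i, j) \<in> X"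
    unfolding iff using NC_trans[OF X] blk_sym by meson+
  have sd: "(j, l) \<in> sd (i, j)" "(i, l) \<in> sd (j, l)" "(i, j) \<in> sd (i, l)" using lt by (auto simp: sd_iff)
  have eq: "sd (i, j) \<inter> sd (j, l) = sd (j, l) \<inter> sd (i, l)" "sd (j, l) \<inter> sd (i, l) = sd (i, l) \<inter> sd (i, j)"
    using lt by (auto simp: sd_iff)
  show "run (\<lambda>X. X) cut [(i, j), (j, l)] X = run (\<lambda>X. X) cut [(j, l), (i, l)] X"
    unfolding run_two using mem(1) sd eq(1) by (auto simp: Int_assoc)
  show "run (\<lambda>X. X) cut [(j, l), (i, l)] X = run (\<lambda>X. X) cut [(i, l), (i, j)] X"
    unfolding run_two using mem(2) sd eq(2) by (auto simp: Int_assoc)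
qed

text \<open>Disjoint or nested chords commute, and chords with a common endpoint lie in a triangle
  of relations. Crossing chords head no relation, but noncrossing puts them in one block, where the
  chord \<open>(i, l)\<close> links them.\<close>

lemma Dual_conn:
  assumes X: "X \<in> NC n" and s: "s \<in> X" and t: "t \<in> X"
  shows "(s, t) \<in> {(a, b). a \<in> X \<and> b \<in> X \<and> (\<exists>u v. (a # u, b # v) \<in> rels Dual n \<or> (b # v, a # u) \<in> rels Dual n)}\<^sup>*"
    (is "_ \<in> ?R\<^sup>*")
proof -
  have sym: "(b, a) \<in> ?R\<^sup>*" if "(a, b) \<in> ?R\<^sup>*" for a b
  proof -
    have "sym ?R" unfolding sym_def by blast
    then show ?thesis using that by (blast intro: symD[OF sym_rtrancl])
  qed
  have tri: "((i, j), (j, l)) \<in> ?R\<^sup>* \<and> ((j, l), (i, l)) \<in> ?R\<^sup>* \<and> ((i, j), (i, l)) \<in> ?R\<^sup>*"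
    if h: "i < j" "j < l" "(i, j) \<in> X" "(j, l) \<in> X" "(i, l) \<in> X" for i j l
  proof -
    have b: "1 \<le> i" "l \<le> n" using NC_less[OF X] h by blast+
    have 1: "((i, j), (j, l)) \<in> ?R" using rels_DualI(1)[OF b(1) h(1,2) b(2)] h by blast
    have 2: "((j, l), (i, l)) \<in> ?R" using rels_DualI(2)[OF b(1) h(1,2) b(2)] h by blast
    show ?thesis using 1 2 by (meson r_into_rtrancl rtrancl_trans)
  qed
  have tri': "((i, j), (j, l)) \<in> ?R\<^sup>*" "((j, l), (i, l)) \<in> ?R\<^sup>*" "((i, j), (i, l)) \<in> ?R\<^sup>*"
    if h: "i < j" "j < l" "blk X i j" "blk X j l" for i j l
  proof -
    have "blk X i l" using NC_trans[OF X] h by blast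
    then show "((i, j), (j, l)) \<in> ?R\<^sup>*" "((j, l), (i, l)) \<in> ?R\<^sup>*" "((i, j), (i, l)) \<in> ?R\<^sup>*"
      using tri[OF h(1,2)] NC_blk[OF X] h by (metis order_less_trans)+
  qed
  have main: "((i, j), (l, m)) \<in> ?R\<^sup>*" if h: "(i, j) \<in> X" "(l, m) \<in> X" "i < l \<or> i = l \<and> j < m" for i j l m
  proof -
    have lt: "1 \<le> i" "i < j" "j \<le> n" "1 \<le> l" "l < m" "m \<le> n" using NC_less[OF X] h by blast+
    have blk: "blk X i j" "blk X l m" using h by (auto simp: blk_def)
    consider "i = l" "j < m" | "i < l" "j = m" | "i < l" "j = l" | "i < l" "j < l \<or> m < j" | "i < l" "l < j" "j < m"
      using h(3) by linarith
    then show ?thesis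
    proof cases
      case 1
      then have "blk X j m" using NC_trans[OF X] blk blk_sym by meson
      then show ?thesis using tri'(3)[of i j m] 1 lt blk by simp
    next
      case 2
      then have "blk X i l" using NC_trans[OF X] blk blk_sym by meson
      then show ?thesis using tri'(2)[of i l m] 2 lt blk sym by simp
    next
      case 3
      then show ?thesis using tri'(1)[of i j m] lt blk by simp
    next
      case 4
      then have "([(i, j), (l, m)], [(l, m), (i, j)]) \<in> rels Dual n" using rels_DualI(3) lt by blast
      then show ?thesis using h by (intro r_into_rtrancl) blast
    next
      case 5
      have "blk X i l" using NC_cross[OF X 5] blk by blast
      moreover from this have "blk X l j" using NC_trans[OF X] blk blk_sym by meson
      ultimately have "((i, l), (i, j)) \<in> ?R\<^sup>*" "((i, l), (l, m)) \<in> ?R\<^sup>*"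
        using tri'(3)[of i l j] tri'(1)[of i l m] 5 lt blk by auto
      then show ?thesis using sym rtrancl_trans by meson
    qed
  qed
  obtain i j where ij: "s = (i, j)" by (cases s)
  obtain l m where lm: "t = (l, m)" by (cases t)
  consider "s = t" | "i < l \<or> i = l \<and> j < m" | "l < i \<or> l = i \<and> m < j" using ij lm by (auto, linarith)
  then show ?thesis using main[of i j l m] main[of l m i j] sym s t unfolding ij lm by cases auto
qed

text \<open>Conjugation by \<open>\<Delta>\<close> rotates chords by one step, with \<open>0\<close>
  read as \<open>n\<close>. A short chord \<open>(a, a + 1)\<close> not crossing
  \<open>(i, j)\<close> excludes \<open>a\<close> as an endpoint; if \<open>i \<noteq> 1\<close>,
  the chord \<open>(i - 1, j)\<close> settles the remaining choice.\<close>

lemma kr_atom: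
  assumes s: "(i, j) \<in> gens Dual n" and t: "(x, y) \<in> kr n (cut (i, j) (gens Dual n))"
  shows "(x, y) = (if i = 1 then (j - 1, n) else (i - 1, j - 1))"
proof -
  have ij: "1 \<le> i" "i < j" "j \<le> n" using s gens_Dual_iff by auto
  have xy: "1 \<le> x" "x < y" "y \<le> n" using t gens_Dual_iff unfolding kr_def by auto
  have K: "(x, y) \<in> sd (a, b)" if "1 \<le> a" "a < b" "b \<le> n" "(a, b) \<in> sd (i, j)" for a b
    using t that gens_Dual_iff unfolding kr_def cut_def by blast
  have ne: "x \<noteq> a \<and> y \<noteq> a" if a: "1 \<le> a" "Suc a \<le> n" "Suc a \<noteq> i" "Suc a \<noteq> j" for a
  proof -
    have "(a, Suc a) \<in> sd (i, j)" using a by (auto simp: sd_iff)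
    then have "(x, y) \<in> sd (a, Suc a)" using K a by simp
    then show ?thesis using xy by (auto simp: sd_iff)
  qed
  have "Suc x = i \<or> Suc x = j" using ne[of x] xy by auto
  then have x: "x = i - 1 \<or> x = j - 1" by auto
  have "Suc y = i \<or> Suc y = j \<or> y = n" using ne[of y] xy by (cases "y = n") auto
  then have y: "y = i - 1 \<or> y = j - 1 \<or> y = n" by auto
  show ?thesis
  proof (cases "i = 1")
    case True
    then show ?thesis using x y xy ij by auto
  next
    case False
    have "(i - 1, j) \<in> sd (i, j)" using False ij by (auto simp: sd_iff)
    then have "(x, y) \<in> sd (i - 1, j)" using K[of "i - 1" j] False ij by auto
    then show ?thesis using x y xy ij False by (auto simp: sd_iff)
  qed
qed

lemma Dual_germ: "germ Dual n (NC n) (\<lambda>X. X) cut {} (gens Dual n) card (kr n)"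
proof -
  interpret germ0 Dual n "NC n" "\<lambda>X. X" cut "{}" "gens Dual n" card "kr n"
  proof
    show "{} \<in> NC n" "gens Dual n \<in> NC n" by (rule empty_NC, rule gens_NC)
  next
    fix X assume "X \<in> NC n"
    then show "X \<subseteq> gens Dual n" by (rule NC_sub)
  next
    fix s X assume X: "X \<in> NC n" and s: "s \<in> X"
    show "cut s X \<in> NC n" using cut_NC[OF X] .
    obtain i j where ij: "s = (i, j)" by (cases s)
    have "s \<notin> sd s" using NC_less[OF X] s ij by (auto simp: sd_iff)
    then have "cut s X \<subset> X" using s unfolding cut_def by blast
    then show "card (cut s X) < card X" using NC_finite[OF X] psubset_card_mono by blast
  next
    fix s X assume "X \<in> NC n" "s \<in> gens Dual n" "X \<subseteq> cut s (gens Dual n)"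
    then show "\<exists>Y\<in>NC n. s \<in> Y \<and> cut s Y = X" using merge_NC[of X n "fst s" "snd s"] unfolding cut_def by auto
  next
    fix u v X assume "(u, v) \<in> rels Dual n" and X: "X \<in> NC n"
    then show "run (\<lambda>X. X) cut u X = run (\<lambda>X. X) cut v X"
    proof (cases rule: rels_Dual_cases)
      case (comm i j l m)
      then have "(l, m) \<in> sd (i, j)" "(i, j) \<in> sd (l, m)" by (auto simp: sd_iff)
      then show ?thesis unfolding comm(1,2) run_two by auto
    next
      case (tri1 i j l)
      show ?thesis unfolding tri1(1,2) by (rule run_tri(1)[OF X tri1(4,5)])
    next
      case (tri2 i j l)
      show ?thesis unfolding tri2(1,2) by (rule run_tri(2)[OF X tri2(4,5)])
    qed
  next
    fix s t u v X assume R: "(s # u, t # v) \<in> rels Dual n" and X: "X \<in> NC n" and st: "s \<in> X" "t \<in> X"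
    from R show "run (\<lambda>X. X) cut (s # u) X \<noteq> None"
    proof (cases rule: rels_Dual_cases)
      case (tri1 i j l)
      then have "s # u = [(i, j), (j, l)]" "(j, l) \<in> sd (i, j)" by (auto simp: sd_iff)
      then show ?thesis unfolding \<open>s # u = _\<close> run_two using st tri1 by auto
    next
      case (tri2 i j l)
      then have "s # u = [(j, l), (i, l)]" "(i, l) \<in> sd (j, l)" by (auto simp: sd_iff)
      then show ?thesis unfolding \<open>s # u = _\<close> run_two using st tri2 by auto
    next
      case (comm i j l m)
      then have "s # u = [(i, j), (l, m)]" "(l, m) \<in> sd (i, j)" by (auto simp: sd_iff)
      then show ?thesis unfolding \<open>s # u = _\<close> run_two using st comm by auto
    qed
  next
    fix s t X assume "X \<in> NC n" "s \<in> X" "t \<in> X"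
    then show "(s, t) \<in> {(a, b). a \<in> X \<and> b \<in> X \<and> (\<exists>u v. (a # u, b # v) \<in> rels Dual n \<or> (b # v, a # u) \<in> rels Dual n)}\<^sup>*"
      by (rule Dual_conn)
  next
    fix w X assume "X \<in> NC n" "run (\<lambda>X. X) cut w X = Some {}"
    then show "run (\<lambda>X. X) cut w (gens Dual n) = Some (kr n X)" by (rule run_cut_kr)
  next
    fix s t assume st: "s \<in> gens Dual n" "t \<in> gens Dual n"
      "kr n (cut s (gens Dual n)) \<inter> kr n (cut t (gens Dual n)) \<noteq> {}"
    obtain i j where ij: "s = (i, j)" by (cases s)
    obtain l m where lm: "t = (l, m)" by (cases t)
    obtain x y where xy: "(x, y) \<in> kr n (cut s (gens Dual n))" "(x, y) \<in> kr n (cut t (gens Dual n))"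
      using st(3) by fast
    have "(if i = 1 then (j - 1, n) else (i - 1, j - 1)) = (if l = 1 then (m - 1, n) else (l - 1, m - 1))"
      using kr_atom[of i j n x y] kr_atom[of l m n x y] xy st ij lm by simp
    then show "s = t" using st unfolding ij lm gens_Dual_iff by (auto split: if_splits)
  qed auto
  show ?thesis
  proof
    fix s t assume st: "s \<in> gens Dual n" "t \<in> gens Dual n"
    \<comment> \<open>A reduced word of \<open>J\<close> runs on every larger \<open>X\<close>, so
      inclusion gives divisibility and \<open>J\<close> is the join.\<close>
    define J where "J = \<Inter>{X \<in> NC n. s \<in> X \<and> t \<in> X}"
    have JN: "J \<in> NC n" unfolding J_def using gens_NC st by (intro Inter_NC) auto
    obtain w where w: "run (\<lambda>X. X) cut w J = Some {}" using reduced_ex[OF JN] by blast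
    have "le J X" if "X \<in> NC n" "s \<in> X" "t \<in> X" for X
    proof -
      have "J \<subseteq> X" unfolding J_def using that by blast
      then have "run (\<lambda>X. X) cut w X \<noteq> None" using run_cut_mono[OF w] by simp
      then show ?thesis unfolding le_def using w by blast
    qed
    moreover have "s \<in> J" "t \<in> J" unfolding J_def by auto
    ultimately show "\<exists>j\<in>NC n. s \<in> j \<and> t \<in> j \<and> (\<forall>x\<in>NC n. s \<in> x \<longrightarrow> t \<in> x \<longrightarrow> le j x)" using JN by blast
  qed
qed

section \<open>Paths of arrows between noncrossing partitions\<close>

lemma atom_NC: assumes "s \<in> gens Dual n" shows "{s} \<in> NC n"
proof -
  obtain i j where ij: "s = (i, j)" by (cases s)
  have "i < j" using assms ij gens_Dual_iff by blast
  then show ?thesis using assms unfolding ij by (intro NCI) (auto simp: blk_def)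
qed

lemma Dual_garside: assumes "n \<ge> 2" shows "garside Dual n"
proof -
  interpret germ Dual n "NC n" "\<lambda>X. X" cut "{}" "gens Dual n" card "kr n" by (rule Dual_germ)
  let ?R = "{(x, y). x \<in> NC n \<and> y \<in> NC n \<and> y \<inter> kr n x = {}}"
  have run: "run (\<lambda>X. X) cut [s] {s} = Some {}" if "s \<in> gens Dual n" for s
  proof -
    obtain i j where ij: "s = (i, j)" by (cases s)
    then show ?thesis using that gens_Dual_iff by (auto simp: cut_def sd_iff)
  qed
  show ?thesis
  proof (rule garsideI)
    fix s assume s: "s \<in> \<Sigma>"
    obtain i j where sij: "s = (i, j)" by (cases s)
    have ij: "1 \<le> i" "i < j" "j \<le> n" using s sij gens_Dual_iff by auto
    have "\<exists>z. ({s}, z) \<in> ?R\<^sup>* \<and> card (kr n z) \<le> 1"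
    proof (cases "n = 2")
      \<comment> \<open>There is a single atom, which is \<open>\<Delta>\<close>; its complement is
        empty and the path has length zero.\<close>
      case True
      have "t \<notin> kr n {s}" for t
      proof (cases t)
        case (Pair a b)
        then show ?thesis using True ij sij unfolding kr_def by (auto simp: gens_Dual_iff sd_iff)
      qed
      then have "kr n {s} = {}" by blast
      then show ?thesis by (intro exI[of _ "{s}"]) simp
    next
      case False
      then have n: "3 \<le> n" using assms by simp
      define m where "m = n div 2"
      have m: "1 \<le> m" "Suc m < n" "2 * m \<le> n" "n \<le> 2 * m + 1" using n unfolding m_def by auto
      \<comment> \<open>One chord may follow another if its endpoints are separated by it.\<close>
      have atom: "({(a, b)}, {(c, d)}) \<in> ?R"
        if "(a, b) \<in> gens Dual n" "(c, d) \<in> gens Dual n" "(c, d) \<notin> sd (a, b)" for a b c d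
        using that atom_NC unfolding kr_def by auto
      have g: "(1, n) \<in> gens Dual n" "(2, n) \<in> gens Dual n" "(1, Suc m) \<in> gens Dual n" "(i, j) \<in> gens Dual n"
        using n m ij by (auto simp: gens_Dual_iff)
      \<comment> \<open>Every chord is led to \<open>(1, n)\<close>, through \<open>(1, i)\<close>
        unless \<open>i = 1\<close>, and from there to \<open>(1, Suc m)\<close>, which separates
        the two halves of the points.\<close>
      have "({s}, {(1, n)}) \<in> ?R\<^sup>*"
      proof (cases "i = 1")
        case True
        then show ?thesis using atom[OF g(4) g(1)] ij sij by (auto simp: sd_iff)
      next
        case False
        then have gi: "(1, i) \<in> gens Dual n" using ij by (auto simp: gens_Dual_iff)
        have "({s}, {(1, i)}) \<in> ?R" using atom[OF g(4) gi] False ij unfolding sij by (auto simp: sd_iff)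
        moreover have "({(1, i)}, {(1, n)}) \<in> ?R" using atom[OF gi g(1)] False ij by (auto simp: sd_iff)
        ultimately show ?thesis by (meson converse_rtrancl_into_rtrancl r_into_rtrancl)
      qed
      moreover have "({(1, n)}, {(2, n)}) \<in> ?R" using atom[OF g(1,2)] n by (auto simp: sd_iff)
      moreover have "({(2, n)}, {(1, Suc m)}) \<in> ?R" using atom[OF g(2,3)] n m by (auto simp: sd_iff)
      ultimately have p1: "({s}, {(1, Suc m)}) \<in> ?R\<^sup>*" by (meson rtrancl_into_rtrancl)
      \<comment> \<open>The nested chords of \<open>Y\<close> join the two halves, so they may
        follow \<open>(1, Suc m)\<close>. They separate any two points of the same half, so
        \<open>Z\<close>, whose blocks are the halves, may come next; only the chord
        \<open>(m, n)\<close> can extend it.\<close>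
      define Y where "Y = {(a, b). 1 \<le> a \<and> a \<le> m \<and> a + b = n + 1}"
      define Z where "Z = {(a, b) \<in> gens Dual n. (a \<le> m) = (b \<le> m)}"
      have YG: "Y \<subseteq> gens Dual n" using m by (auto simp: Y_def gens_Dual_iff)
      have Yblk: "blk Y a b \<longleftrightarrow> a = b \<or> 1 \<le> a \<and> 1 \<le> b \<and> a + b = n + 1" for a b
        using m unfolding blk_def Y_def by auto
      have YN: "Y \<in> NC n" by (rule NCI[OF YG]) (auto simp: Yblk)
      have Zblk: "blk Z a b \<longleftrightarrow> a = b \<or> 1 \<le> a \<and> a \<le> n \<and> 1 \<le> b \<and> b \<le> n \<and> (a \<le> m) = (b \<le> m)" for a b
        unfolding blk_def Z_def by (auto simp: gens_Dual_iff)
      have "Z \<subseteq> gens Dual n" unfolding Z_def by blast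
      then have ZN: "Z \<in> NC n" by (rule NCI) (auto simp: Zblk)
      have "y \<notin> kr n {(1, Suc m)}" if y: "y \<in> Y" for y
      proof -
        obtain a b where ab: "y = (a, b)" by (cases y)
        then have "(a, b) \<notin> sd (1, Suc m)" using y m by (auto simp: Y_def sd_iff)
        then show ?thesis using ab unfolding kr_def by simp
      qed
      then have "({(1, Suc m)}, Y) \<in> ?R" using YN atom_NC[OF g(3)] by auto
      moreover have "z \<notin> kr n Y" if z: "z \<in> Z" for z
      proof
        assume K: "z \<in> kr n Y"
        obtain a b where ab: "z = (a, b)" by (cases z)
        have h: "1 \<le> a" "a < b" "b \<le> n" "(a \<le> m) = (b \<le> m)" using z ab by (auto simp: Z_def gens_Dual_iff)
        have sd: "(a, b) \<in> sd y" if "y \<in> Y" for y using K that ab unfolding kr_def by blast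
        show False
        proof (cases "b \<le> m")
          case True
          then have "(b, n + 1 - b) \<in> Y" using h m by (auto simp: Y_def)
          then have "(a, b) \<in> sd (b, n + 1 - b)" by (rule sd)
          then show False using True h m by (auto simp: sd_iff)
        next
          case False
          then have "(n + 1 - b, b) \<in> Y" using h m by (auto simp: Y_def)
          then have "(a, b) \<in> sd (n + 1 - b, b)" by (rule sd)
          then show False using False h m by (auto simp: sd_iff)
        qed
      qed
      then have "(Y, Z) \<in> ?R" using YN ZN by auto
      ultimately have p2: "({s}, Z) \<in> ?R\<^sup>*" using p1 by (meson rtrancl_into_rtrancl)
      have "kr n Z \<subseteq> {(m, n)}"
      proof
        fix t assume t: "t \<in> kr n Z"
        obtain x y where xy: "t = (x, y)" by (cases t)
        have h: "1 \<le> x" "x < y" "y \<le> n" using t xy unfolding kr_def by (auto simp: gens_Dual_iff)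
        have ne: "x \<noteq> a \<and> y \<noteq> a" if a: "1 \<le> a" "Suc a \<le> n" "a \<noteq> m" for a
        proof -
          have "(a, Suc a) \<in> Z" using a by (auto simp: Z_def gens_Dual_iff)
          then have "(x, y) \<in> sd (a, Suc a)" using t xy unfolding kr_def by blast
          then show ?thesis using h by (auto simp: sd_iff)
        qed
        have "x = m" using ne[of x] h by auto
        moreover have "y = n" using ne[of y] h calculation by (cases "y = n") auto
        ultimately show "t \<in> {(m, n)}" using xy by simp
      qed
      then have "card (kr n Z) \<le> 1" using card_mono[of "{(m, n)}" "kr n Z"] by simp
      then show ?thesis using p2 by blast
    qed
    then show "\<exists>x z. x \<in> NC n \<and> run (\<lambda>X. X) cut [s] x = Some {} \<and> (x, z) \<in> ?R\<^sup>* \<and> card (kr n z) \<le> 1"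
      using run[OF s] atom_NC[OF s] by blast
  qed
qed

theorem theorem4p8:
  fixes k :: mkind and n :: nat and p :: real
  assumes "n \<ge> 2" and "p \<ge> 0"
  shows "((\<exists>\<nu>. uniform k n p \<nu>) \<longleftrightarrow> (p \<le> qn k n \<or> p = 1))
    \<and> ((p \<le> qn k n \<or> p = 1) \<longrightarrow> (\<exists>!\<nu>. uniform k n p \<nu>))
    \<and> (\<forall>\<nu>. uniform k n 0 \<nu> \<longrightarrow> \<nu> = return (Bbar k n) (nfs k n (unit_e k n)))
    \<and> (\<forall>\<nu>. uniform k n 1 \<nu> \<longrightarrow> \<nu> = return (Bbar k n) (\<lambda>_. Delta k n))
    \<and> (0 < p \<and> p < qn k n \<longrightarrow>
         (\<forall>\<nu>. uniform k n p \<nu> \<longrightarrow> measure \<nu> (Mimg k n) = 1 \<and>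
              (\<forall>x\<in>Mon k n. measure \<nu> {nfs k n x} = Hn k n p * p ^ blen x))
       \<and> (\<forall>\<nu>. prob_on k n \<nu> \<longrightarrow>
            ((\<forall>x\<in>Mon k n. measure \<nu> {nfs k n x} = Hn k n p * p ^ blen x)
              \<longleftrightarrow> uniform k n p \<nu>)))
    \<and> (p = qn k n \<longrightarrow>
         (\<forall>\<nu>. uniform k n p \<nu> \<longrightarrow> measure \<nu> (bdry k n) = 1)
       \<and> (\<forall>\<nu>. prob_on k n \<nu> \<longrightarrow>
            ((\<forall>x\<in>Mon k n. measure \<nu> (up k n x) = qn k n ^ blen x)
              \<longleftrightarrow> uniform k n p \<nu>)))"
proof -
  have "(1, 2) \<in> gens k n" using assms(1) by (cases k) (auto simp: gens_def)
  moreover have "garside k n" using Artin_garside Dual_garside assms(1) by (cases k) auto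
  ultimately have "nontrivial_garside k n"
    unfolding nontrivial_garside_def nontrivial_garside_axioms_def by blast
  then show ?thesis using assms(2) by (rule nontrivial_garside.uniform_measures)
qed

end
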